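(* Let $k \ge 4$ be an integer. For every real $p$ with $2k < p < 2k+2$, $$\|1 + e(x) - e((k+2)x)\|_{L^p(\mathbb{T})} > \|1 + e(x) + e((k+2)x)\|_{L^p(\mathbb{T})} .$$
   Context: Here $e(x) = e^{2\pi i x}$ and $\mathbb{T} = \mathbb{R}/\mathbb{Z}$ carries normalized Lebesgue measure. For $0<p<\infty$, $\|h\|_{L^p(\mathbb{T})} := \left(\int_{\mathbb{T}} |h(x)|^p\,dx\right)^{1/p}$. *)

theory Defs
  imports "HOL-Analysis.Analysis"
begin

definition circle_exp :: "real \<Rightarrow> complex" where
  "circle_exp x = exp (2 * of_real pi * \<i> * of_real x)"

(* A function on the circle R/Z is given as a 1-periodic function on the reals; integration
   against normalized Lebesgue measure on R/Z is integration over the fundamental domain [0,1).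
   The Bochner integral of a non-integrable function is 0, so this is the L^p norm only for
   h in L^p, in particular for continuous h. *)
definition circle_Lp_norm :: "real \<Rightarrow> (real \<Rightarrow> complex) \<Rightarrow> real" where
  "circle_Lp_norm p h = (LINT x:{0..<1}|lebesgue. norm (h x) powr p) powr (1 / p)"

end

theory Submission
  imports Defs
begin

text \<open>
  Put \<open>q = p/2\<close>, \<open>n = k + 2\<close>, \<open>N = 2n - 1\<close>. With \<open>\<rho> = 2 cos x\<close> the squared moduli of the two trinomials
  are \<open>1 + \<rho>\<^sup>2 \<pm> 2 \<rho> cos (N x)\<close>, so the difference of the two integrals collects the odd
  frequencies \<open>d\<close> of \<open>y \<mapsto> (1 + \<rho>\<^sup>2 + 2 \<rho> cos y) powr q\<close>, each resonating with \<open>cos (d N x)\<close>.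

  The frequencies \<open>d \<ge> 3\<close> are negligible: their total contribution vanishes when \<open>u powr q\<close> is replaced
  by a polynomial of degree less than \<open>3 n\<close>, and the Chebyshev expansion of \<open>u powr q\<close> on \<open>[0, 9]\<close>,
  whose coefficients are explicit products, gives an approximation of that degree with a tiny error.

  The frequency \<open>d = 1\<close> has a sign. Its coefficient is \<open>\<pi> \<rho> H(\<rho>\<^sup>2)\<close> with \<open>H\<close> hypergeometric on \<open>[0, 1]\<close> and on
  \<open>[1, \<infinity>)\<close>, and \<open>cos (N x)\<close> is a Jacobi polynomial in \<open>\<rho>\<^sup>2\<close>; by Rodrigues' formula the integral
  becomes that of a positive weight against the derivative of \<open>H\<close> of order \<open>k + 1\<close>, which is negative
  throughout and explicitly bounded away from 0 on \<open>[2, 3]\<close>. Both estimates contain the factor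
  \<open>(q - k) (k + 1 - q)\<close>, so that they can be compared uniformly in \<open>q\<close>.
\<close>

section \<open>Trigonometric integrals\<close>

text \<open>At both ends of the range, \<open>p = 2k\<close> and \<open>p = 2k+2\<close>, the two
  norms coincide: \<open>u powr q\<close> is then a polynomial of degree below
  \<open>n = k+2\<close>, and an odd frequency \<open>d\<close> can resonate only from degree
  \<open>d * n\<close> on. So there is no gap uniform in \<open>q\<close>, and the main term and the
  error both have to be measured against \<open>(q-k) (k+1-q)\<close>, which vanishes at exactly
  these ends. The number \<open>N\<close> comes from \<open>1 + e(x) = 2 cos(pi x) e(x/2)\<close>:
  relative to \<open>e(n x)\<close> the phase runs at speed \<open>2n-1\<close> in
  \<open>pi x\<close>. With \<open>N = 2m+1\<close> one gets \<open>m = k+1\<close>, the order of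
  the derivative in Rodrigues' formula. The function \<open>H\<close> has different expansions on
  the two sides of 1 and a singularity of exponent \<open>2q+1\<close> there. Its derivatives up to
  order \<open>k+1\<close> remain continuous, so Rodrigues' formula is needed for piecewise smooth
  functions and the matching at 1 has to be proved. The normalising constants (an integral
  \<open>w\<close> for the Jacobi weight, a limit \<open>L\<close> for the cosine series) are never
  evaluated in closed form; each is only bounded from the side that the comparison uses.\<close>

lemma integral_cos_multiple:
  assumes "r \<ge> 1"
  shows "((\<lambda>x. cos (real r * x)) has_integral 0) {0..pi}"
proof -
  have "((\<lambda>x. cos (real r * x)) has_integral (sin (real r * pi) / real r - sin (real r * 0) / real r)) {0..pi}"
    by (rule fundamental_theorem_of_calculus)
      (use assms in \<open>auto intro!: derivative_eq_intros simp: has_real_derivative_iff_has_vector_derivative[symmetric]\<close>)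
  moreover have "sin (real r * pi) = 0" by (simp add: sin_npi mult.commute)
  ultimately show ?thesis by simp
qed

text \<open>Orthogonality: \<open>cos x ^ s\<close> only contains frequencies up to
  \<open>s\<close>. The induction moves one factor \<open>cos x\<close> onto
  \<open>cos (r x)\<close>, which changes \<open>r\<close> by one in either direction.\<close>

lemma integral_cos_multiple_power:
  assumes "s < r"
  shows "((\<lambda>x. cos (real r * x) * cos x ^ s) has_integral 0) {0..pi}"
  using assms
proof (induction s arbitrary: r)
  case 0
  then show ?case using integral_cos_multiple[of r] by simp
next
  case (Suc s)
  then obtain r' where r: "r = Suc r'" and "s < r'" by (cases r) auto
  have "((\<lambda>x. (1/2) * (cos (real (Suc (Suc r')) * x) * cos x ^ s + cos (real r' * x) * cos x ^ s)) has_integral (1/2) * (0 + 0)) {0..pi}"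
    by (intro has_integral_mult_right has_integral_add Suc.IH) (use \<open>s < r'\<close> in auto)
  moreover have "(1/2) * (cos (real (Suc (Suc r')) * x) * cos x ^ s + cos (real r' * x) * cos x ^ s)
      = cos (real r * x) * cos x ^ Suc s" for x
  proof -
    have "cos (real r * x) * cos x = (cos (real r' * x) + cos (real (Suc (Suc r')) * x)) / 2"
      by (simp add: cos_times_cos r algebra_simps)
    then have "cos (real r * x) * cos x * cos x ^ s = (cos (real r' * x) + cos (real (Suc (Suc r')) * x)) / 2 * cos x ^ s"
      by simp
    then show ?thesis by (simp add: algebra_simps)
  qed
  ultimately show ?case by simp
qed

lemma integral_cos_multiple_power_same:
  "((\<lambda>x. cos (real r * x) * cos x ^ r) has_integral (pi / 2 ^ r)) {0..pi}"
proof (induction r)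
  case 0
  then show ?case using has_integral_const_real[of "1::real" 0 pi] by simp
next
  case (Suc r)
  have "((\<lambda>x. (1/2) * (cos (real (Suc (Suc r)) * x) * cos x ^ r + cos (real r * x) * cos x ^ r)) has_integral (1/2) * (0 + pi / 2 ^ r)) {0..pi}"
    by (intro has_integral_mult_right has_integral_add Suc.IH integral_cos_multiple_power) auto
  moreover have "(1/2) * (cos (real (Suc (Suc r)) * x) * cos x ^ r + cos (real r * x) * cos x ^ r)
      = cos (real (Suc r) * x) * cos x ^ Suc r" for x
  proof -
    have "cos (real (Suc r) * x) * cos x = (cos (real r * x) + cos (real (Suc (Suc r)) * x)) / 2"
      by (simp add: cos_times_cos algebra_simps)
    then have "cos (real (Suc r) * x) * cos x * cos x ^ r = (cos (real r * x) + cos (real (Suc (Suc r)) * x)) / 2 * cos x ^ r"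
      by simp
    then show ?thesis by (simp add: algebra_simps)
  qed
  ultimately show ?case by simp
qed

lemma integral_cos_multiple_cos:
  "((\<lambda>x. cos (real d * x) * cos x) has_integral (if d = 1 then pi / 2 else 0)) {0..pi}"
proof (cases "d = 0")
  case True
  then show ?thesis using integral_cos_multiple[of 1] by simp
next
  case False
  then show ?thesis
    using integral_cos_multiple_power[of 1 d] integral_cos_multiple_power_same[of 1] by auto
qed

text \<open>Green's identity for \<open>cos (r x)\<close> and \<open>cos x ^ (a+2)\<close>: the
  antiderivative \<open>?F\<close> is their Wronskian, and the second derivative of
  \<open>cos x ^ n\<close> is \<open>n (n-1) cos x ^ (n-2) - n^2 cos x ^ n\<close>. The boundary
  terms vanish because \<open>sin\<close> is zero at multiples of \<open>pi\<close>.\<close>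

lemma integral_cos_multiple_power_rec:
  fixes r a :: nat
  defines "M \<equiv> \<lambda>a. integral {0..pi} (\<lambda>x. cos (real r * x) * cos x ^ a)"
  shows "(real (a+2)^2 - real r^2) * M (a+2) = real (a+2) * real (a+1) * M a"
proof -
  let ?F = "\<lambda>x. real r * sin (real r * x) * cos x ^ Suc (a+1) - real (a+2) * cos (real r * x) * cos x ^ Suc a * sin x"
  let ?f = "\<lambda>x. (real r^2 - real (a+2)^2) * (cos (real r * x) * cos x ^ (a+2)) + real (a+2) * real (a+1) * (cos (real r * x) * cos x ^ a)"
  have "(?f has_integral (?F pi - ?F 0)) {0..pi}"
  proof (rule fundamental_theorem_of_calculus)
    fix x :: real assume "x \<in> {0..pi}"
    have s: "sin x * sin x = 1 - cos x * cos x" using sin_cos_squared_add3[of x] by (simp add: algebra_simps)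
    have cp: "((\<lambda>x. cos x ^ Suc n) has_real_derivative - real (Suc n) * cos x ^ n * sin x) (at x)" for n
      by (rule DERIV_cong[OF DERIV_power[OF DERIV_cos]]) (simp add: algebra_simps)
    have sr: "((\<lambda>x. sin (real r * x)) has_real_derivative real r * cos (real r * x)) (at x)"
      and cr: "((\<lambda>x. cos (real r * x)) has_real_derivative - real r * sin (real r * x)) (at x)"
      by (auto intro!: derivative_eq_intros)
    have "(?F has_real_derivative 
       (real r * (real r * cos (real r * x)) * cos x ^ Suc (a+1) - real r * sin (real r * x) * (real (a+2) * cos x ^ (a+1) * sin x))
       - (real (a+2) * (- real r * sin (real r * x)) * cos x ^ (a+1) * sin x + real (a+2) * cos (real r * x) * (cos x ^ (a+1) * cos x - real (a+1) * cos x ^ a * (sin x * sin x)))) (at x)"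
      by (rule DERIV_cong[OF DERIV_diff[OF DERIV_mult[OF DERIV_cmult[OF sr] cp[of "a+1"]] DERIV_mult[OF DERIV_mult[OF DERIV_cmult[OF cr] cp[of a]] DERIV_sin]]])
        (simp add: algebra_simps)
    also have "(real r * (real r * cos (real r * x)) * cos x ^ Suc (a+1) - real r * sin (real r * x) * (real (a+2) * cos x ^ (a+1) * sin x))
       - (real (a+2) * (- real r * sin (real r * x)) * cos x ^ (a+1) * sin x + real (a+2) * cos (real r * x) * (cos x ^ (a+1) * cos x - real (a+1) * cos x ^ a * (sin x * sin x))) = ?f x"
      unfolding s by (simp add: algebra_simps power2_eq_square)
    finally show "(?F has_vector_derivative ?f x) (at x within {0..pi})"
      by (simp add: has_real_derivative_iff_has_vector_derivative[symmetric] has_field_derivative_at_within)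
  qed simp
  moreover have "?F pi - ?F 0 = 0" by (simp add: sin_npi mult.commute)
  ultimately have "(?f has_integral 0) {0..pi}" by simp
  moreover have "(?f has_integral ((real r^2 - real (a+2)^2) * M (a+2) + real (a+2) * real (a+1) * M a)) {0..pi}"
    unfolding M_def by (intro has_integral_mult_right has_integral_add integrable_integral integrable_continuous_real continuous_intros)
  ultimately have "(real r^2 - real (a+2)^2) * M (a+2) + real (a+2) * real (a+1) * M a = 0"
    using has_integral_unique by blast
  then show ?thesis by (simp add: algebra_simps)
qed

text \<open>The recursion of the Beta integral, from the derivative of
  \<open>cos x ^ (a+1) * sin x ^ (b+1)\<close>, which vanishes at both ends.\<close>

lemma integral_cos_power_sin_power_rec:
  fixes a b :: nat
  defines "D \<equiv> \<lambda>a. integral {0..pi} (\<lambda>x. cos x ^ a * sin x ^ b)"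
  shows "real (a+2+b) * D (a+2) = real (a+1) * D a"
proof -
  let ?F = "\<lambda>x. cos x ^ Suc a * sin x ^ Suc b"
  let ?f = "\<lambda>x. real (a+2+b) * (cos x ^ (a+2) * sin x ^ b) - real (a+1) * (cos x ^ a * sin x ^ b)"
  have "(?f has_integral (?F pi - ?F 0)) {0..pi}"
  proof (rule fundamental_theorem_of_calculus)
    fix x :: real assume "x \<in> {0..pi}"
    have s: "sin x * sin x = 1 - cos x * cos x" using sin_cos_squared_add3[of x] by (simp add: algebra_simps)
    have cp: "((\<lambda>x. cos x ^ Suc n) has_real_derivative - real (Suc n) * cos x ^ n * sin x) (at x)" for n
      by (rule DERIV_cong[OF DERIV_power[OF DERIV_cos]]) (simp add: algebra_simps)
    have sp: "((\<lambda>x. sin x ^ Suc n) has_real_derivative real (Suc n) * sin x ^ n * cos x) (at x)" for n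
      by (rule DERIV_cong[OF DERIV_power[OF DERIV_sin]]) simp
    have "(?F has_real_derivative 
       (real (b+1) * cos x ^ (a+2) * sin x ^ b - real (a+1) * cos x ^ a * sin x ^ b * (sin x * sin x))) (at x)"
      by (rule DERIV_cong[OF DERIV_mult[OF cp sp]]) (simp add: algebra_simps)
    also have "(real (b+1) * cos x ^ (a+2) * sin x ^ b - real (a+1) * cos x ^ a * sin x ^ b * (sin x * sin x)) = ?f x"
      unfolding s by (simp add: algebra_simps power2_eq_square)
    finally show "(?F has_vector_derivative ?f x) (at x within {0..pi})"
      by (simp add: has_real_derivative_iff_has_vector_derivative[symmetric] has_field_derivative_at_within)
  qed simp
  then have "(?f has_integral 0) {0..pi}" by simp
  moreover have "(?f has_integral (real (a+2+b) * D (a+2) - real (a+1) * D a)) {0..pi}"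
    unfolding D_def by (intro has_integral_mult_right has_integral_diff integrable_integral integrable_continuous_real continuous_intros)
  ultimately have "real (a+2+b) * D (a+2) - real (a+1) * D a = 0"
    using has_integral_unique by blast
  then show ?thesis by simp
qed

section \<open>Rodrigues' formula\<close>

lemma integral_cos_power_sin_power_pos:
  "0 < integral {0..pi} (\<lambda>x. cos x ^ (2 * a) * sin x ^ (2 * b))"
proof -
  let ?f = "\<lambda>x::real. cos x ^ (2 * a) * sin x ^ (2 * b)"
  have nonneg: "0 \<le> ?f x" for x by (simp add: power_mult)
  have cont: "continuous_on {0..pi} ?f" by (intro continuous_intros)
  have "integral {0..pi} ?f \<noteq> 0"
  proof
    assume "integral {0..pi} ?f = 0"
    then have "(?f has_integral 0) (cbox 0 pi)"
      using integrable_integral[OF integrable_continuous_real[OF cont]] by simp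
    then have "?f (pi/4) = 0"
      by (rule has_integral_0_cbox_imp_0[rotated 2]) (use cont nonneg pi_gt_zero in \<open>auto simp: not_le\<close>)
    then show False by (simp add: cos_45 sin_45)
  qed
  moreover have "0 \<le> integral {0..pi} ?f"
    using nonneg by (intro integral_nonneg integrable_continuous_real cont) auto
  ultimately show ?thesis by simp
qed

text \<open>As functions of \<open>i\<close>, both sides satisfy the same first-order recursion, by
  the two integral recursions above; the case \<open>i = 0\<close> fixes the constant. Dividing by
  the integral \<open>w\<close> instead of its Gamma value makes that case immediate.\<close>

lemma Rodrigues_monomial:
  fixes m i :: nat
  defines "w \<equiv> integral {0..pi} (\<lambda>x. cos x ^ (2*m+2) * sin x ^ (2*m))"
  shows "2 * 4 ^ (m+i) * integral {0..pi} (\<lambda>x. cos (real (2*m+1) * x) * cos x ^ (2*(m+i)+1))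
    = pi / (fact m * w) * (fact (m+i) / fact i * 4 ^ i * integral {0..pi} (\<lambda>x. cos x ^ (2*(m+i)+2) * sin x ^ (2*m)))"
proof (induction i)
  case 0
  have "w > 0" unfolding w_def using integral_cos_power_sin_power_pos[of "m+1" m] by simp
  moreover have "integral {0..pi} (\<lambda>x. cos (real (2*m+1) * x) * cos x ^ (2*m+1)) = pi / 2 ^ (2*m+1)"
    by (rule integral_unique[OF integral_cos_multiple_power_same])
  moreover have "(2::real) ^ (2*m+1) = 2 * 4 ^ m" by (simp add: power_mult)
  ultimately show ?case by (simp add: w_def)
next
  case (Suc i)
  define M where "M a = integral {0..pi} (\<lambda>x. cos (real (2*m+1) * x) * cos x ^ a)" for a
  define D where "D a = integral {0..pi} (\<lambda>x. cos x ^ a * sin x ^ (2*m))" for a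
  define K where "K = pi / (fact m * w)"
  have M: "(real (2*(m+i)+3)^2 - real (2*m+1)^2) * M (2*(m+i)+3) = real (2*(m+i)+3) * real (2*(m+i)+2) * M (2*(m+i)+1)"
    using integral_cos_multiple_power_rec[of "2*(m+i)+1" "2*m+1"] unfolding M_def by (simp add: numeral_eq_Suc)
  have D: "real (2*(m+i)+4+2*m) * D (2*(m+i)+4) = real (2*(m+i)+3) * D (2*(m+i)+2)"
    using integral_cos_power_sin_power_rec[of "2*(m+i)+2" "2*m"] unfolding D_def by (simp add: numeral_eq_Suc)
  have IH: "2 * 4 ^ (m+i) * M (2*(m+i)+1) = K * (fact (m+i) / fact i * 4 ^ i * D (2*(m+i)+2))"
    using Suc unfolding M_def D_def K_def .
  \<comment> \<open>The difference of squares in the recursion for \<open>M\<close> factors as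
    \<open>2 s * 2 t\<close>. The factor in the recursion for \<open>D\<close> is
    \<open>2 t\<close>, and \<open>s\<close> is supplied by the factorials, so everything
    cancels.\<close>
  define s where "s = real i + 1"
  define t where "t = real (2*m+i+2)"
  have st: "s > 0" "t > 0" unfolding s_def t_def by auto
  have "real (2*(m+i)+3)^2 - real (2*m+1)^2 = 4 * s * t"
    unfolding s_def t_def by (simp add: power2_eq_square algebra_simps)
  then have M': "M (2*(m+i)+3) = real (2*(m+i)+3) * real (2*(m+i)+2) * M (2*(m+i)+1) / (4 * s * t)"
    using M st by (simp add: field_simps)
  have "real (2*(m+i)+4+2*m) = 2 * t" unfolding t_def by simp
  then have D': "D (2*(m+i)+4) = real (2*(m+i)+3) * D (2*(m+i)+2) / (2 * t)"
    using D st by (simp add: field_simps)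
  have f: "fact (m + Suc i) = real (m+i+1) * fact (m+i)" "fact (Suc i) = s * (fact i::real)"
    unfolding s_def by (simp_all add: algebra_simps)
  have "2 * 4 ^ (m+Suc i) * M (2*(m+i)+3) 
      = (2 * 4 ^ (m+i) * M (2*(m+i)+1)) * (real (2*(m+i)+3) * real (2*(m+i)+2) / (s * t))"
    unfolding M' power_Suc add_Suc_right by simp
  also have "\<dots> = K * (fact (m+i) / fact i * 4 ^ i * D (2*(m+i)+2)) * (real (2*(m+i)+3) * (2 * real (m+i+1)) / (s * t))"
    unfolding IH by simp
  also have "\<dots> = K * (fact (m+Suc i) / fact (Suc i) * 4 ^ Suc i * D (2*(m+i)+4))"
    unfolding D' f using st by (simp add: field_simps)
  finally show ?case unfolding M_def D_def K_def by (simp add: algebra_simps numeral_eq_Suc)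
qed

text \<open>In the variable \<open>v = 4 cos x ^ 2\<close> this is an \<open>m\<close>-fold
  integration by parts against the Jacobi weight. Checking it on monomials avoids derivatives of the
  weight: below degree \<open>m\<close> both sides are zero, the left one by orthogonality, and from
  degree \<open>m\<close> on \<open>Rodrigues_monomial\<close> applies.\<close>

lemma Rodrigues_poly:
  fixes m :: nat and P :: "real poly"
  defines "w \<equiv> integral {0..pi} (\<lambda>x. cos x ^ (2*m+2) * sin x ^ (2*m))"
  shows "integral {0..pi} (\<lambda>x. cos (real (2*m+1) * x) * (2 * cos x) * poly P (4 * cos x ^ 2))
    = pi / (fact m * w) * integral {0..pi} (\<lambda>x. cos x ^ (2*m+2) * sin x ^ (2*m) * poly ((pderiv ^^ m) P) (4 * cos x ^ 2))"
    (is "?L P = ?R P")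
proof -
  have odd: "2 * cos x * (4 * cos x ^ 2) ^ j = 2 * 4 ^ j * cos x ^ (2*j+1)" for x :: real and j
    by (simp add: power_mult_distrib power_mult)
  have even: "cos x ^ (2*m+2) * (4 * cos x ^ 2) ^ i = 4 ^ i * cos x ^ (2*(m+i)+2)" for x :: real and i
    by (simp add: power_mult_distrib power_mult power_add distrib_left)
  have L: "?L (monom c j) = c * (2 * 4 ^ j * integral {0..pi} (\<lambda>x. cos (real (2*m+1) * x) * cos x ^ (2*j+1)))" for c j
  proof -
    have "cos (real (2*m+1) * x) * (2 * cos x) * poly (monom c j) (4 * cos x ^ 2)
        = (c * (2 * 4 ^ j)) * (cos (real (2*m+1) * x) * cos x ^ (2*j+1))" for x
    proof -
      have "cos (real (2*m+1) * x) * (2 * cos x) * poly (monom c j) (4 * cos x ^ 2)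
          = cos (real (2*m+1) * x) * c * (2 * cos x * (4 * cos x ^ 2) ^ j)" by (simp add: poly_monom)
      then show ?thesis unfolding odd by simp
    qed
    then show ?thesis by (simp only: integral_mult_right mult.assoc)
  qed
  have mono: "?L (monom c j) = ?R (monom c j)" for c j
  proof (cases "j < m")
    case True
    then have "integral {0..pi} (\<lambda>x. cos (real (2*m+1) * x) * cos x ^ (2*j+1)) = 0"
      by (intro integral_unique[OF integral_cos_multiple_power]) simp
    moreover have "(pderiv ^^ m) (monom c j) = 0"
      using True by (intro poly_eqI) (auto simp: coeff_higher_pderiv)
    ultimately show ?thesis unfolding L by simp
  next
    case False
    then obtain i where j: "j = m + i" using le_Suc_ex not_less by blast
    have poch: "pochhammer (of_nat i + 1) m = (fact j / fact i :: real)"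
      using pochhammer_product'[of "1::real" i m] unfolding j
      by (simp add: pochhammer_fact[symmetric] field_simps add.commute)
    have "(pderiv ^^ m) (monom c j) = monom (fact j / fact i * c) i"
      using poch by (intro poly_eqI) (auto simp: coeff_higher_pderiv j add.commute)
    then have "cos x ^ (2*m+2) * sin x ^ (2*m) * poly ((pderiv ^^ m) (monom c j)) (4 * cos x ^ 2)
        = (fact j / fact i * c * 4 ^ i) * (cos x ^ (2*(m+i)+2) * sin x ^ (2*m))" for x
    proof -
      have "cos x ^ (2*m+2) * sin x ^ (2*m) * poly (monom (fact j / fact i * c) i) (4 * cos x ^ 2)
          = sin x ^ (2*m) * (fact j / fact i * c) * (cos x ^ (2*m+2) * (4 * cos x ^ 2) ^ i)" by (simp add: poly_monom)
      then show ?thesis unfolding even \<open>(pderiv ^^ m) (monom c j) = _\<close> by simp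
    qed
    then have "?R (monom c j) = pi / (fact m * w) * (fact j / fact i * c * 4^i * integral {0..pi} (\<lambda>x. cos x ^ (2*(m+i)+2) * sin x ^ (2*m)))"
      by (simp only: integral_mult_right)
    then show ?thesis
      using Rodrigues_monomial[of m i] unfolding w_def L j by (simp only: mult_ac)
  qed
  have add: "?L (P + Q) = ?R (P + Q)" if "?L P = ?R P" "?L Q = ?R Q" for P Q
  proof -
    have "?L (P + Q) = ?L P + ?L Q"
      by (subst integral_add[symmetric]) (auto intro!: integrable_continuous_real continuous_intros simp: algebra_simps)
    also have "\<dots> = ?R P + ?R Q" using that by simp
    also have "\<dots> = ?R (P + Q)" unfolding distrib_left[symmetric]
      by (subst integral_add[symmetric]) (auto intro!: integrable_continuous_real continuous_intros simp: algebra_simps higher_pderiv_add)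
    finally show ?thesis .
  qed
  have "?L (\<Sum>i\<in>A. monom (coeff P i) i) = ?R (\<Sum>i\<in>A. monom (coeff P i) i)" if "finite A" for A
    using that
  proof (induction A)
    case empty
    show ?case using mono[of 0 0] by simp
  next
    case (insert i A)
    then show ?case using add[OF mono[of "coeff P i" i] insert.IH] by simp
  qed
  from this[of "{..degree P}"] show ?thesis by (simp only: poly_as_sum_of_monoms finite_atMost)
qed

section \<open>From polynomials to piecewise smooth functions\<close>

lemma poly_antideriv:
  fixes p :: "real poly"
  obtains P where "pderiv P = p" "poly P 0 = c"
proof
  define P where "P = [:c:] + (\<Sum>i\<le>degree p. monom (coeff p i / real (Suc i)) (Suc i))"
  have sum: "pderiv (sum f A) = (\<Sum>x\<in>A. pderiv (f x))" for f :: "nat \<Rightarrow> real poly" and A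
    using higher_pderiv_sum[of 1 f A] by simp
  have "pderiv P = (\<Sum>i\<le>degree p. monom (coeff p i) i)"
    unfolding P_def by (simp add: pderiv_add sum pderiv_monom pderiv_pCons del: of_nat_Suc)
  then show "pderiv P = p" by (simp only: poly_as_sum_of_monoms)
  show "poly P 0 = c" unfolding P_def by (simp add: poly_sum poly_monom)
qed

lemma Weierstrass_poly:
  fixes f :: "real \<Rightarrow> real"
  assumes "continuous_on {a..b} f" "e > 0"
  obtains p where "\<And>x. x \<in> {a..b} \<Longrightarrow> \<bar>f x - poly p x\<bar> < e"
proof -
  obtain g where g: "real_polynomial_function g" "\<And>x. x \<in> {a..b} \<Longrightarrow> \<bar>f x - g x\<bar> < e"
    using Stone_Weierstrass_real_polynomial_function[of "{a..b}" f e] assms by auto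
  obtain c n where "g = (\<lambda>x. \<Sum>i\<le>n. c i * x ^ i)"
    using g(1) unfolding real_polynomial_function_iff_sum by blast
  then have "g x = poly (\<Sum>i\<le>n. monom (c i) i) x" for x by (simp add: poly_sum poly_monom)
  then show ?thesis using that g(2) by metis
qed

text \<open>The top derivative is approximated by Weierstrass and then integrated \<open>m\<close>
  times; each integration over a length of at most 4 multiplies the error by 4. Continuity of all
  \<open>F i\<close> across the exceptional set \<open>S\<close> is what lets the fundamental
  theorem pass over it.\<close>

lemma piecewise_C_poly_approx:
  fixes F :: "nat \<Rightarrow> real \<Rightarrow> real"
  assumes "\<And>i. i \<le> m \<Longrightarrow> continuous_on {0..4} (F i)" and "finite S"
    and "\<And>i v. i < m \<Longrightarrow> v \<in> {0<..<4} - S \<Longrightarrow> (F i has_real_derivative F (Suc i) v) (at v)"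
    and "e > 0"
  shows "\<exists>P. \<forall>v\<in>{0..4}. \<bar>F 0 v - poly P v\<bar> \<le> 4 ^ m * e \<and> \<bar>F m v - poly ((pderiv ^^ m) P) v\<bar> \<le> e"
  using assms(1,3)
proof (induction m arbitrary: F)
  case 0
  obtain p where "\<And>x. x \<in> {0..4} \<Longrightarrow> \<bar>F 0 x - poly p x\<bar> < e"
    using Weierstrass_poly[OF 0(1)[of 0] \<open>e > 0\<close>] by auto
  then show ?case by (intro exI[of _ p]) (auto intro: less_imp_le)
next
  case (Suc m)
  have "\<exists>P. \<forall>v\<in>{0..4}. \<bar>F (Suc 0) v - poly P v\<bar> \<le> 4 ^ m * e \<and> \<bar>F (Suc m) v - poly ((pderiv ^^ m) P) v\<bar> \<le> e"
    by (rule Suc.IH[of "\<lambda>i. F (Suc i)"]) (use Suc.prems in auto)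
  then obtain P where "\<forall>v\<in>{0..4}. \<bar>F (Suc 0) v - poly P v\<bar> \<le> 4 ^ m * e \<and> \<bar>F (Suc m) v - poly ((pderiv ^^ m) P) v\<bar> \<le> e"
    by blast
  then have P: "\<And>v. v \<in> {0..4} \<Longrightarrow> \<bar>F 1 v - poly P v\<bar> \<le> 4 ^ m * e"
    "\<And>v. v \<in> {0..4} \<Longrightarrow> \<bar>F (Suc m) v - poly ((pderiv ^^ m) P) v\<bar> \<le> e"
    by auto
  \<comment> \<open>The integration constant makes the error vanish at 0, so it is the integral of
    the error one level above.\<close>
  obtain Q where Q: "pderiv Q = P" "poly Q 0 = F 0 0" using poly_antideriv by blast
  have "\<bar>F 0 v - poly Q v\<bar> \<le> 4 ^ Suc m * e" if v: "v \<in> {0..4}" for v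
  proof -
    have sub: "{0..v} \<subseteq> {0..4}" using v by auto
    have "((\<lambda>x. F 1 x - poly P x) has_integral ((F 0 v - poly Q v) - (F 0 0 - poly Q 0))) {0..v}"
    proof (rule fundamental_theorem_of_calculus_interior_strong[OF \<open>finite S\<close>])
      show "0 \<le> v" using v by simp
      show "continuous_on {0..v} (\<lambda>x. F 0 x - poly Q x)"
        using continuous_on_subset[OF Suc.prems(1)[of 0] sub] by (intro continuous_intros) auto
      fix x assume "x \<in> {0<..<v} - S"
      then have "(F 0 has_real_derivative F 1 x) (at x)" using Suc.prems(2)[of 0 x] v by auto
      moreover have "(poly Q has_real_derivative poly P x) (at x)" using poly_DERIV[of Q x] Q(1) by simp
      ultimately show "((\<lambda>x. F 0 x - poly Q x) has_vector_derivative F 1 x - poly P x) (at x)"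
        unfolding has_real_derivative_iff_has_vector_derivative[symmetric] by (rule DERIV_diff)
    qed
    then have "F 0 v - poly Q v = integral {0..v} (\<lambda>x. F 1 x - poly P x)"
      using Q(2) by (simp add: integral_unique)
    also have "\<bar>\<dots>\<bar> \<le> 4 ^ m * e * (v - 0)"
      unfolding real_norm_def[symmetric]
    proof (rule integral_bound)
      show "continuous_on {0..v} (\<lambda>x. F 1 x - poly P x)"
        using continuous_on_subset[OF Suc.prems(1)[of 1] sub] by (intro continuous_intros) auto
      show "norm (F 1 x - poly P x) \<le> 4 ^ m * e" if "x \<in> {0..v}" for x
        using P(1)[of x] that sub by auto
    qed (use v in auto)
    also have "\<dots> \<le> 4 ^ m * e * 4" using v \<open>e > 0\<close> by (intro mult_left_mono) auto
    finally show ?thesis by (simp add: mult_ac)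
  qed
  moreover have "(pderiv ^^ Suc m) Q = (pderiv ^^ m) P" unfolding Q(1)[symmetric] by (simp add: funpow_Suc_right del: funpow.simps)
  ultimately show ?case using P(2) by metis
qed

lemma four_cos_sq_bounds: "4 * cos (x::real) ^ 2 \<in> {0..4}"
  using power_mono[OF abs_cos_le_one[of x] abs_ge_zero, of 2] by simp

text \<open>Both sides are continuous in \<open>F 0\<close> and \<open>F m\<close> for the uniform
  norm, so the identity for polynomials passes to the limit along simultaneous approximations of
  \<open>F 0\<close> and \<open>F m\<close>.\<close>

lemma Rodrigues_piecewise:
  fixes F :: "nat \<Rightarrow> real \<Rightarrow> real" and m :: nat
  defines "w \<equiv> integral {0..pi} (\<lambda>x. cos x ^ (2*m+2) * sin x ^ (2*m))"
  assumes cont: "\<And>i. i \<le> m \<Longrightarrow> continuous_on {0..4} (F i)" and "finite S"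
    and der: "\<And>i v. i < m \<Longrightarrow> v \<in> {0<..<4} - S \<Longrightarrow> (F i has_real_derivative F (Suc i) v) (at v)"
  shows "integral {0..pi} (\<lambda>x. cos (real (2*m+1) * x) * (2 * cos x) * F 0 (4 * cos x ^ 2))
    = pi / (fact m * w) * integral {0..pi} (\<lambda>x. cos x ^ (2*m+2) * sin x ^ (2*m) * F m (4 * cos x ^ 2))"
proof -
  define K where "K = pi / (fact m * w)"
  define k1 where "k1 x = cos (real (2*m+1) * x) * (2 * cos x)" for x :: real
  define k2 where "k2 x = cos x ^ (2*m+2) * sin x ^ (2*m)" for x :: real
  have c1: "continuous_on {0..pi} k1" and c2: "continuous_on {0..pi} k2"
    unfolding k1_def k2_def by (intro continuous_intros)+
  have b1: "\<bar>k1 x\<bar> \<le> 2" and b2: "\<bar>k2 x\<bar> \<le> 1" for x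
  proof -
    have "\<bar>cos (real (2*m+1) * x)\<bar> * \<bar>2 * cos x\<bar> \<le> 1 * 2"
    proof (intro mult_mono)
      show "\<bar>2 * cos x\<bar> \<le> 2" using abs_cos_le_one[of x] by linarith
    qed auto
    then show "\<bar>k1 x\<bar> \<le> 2" unfolding k1_def abs_mult[of "cos (real _ * _)"] by simp
    have "\<bar>cos x\<bar> ^ (2*m+2) * \<bar>sin x\<bar> ^ (2*m) \<le> 1 * 1"
      by (intro mult_mono power_le_one) auto
    then show "\<bar>k2 x\<bar> \<le> 1" by (simp add: k2_def abs_mult power_abs)
  qed
  have comp: "continuous_on {0..pi} (\<lambda>x. f (4 * cos x ^ 2))" if "continuous_on {0..4} f" for f :: "real \<Rightarrow> real"
    by (rule continuous_on_compose2[OF that]) (use four_cos_sq_bounds in \<open>auto intro!: continuous_intros\<close>)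
  have diff: "\<bar>integral {0..pi} (\<lambda>x. g x * f (4 * cos x ^ 2)) - integral {0..pi} (\<lambda>x. g x * h (4 * cos x ^ 2))\<bar> \<le> B * e * pi"
    if f: "continuous_on {0..4} f" and h: "continuous_on {0..4} h" and g: "continuous_on {0..pi} g"
      and B: "\<And>x. \<bar>g x\<bar> \<le> B" and e: "\<And>v. v \<in> {0..4} \<Longrightarrow> \<bar>f v - h v\<bar> \<le> e" for f g h :: "real \<Rightarrow> real" and B e
  proof -
    have "integral {0..pi} (\<lambda>x. g x * f (4 * cos x ^ 2)) - integral {0..pi} (\<lambda>x. g x * h (4 * cos x ^ 2))
        = integral {0..pi} (\<lambda>x. g x * f (4 * cos x ^ 2) - g x * h (4 * cos x ^ 2))"
      by (intro integral_diff[symmetric] integrable_continuous_real continuous_intros comp f h g)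
    also have "\<bar>\<dots>\<bar> \<le> B * e * (pi - 0)"
      unfolding real_norm_def[symmetric]
    proof (rule integral_bound)
      show "continuous_on {0..pi} (\<lambda>x. g x * f (4 * cos x ^ 2) - g x * h (4 * cos x ^ 2))"
        by (intro continuous_intros comp f h g)
      show "norm (g x * f (4 * cos x ^ 2) - g x * h (4 * cos x ^ 2)) \<le> B * e" for x
        unfolding right_diff_distrib[symmetric] real_norm_def abs_mult
        by (intro mult_mono B e four_cos_sq_bounds order_trans[OF abs_ge_zero B]) auto
    qed simp
    finally show ?thesis by simp
  qed
  have "\<bar>integral {0..pi} (\<lambda>x. k1 x * F 0 (4 * cos x ^ 2)) - K * integral {0..pi} (\<lambda>x. k2 x * F m (4 * cos x ^ 2))\<bar>
      \<le> 0 + e * (2 * 4 ^ m * pi + \<bar>K\<bar> * pi)" if e: "e > 0" for e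
  proof -
    have "\<exists>P. \<forall>v\<in>{0..4}. \<bar>F 0 v - poly P v\<bar> \<le> 4 ^ m * e \<and> \<bar>F m v - poly ((pderiv ^^ m) P) v\<bar> \<le> e"
      by (rule piecewise_C_poly_approx[OF _ \<open>finite S\<close> _ e]) (use cont der in auto)
    then obtain P where P: "\<And>v. v \<in> {0..4} \<Longrightarrow> \<bar>F 0 v - poly P v\<bar> \<le> 4 ^ m * e"
      "\<And>v. v \<in> {0..4} \<Longrightarrow> \<bar>F m v - poly ((pderiv ^^ m) P) v\<bar> \<le> e"
      by blast
    have R: "integral {0..pi} (\<lambda>x. k1 x * poly P (4 * cos x ^ 2)) = K * integral {0..pi} (\<lambda>x. k2 x * poly ((pderiv ^^ m) P) (4 * cos x ^ 2))"
      using Rodrigues_poly[of m P] unfolding k1_def k2_def K_def w_def by simp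
    have cp: "continuous_on {0..4} (poly p)" for p :: "real poly" by (intro continuous_intros)
    have 1: "\<bar>integral {0..pi} (\<lambda>x. k1 x * F 0 (4 * cos x ^ 2)) - integral {0..pi} (\<lambda>x. k1 x * poly P (4 * cos x ^ 2))\<bar> \<le> 2 * (4 ^ m * e) * pi"
      by (rule diff[OF cont cp c1 b1 P(1)]) auto
    have "\<bar>integral {0..pi} (\<lambda>x. k2 x * F m (4 * cos x ^ 2)) - integral {0..pi} (\<lambda>x. k2 x * poly ((pderiv ^^ m) P) (4 * cos x ^ 2))\<bar> \<le> 1 * e * pi"
      by (rule diff[OF cont cp c2 b2 P(2)]) auto
    then have "\<bar>K\<bar> * \<bar>integral {0..pi} (\<lambda>x. k2 x * F m (4 * cos x ^ 2)) - integral {0..pi} (\<lambda>x. k2 x * poly ((pderiv ^^ m) P) (4 * cos x ^ 2))\<bar> \<le> \<bar>K\<bar> * (1 * e * pi)"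
      by (intro mult_left_mono) auto
    then have 2: "\<bar>K * integral {0..pi} (\<lambda>x. k2 x * F m (4 * cos x ^ 2)) - K * integral {0..pi} (\<lambda>x. k2 x * poly ((pderiv ^^ m) P) (4 * cos x ^ 2))\<bar> \<le> \<bar>K\<bar> * (1 * e * pi)"
      unfolding abs_mult[symmetric] right_diff_distrib .
    have "2 * (4 ^ m * e) * pi + \<bar>K\<bar> * (1 * e * pi) = e * (2 * 4 ^ m * pi + \<bar>K\<bar> * pi)" by (simp add: algebra_simps)
    then show ?thesis using 1 2 R by linarith
  qed
  then have "\<bar>integral {0..pi} (\<lambda>x. k1 x * F 0 (4 * cos x ^ 2)) - K * integral {0..pi} (\<lambda>x. k2 x * F m (4 * cos x ^ 2))\<bar> \<le> 0"
    (is "?d \<le> 0")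
  proof -
    define Z where "Z = 2 * 4 ^ m * pi + \<bar>K\<bar> * pi"
    have Z: "Z > 0" unfolding Z_def by (intro add_pos_nonneg) auto
    have "?d \<le> 0 + e" if "e > 0" for e
      using \<open>\<And>e. e > 0 \<Longrightarrow> ?d \<le> 0 + e * (2 * 4 ^ m * pi + \<bar>K\<bar> * pi)\<close>[of "e / Z"] that Z
      unfolding Z_def[symmetric] by simp
    then show ?thesis by (rule field_le_epsilon)
  qed
  then show ?thesis unfolding k1_def k2_def K_def by simp
qed

section \<open>Separating the first odd frequency\<close>

text \<open>The squared modulus of \<open>1 + \<rho> * cis y\<close>. Shifting \<open>y\<close> by
  \<open>pi\<close> flips the sign of the cosine term and so passes from one trinomial to the
  other.\<close>

definition tri_sq :: "real \<Rightarrow> real \<Rightarrow> real" where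
  "tri_sq \<rho> y = 1 + \<rho>\<^sup>2 + 2 * \<rho> * cos y"

text \<open>\<open>4 / pi * first_coeff\<close> is the part of \<open>alt_mean\<close> due to the frequencies \<open>\<pm>1\<close> in the second
  argument of \<open>tri_sq\<close>.\<close>

definition alt_mean :: "nat \<Rightarrow> (real \<Rightarrow> real) \<Rightarrow> real" where
  "alt_mean N f = integral {0..pi} (\<lambda>x. f (tri_sq (2 * cos x) (real N * x)) - f (tri_sq (2 * cos x) (real N * x + pi)))"

definition inner_coeff :: "(real \<Rightarrow> real) \<Rightarrow> real \<Rightarrow> real" where
  "inner_coeff f \<rho> = integral {0..pi} (\<lambda>y. f (tri_sq \<rho> y) * cos y)"

definition first_coeff :: "nat \<Rightarrow> (real \<Rightarrow> real) \<Rightarrow> real" where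
  "first_coeff N f = integral {0..pi} (\<lambda>x. cos (real N * x) * inner_coeff f (2 * cos x))"

lemma tri_sq_bounds:
  assumes "\<bar>\<rho>\<bar> \<le> 2"
  shows "tri_sq \<rho> y \<in> {0..9}"
proof -
  have *: "\<bar>\<rho> * cos y\<bar> \<le> \<bar>\<rho>\<bar> * 1" unfolding abs_mult by (intro mult_left_mono) auto
  have "(1 - \<bar>\<rho>\<bar>)\<^sup>2 \<le> tri_sq \<rho> y" "tri_sq \<rho> y \<le> (1 + \<bar>\<rho>\<bar>)\<^sup>2"
    using * by (auto simp: tri_sq_def power2_eq_square algebra_simps abs_le_iff)
  moreover have "0 \<le> (1 - \<bar>\<rho>\<bar>)\<^sup>2" by simp
  moreover have "(1 + \<bar>\<rho>\<bar>)\<^sup>2 \<le> 3\<^sup>2" using assms by (intro power_mono) auto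
  ultimately show ?thesis by (simp, linarith)
qed

lemma continuous_on_tri_sq [continuous_intros]:
  assumes "continuous_on S f" "continuous_on S g"
  shows "continuous_on S (\<lambda>x. tri_sq (f x) (g x))"
  unfolding tri_sq_def
  by (intro continuous_intros assms continuous_on_compose2[OF continuous_on_cos[OF continuous_on_id] assms(2), of UNIV]) auto

lemma continuous_on_comp_tri_sq:
  assumes "continuous_on {0..9} f" "continuous_on S r" "continuous_on S g" "\<And>x. x \<in> S \<Longrightarrow> \<bar>r x\<bar> \<le> 2"
  shows "continuous_on S (\<lambda>x. f (tri_sq (r x) (g x)))"
  by (rule continuous_on_compose2[OF assms(1)]) (use assms tri_sq_bounds in \<open>auto intro!: continuous_intros\<close>)

lemma abs_two_cos_le: "\<bar>2 * cos (x::real)\<bar> \<le> 2"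
  using abs_cos_le_one[of x] by linarith

lemma continuous_on_inner_coeff:
  assumes "continuous_on {0..9} f"
  shows "continuous_on {-2..2} (inner_coeff f)"
proof -
  have "continuous_on {-2..2} (\<lambda>r. integral (cbox 0 pi) (\<lambda>y. f (tri_sq r y) * cos y))"
    by (rule integral_continuous_on_param)
      (auto simp: case_prod_unfold intro!: continuous_intros continuous_on_comp_tri_sq[OF assms])
  then show ?thesis unfolding inner_coeff_def by simp
qed

lemma continuous_on_first_coeff_integrand:
  assumes "continuous_on {0..9} f"
  shows "continuous_on {0..pi} (\<lambda>x. cos (real N * x) * inner_coeff f (2 * cos x))"
  by (intro continuous_intros continuous_on_compose2[OF continuous_on_inner_coeff[OF assms]])
    (use abs_two_cos_le in \<open>auto simp: abs_le_iff\<close>)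

lemma integrable_inner:
  assumes "continuous_on {0..9} f" "\<bar>\<rho>\<bar> \<le> 2"
  shows "(\<lambda>y. f (tri_sq \<rho> y) * cos y) integrable_on {0..pi}"
  by (intro integrable_continuous_real continuous_intros continuous_on_comp_tri_sq assms)

lemma alt_mean_integrable:
  fixes f :: "real \<Rightarrow> real"
  assumes "continuous_on {0..9} f"
  shows "(\<lambda>x. f (tri_sq (2 * cos x) (real N * x + t))) integrable_on {0..pi}"
  by (intro integrable_continuous_real continuous_on_comp_tri_sq[OF assms] continuous_intros abs_two_cos_le)

text \<open>The form \<open>f u + c * g u\<close> covers both uses of linearity: adding a monomial
  with its coefficient, and subtracting an approximating polynomial with
  \<open>c = -1\<close>.\<close>

lemma inner_coeff_add:
  assumes "continuous_on {0..9} f" "continuous_on {0..9} g" "\<bar>\<rho>\<bar> \<le> 2"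
  shows "inner_coeff (\<lambda>u. f u + c * g u) \<rho> = inner_coeff f \<rho> + c * inner_coeff g \<rho>"
proof -
  have "((\<lambda>y. f (tri_sq \<rho> y) * cos y + c * (g (tri_sq \<rho> y) * cos y)) has_integral inner_coeff f \<rho> + c * inner_coeff g \<rho>) {0..pi}"
    unfolding inner_coeff_def
    by (intro has_integral_add has_integral_mult_right integrable_integral integrable_inner assms)
  then show ?thesis unfolding inner_coeff_def by (intro integral_unique) (simp add: algebra_simps)
qed

lemma first_coeff_add:
  assumes "continuous_on {0..9} f" "continuous_on {0..9} g"
  shows "first_coeff N (\<lambda>u. f u + c * g u) = first_coeff N f + c * first_coeff N g"
proof -
  have "((\<lambda>x. cos (real N * x) * inner_coeff f (2 * cos x) + c * (cos (real N * x) * inner_coeff g (2 * cos x)))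
      has_integral first_coeff N f + c * first_coeff N g) {0..pi}"
    unfolding first_coeff_def
    by (intro has_integral_add has_integral_mult_right integrable_integral integrable_continuous_real
        continuous_on_first_coeff_integrand assms)
  then show ?thesis unfolding first_coeff_def
    by (intro integral_unique) (simp only: inner_coeff_add[OF assms abs_two_cos_le], simp add: algebra_simps)
qed

lemma alt_mean_add:
  assumes "continuous_on {0..9} f" "continuous_on {0..9} g"
  shows "alt_mean N (\<lambda>u. f u + c * g u) = alt_mean N f + c * alt_mean N g"
proof -
  have "((\<lambda>x. (f (tri_sq (2 * cos x) (real N * x)) - f (tri_sq (2 * cos x) (real N * x + pi)))
       + c * (g (tri_sq (2 * cos x) (real N * x)) - g (tri_sq (2 * cos x) (real N * x + pi))))
      has_integral alt_mean N f + c * alt_mean N g) {0..pi}"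
    unfolding alt_mean_def
    by (intro has_integral_add has_integral_mult_right integrable_integral integrable_diff
        alt_mean_integrable alt_mean_integrable[where t=0, simplified] assms)
  then show ?thesis unfolding alt_mean_def
    by (intro integral_unique) (simp add: algebra_simps)
qed

text \<open>The coefficients are left general because the expansion is used with constant
  coefficients for \<open>tri_sq\<close> itself, with binomial coefficients for its integer powers,
  and with \<open>q gchoose i\<close> for its real powers.\<close>

lemma norm_sq_partial_sum:
  fixes c :: "nat \<Rightarrow> real"
  shows "(norm (\<Sum>i<M. complex_of_real (c i) * (complex_of_real \<rho> * cis y) ^ i))\<^sup>2
    = (\<Sum>i<M. \<Sum>l<M. c i * c l * \<rho> ^ (i+l) * cos ((real i - real l) * y))"
proof -
  define Y where "Y = complex_of_real \<rho> * cis y"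
  define s where "s = (\<Sum>i<M. complex_of_real (c i) * Y ^ i)"
  have "complex_of_real ((norm s)\<^sup>2) = s * cnj s" by (rule complex_norm_square)
  also have "\<dots> = (\<Sum>i<M. \<Sum>l<M. (complex_of_real (c i) * Y ^ i) * (complex_of_real (c l) * cnj Y ^ l))"
    unfolding s_def by (simp add: sum_product)
  also have "\<dots> = (\<Sum>i<M. \<Sum>l<M. complex_of_real (c i * c l * \<rho> ^ (i+l)) * cis ((real i - real l) * y))"
  proof (intro sum.cong refl)
    fix i l
    have cY: "cnj Y = complex_of_real \<rho> * cis (- y)" by (simp add: Y_def cis_cnj)
    have "cis (real i * y) * cis (real l * (- y)) = cis ((real i - real l) * y)"
      by (simp add: cis_mult algebra_simps)
    moreover have "Y ^ i = complex_of_real (\<rho> ^ i) * cis (real i * y)" "cnj Y ^ l = complex_of_real (\<rho> ^ l) * cis (real l * (- y))"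
      unfolding cY by (simp_all add: Y_def power_mult_distrib Complex.DeMoivre)
    ultimately show "(complex_of_real (c i) * Y ^ i) * (complex_of_real (c l) * cnj Y ^ l) = complex_of_real (c i * c l * \<rho> ^ (i+l)) * cis ((real i - real l) * y)"
      by (simp add: power_add)
  qed
  finally have "Re (complex_of_real ((norm s)\<^sup>2)) = Re (\<Sum>i<M. \<Sum>l<M. complex_of_real (c i * c l * \<rho> ^ (i+l)) * cis ((real i - real l) * y))"
    by simp
  then show ?thesis unfolding s_def Y_def by (simp add: Re_complex_of_real del: of_real_mult of_real_power)
qed

lemma tri_sq_eq_norm: "tri_sq \<rho> y = (norm (1 + complex_of_real \<rho> * cis y))\<^sup>2"
  using norm_sq_partial_sum[of "\<lambda>_. 1" \<rho> y 2]
  by (simp add: tri_sq_def numeral_2_eq_2 power2_eq_square)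

lemma tri_sq_power:
  "tri_sq \<rho> y ^ j = (\<Sum>i\<le>j. \<Sum>l\<le>j. real (j choose i) * real (j choose l) * \<rho> ^ (i+l) * cos ((real i - real l) * y))"
proof -
  define Y where "Y = complex_of_real \<rho> * cis y"
  have "tri_sq \<rho> y ^ j = (norm ((1 + Y) ^ j))\<^sup>2"
    unfolding tri_sq_eq_norm Y_def norm_power by (simp add: power_mult[symmetric] mult.commute)
  also have "(1 + Y) ^ j = (\<Sum>i<Suc j. complex_of_real (real (j choose i)) * Y ^ i)"
    using binomial_ring[of Y 1 j] by (simp add: add.commute lessThan_Suc_atMost)
  finally show ?thesis unfolding Y_def norm_sq_partial_sum unfolding lessThan_Suc_atMost .
qed

text \<open>Here \<open>d\<close> is the distance of \<open>i\<close> and \<open>l\<close> as a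
  natural number, so that the integrals with natural frequencies apply; the last two equations allow
  \<open>linarith\<close> to count degrees.\<close>

lemma cos_nat_diff:
  obtains d :: nat where "\<And>y. cos ((real i - real l) * y) = cos (real d * y)" "d + 2 * min i l = i + l" "max i l = d + min i l"
proof (cases "l \<le> i")
  case True
  show ?thesis by (rule that[of "i - l"]) (use True in \<open>auto simp: of_nat_diff\<close>)
next
  case False
  have "cos ((real i - real l) * y) = cos (real (l - i) * y)" for y
    using False cos_minus[of "(real l - real i) * y"] by (simp add: of_nat_diff algebra_simps)
  then show ?thesis by (rule that[of "l - i"]) (use False in auto)
qed

lemma cos_nat_mult_add_pi: "cos (real d * (y + pi)) = (-1) ^ d * cos (real d * y)"
  by (simp add: distrib_left cos_add sin_npi cos_npi)

text \<open>Only the frequencies \<open>\<pm>1\<close> in the second variable survive: a frequency \<open>d \<ge> 3\<close> comes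
  with a power of \<open>cos x\<close> too small to resonate with \<open>cos (d N x)\<close>.\<close>

lemma alias_monomial:
  assumes "i \<le> j" "l \<le> j" "j < 3 * n" "N + 1 = 2 * n"
  shows "integral {0..pi} (\<lambda>x. (2 * cos x) ^ (i+l) * (cos ((real i - real l) * (real N * x)) - cos ((real i - real l) * (real N * x + pi))))
    = 4 / pi * (integral {0..pi} (\<lambda>x. cos (real N * x) * (2 * cos x) ^ (i+l)) * integral {0..pi} (\<lambda>y. cos ((real i - real l) * y) * cos y))"
proof -
  obtain d where d: "\<And>y. cos ((real i - real l) * y) = cos (real d * y)" "d + 2 * min i l = i + l" "max i l = d + min i l"
    using cos_nat_diff by metis
  have J: "integral {0..pi} (\<lambda>y. cos (real d * y) * cos y) = (if d = 1 then pi / 2 else 0)"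
    by (rule integral_unique[OF integral_cos_multiple_cos])
  have L: "(2 * cos x) ^ (i+l) * (cos (real d * (real N * x)) - cos (real d * (real N * x + pi)))
      = (1 - (-1) ^ d) * 2 ^ (i+l) * (cos (real (d * N) * x) * cos x ^ (i+l))" for x
    unfolding cos_nat_mult_add_pi by (simp add: algebra_simps power_mult_distrib)
  consider "even d" | "d = 1" | "odd d" "d \<ge> 3"
    by (metis One_nat_def Suc_1 Suc_leI even_Suc nat_less_le not_less_eq_eq numeral_3_eq_3 odd_pos)
  then show ?thesis
  proof cases
    case 1
    then show ?thesis unfolding d(1) J L by (auto split: if_splits)
  next
    \<comment> \<open>The shift by \<open>pi\<close> doubles an odd frequency, and the integral of
      \<open>cos y ^ 2\<close> over \<open>{0..pi}\<close> is \<open>pi / 2\<close>; the factor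
      \<open>4 / pi\<close> is the quotient of these two numbers.\<close>
    case 2
    have "integral {0..pi} (\<lambda>x. cos (real N * x) * (2 * cos x) ^ (i+l)) = 2 ^ (i+l) * integral {0..pi} (\<lambda>x. cos (real N * x) * cos x ^ (i+l))"
      by (subst integral_mult_right[symmetric]) (simp add: power_mult_distrib mult_ac)
    then show ?thesis unfolding d(1) J L using 2 by simp
  next
    case 3
    \<comment> \<open>The sum is twice the larger of \<open>i\<close> and \<open>l\<close>.
      Resonance would need \<open>i + l \<ge> d * N\<close>, hence
      \<open>2 * j \<ge> d * (N + 1) = 2 * d * n\<close>, which for \<open>d \<ge> 3\<close>
      contradicts \<open>j < 3 * n\<close>.\<close>
    have "i + l + d \<le> 2 * j" using d(2,3) assms(1,2) by linarith
    then have "i + l + d \<le> 6 * n - 2" using assms(3) by linarith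
    also have "\<dots> < 2 * n * 3" using assms(3) by linarith
    also have "\<dots> \<le> d * (2 * n)" using 3 by simp
    also have "\<dots> = d * N + d" using assms(4) by (metis distrib_left mult.right_neutral)
    finally have "i + l < d * N" by simp
    then have "integral {0..pi} (\<lambda>x. cos (real (d*N) * x) * cos x ^ (i+l)) = 0"
      by (intro integral_unique integral_cos_multiple_power)
    then show ?thesis unfolding d(1) J L using 3 by simp
  qed
qed

lemma integral_double_sum:
  fixes g :: "nat \<Rightarrow> nat \<Rightarrow> real \<Rightarrow> real"
  assumes "\<And>i l. g i l integrable_on S"
  shows "integral S (\<lambda>x. \<Sum>i\<le>j. \<Sum>l\<le>j. c i l * g i l x) = (\<Sum>i\<le>j. \<Sum>l\<le>j. c i l * integral S (g i l))"
  by (intro integral_unique has_integral_sum finite_atMost has_integral_mult_right integrable_integral assms)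

lemma alias_power:
  assumes "j < 3 * n" "N + 1 = 2 * n"
  shows "alt_mean N (\<lambda>u. u ^ j) = 4 / pi * first_coeff N (\<lambda>u. u ^ j)"
proof -
  define c where "c i l = real (j choose i) * real (j choose l)" for i l
  have "alt_mean N (\<lambda>u. u ^ j) = integral {0..pi} (\<lambda>x. \<Sum>i\<le>j. \<Sum>l\<le>j. c i l * ((2 * cos x) ^ (i+l) * (cos ((real i - real l) * (real N * x)) - cos ((real i - real l) * (real N * x + pi)))))"
    unfolding alt_mean_def tri_sq_power c_def by (simp add: sum_subtractf algebra_simps)
  also have "\<dots> = (\<Sum>i\<le>j. \<Sum>l\<le>j. c i l * integral {0..pi} (\<lambda>x. (2 * cos x) ^ (i+l) * (cos ((real i - real l) * (real N * x)) - cos ((real i - real l) * (real N * x + pi)))))"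
    by (rule integral_double_sum) (intro integrable_continuous_real continuous_intros)
  also have "\<dots> = 4 / pi * (\<Sum>i\<le>j. \<Sum>l\<le>j. c i l * (integral {0..pi} (\<lambda>x. cos (real N * x) * (2 * cos x) ^ (i+l)) * integral {0..pi} (\<lambda>y. cos ((real i - real l) * y) * cos y)))"
    unfolding sum_distrib_left using alias_monomial[OF _ _ assms] by (intro sum.cong refl) simp
  also have "(\<Sum>i\<le>j. \<Sum>l\<le>j. c i l * (integral {0..pi} (\<lambda>x. cos (real N * x) * (2 * cos x) ^ (i+l)) * integral {0..pi} (\<lambda>y. cos ((real i - real l) * y) * cos y))) = first_coeff N (\<lambda>u. u ^ j)"
  proof -
    have inner: "inner_coeff (\<lambda>u. u ^ j) \<rho> = (\<Sum>i\<le>j. \<Sum>l\<le>j. c i l * \<rho> ^ (i+l) * integral {0..pi} (\<lambda>y. cos ((real i - real l) * y) * cos y))" for \<rho>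
    proof -
      have "inner_coeff (\<lambda>u. u ^ j) \<rho> = integral {0..pi} (\<lambda>y. \<Sum>i\<le>j. \<Sum>l\<le>j. c i l * \<rho> ^ (i+l) * (cos ((real i - real l) * y) * cos y))"
        unfolding inner_coeff_def tri_sq_power c_def by (simp add: sum_distrib_right mult.assoc)
      also have "\<dots> = (\<Sum>i\<le>j. \<Sum>l\<le>j. c i l * \<rho> ^ (i+l) * integral {0..pi} (\<lambda>y. cos ((real i - real l) * y) * cos y))"
        by (rule integral_double_sum) (intro integrable_continuous_real continuous_intros)
      finally show ?thesis .
    qed
    have "first_coeff N (\<lambda>u. u ^ j) = integral {0..pi} (\<lambda>x. \<Sum>i\<le>j. \<Sum>l\<le>j. (c i l * integral {0..pi} (\<lambda>y. cos ((real i - real l) * y) * cos y)) * (cos (real N * x) * (2 * cos x) ^ (i+l)))"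
      unfolding first_coeff_def inner by (simp add: sum_distrib_left mult_ac)
    also have "\<dots> = (\<Sum>i\<le>j. \<Sum>l\<le>j. (c i l * integral {0..pi} (\<lambda>y. cos ((real i - real l) * y) * cos y)) * integral {0..pi} (\<lambda>x. cos (real N * x) * (2 * cos x) ^ (i+l)))"
      by (rule integral_double_sum) (intro integrable_continuous_real continuous_intros)
    finally show ?thesis by (simp add: mult_ac)
  qed
  finally show ?thesis .
qed

lemma alias_poly:
  assumes "degree P < 3 * n" "N + 1 = 2 * n"
  shows "alt_mean N (poly P) = 4 / pi * first_coeff N (poly P)"
proof -
  have zero: "alt_mean N (\<lambda>u. 0) = 0" "first_coeff N (\<lambda>u. 0) = 0"
    unfolding alt_mean_def first_coeff_def inner_coeff_def by simp_all
  have "alt_mean N (\<lambda>u. \<Sum>i\<in>A. coeff P i * u ^ i) = 4 / pi * first_coeff N (\<lambda>u. \<Sum>i\<in>A. coeff P i * u ^ i)"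
    if "finite A" "\<And>i. i \<in> A \<Longrightarrow> i < 3 * n" for A
    using that
  proof (induction A)
    case empty
    then show ?case by (simp add: zero)
  next
    case (insert i A)
    let ?f = "\<lambda>u. \<Sum>i\<in>A. coeff P i * u ^ i"
    have *: "(\<lambda>u. \<Sum>i\<in>insert i A. coeff P i * u ^ i) = (\<lambda>u. ?f u + coeff P i * u ^ i)"
      using insert by (simp add: fun_eq_iff)
    have c: "continuous_on {0..9} ?f" "continuous_on {0..9} (\<lambda>u::real. u ^ i)" by (intro continuous_intros)+
    have IH: "alt_mean N ?f = 4 / pi * first_coeff N ?f" using insert by simp
    show ?case unfolding * alt_mean_add[OF c] first_coeff_add[OF c] IH
      using alias_power[OF _ assms(2), of i] insert.prems by (simp add: algebra_simps)
  qed
  note * = this[of "{..degree P}"]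
  have eq: "(\<lambda>u. \<Sum>i\<le>degree P. coeff P i * u ^ i) = poly P"
    by (rule ext) (rule poly_altdef[symmetric])
  show ?thesis using * assms(1) unfolding eq by auto
qed

text \<open>For the polynomial the identity is exact, so only \<open>f - P\<close> contributes: at
  most \<open>2 pi e\<close> through \<open>alt_mean\<close>, and at most
  \<open>(4 / pi) * pi^2 * e = 4 pi e\<close> through \<open>first_coeff\<close>.\<close>

lemma alias_error:
  assumes f: "continuous_on {0..9} f" and P: "degree P < 3 * n" and N: "N + 1 = 2 * n"
    and err: "\<And>u. u \<in> {0..9} \<Longrightarrow> \<bar>f u - poly P u\<bar> \<le> e"
  shows "alt_mean N f \<le> 4 / pi * first_coeff N f + 6 * pi * e"
proof -
  let ?g = "\<lambda>u. f u + (-1) * poly P u"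
  have c: "continuous_on {0..9} (poly P)" by (intro continuous_intros)
  have cg: "continuous_on {0..9} ?g" by (intro continuous_intros f)
  have e: "\<bar>?g (tri_sq \<rho> y)\<bar> \<le> e" if "\<bar>\<rho>\<bar> \<le> 2" for \<rho> y
    using err[OF tri_sq_bounds[OF that]] by simp
  have A: "\<bar>alt_mean N ?g\<bar> \<le> 2 * e * (pi - 0)"
    unfolding alt_mean_def real_norm_def[symmetric]
  proof (rule integral_bound)
    show "continuous_on {0..pi} (\<lambda>x. ?g (tri_sq (2 * cos x) (real N * x)) - ?g (tri_sq (2 * cos x) (real N * x + pi)))"
      by (intro continuous_on_diff continuous_on_comp_tri_sq[OF cg] continuous_intros abs_two_cos_le)
    show "norm (?g (tri_sq (2 * cos x) (real N * x)) - ?g (tri_sq (2 * cos x) (real N * x + pi))) \<le> 2 * e" for x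
      using e[OF abs_two_cos_le[of x], of "real N * x"] e[OF abs_two_cos_le[of x], of "real N * x + pi"]
      unfolding real_norm_def by linarith
  qed simp
  have inner: "\<bar>inner_coeff ?g \<rho>\<bar> \<le> e * (pi - 0)" if "\<bar>\<rho>\<bar> \<le> 2" for \<rho>
    unfolding inner_coeff_def real_norm_def[symmetric]
  proof (rule integral_bound)
    show "continuous_on {0..pi} (\<lambda>y. ?g (tri_sq \<rho> y) * cos y)"
      by (intro continuous_on_mult continuous_on_comp_tri_sq[OF cg] continuous_intros that)
    show "norm (?g (tri_sq \<rho> y) * cos y) \<le> e" for y
      unfolding norm_mult using mult_mono[OF e[OF that, of y] abs_cos_le_one[of y]] e[OF that, of y] by auto
  qed simp
  have "\<bar>first_coeff N ?g\<bar> \<le> (e * pi) * (pi - 0)"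
    unfolding first_coeff_def real_norm_def[symmetric]
  proof (rule integral_bound)
    show "continuous_on {0..pi} (\<lambda>x. cos (real N * x) * inner_coeff ?g (2 * cos x))"
      by (rule continuous_on_first_coeff_integrand[OF cg])
    show "norm (cos (real N * x) * inner_coeff ?g (2 * cos x)) \<le> e * pi" for x
      unfolding norm_mult using mult_mono[OF abs_cos_le_one[of "real N * x"] inner[OF abs_two_cos_le[of x]]] by simp
  qed simp
  then have "4 / pi * (- (e * pi * pi)) \<le> 4 / pi * first_coeff N ?g"
    by (intro mult_left_mono) auto
  moreover have "4 / pi * (- (e * pi * pi)) = - (4 * pi * e)" by simp
  ultimately have B: "- (4 * pi * e) \<le> 4 / pi * first_coeff N ?g" by (rule ord_eq_le_trans[OF sym, rotated])
  have eqs: "alt_mean N ?g = alt_mean N f - alt_mean N (poly P)"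
    "first_coeff N ?g = first_coeff N f - first_coeff N (poly P)"
    using alt_mean_add[OF f c, of N "-1"] first_coeff_add[OF f c, of N "-1"] by linarith+
  have "4 / pi * first_coeff N ?g = 4 / pi * first_coeff N f - alt_mean N (poly P)"
    unfolding eqs alias_poly[OF P N] by (rule right_diff_distrib)
  moreover have "alt_mean N ?g \<le> 2 * (pi * e)" using A by (simp add: mult_ac)
  ultimately show ?thesis using B eqs(1) by simp
qed

section \<open>Chebyshev approximation of a real power\<close>

lemma cos_multiple_poly:
  "\<exists>p :: real poly. degree p \<le> d \<and> (\<forall>x. cos (real d * x) = poly p (cos x))"
proof (induction d rule: less_induct)
  case (less d)
  consider "d = 0" | "d = 1" | e where "d = Suc (Suc e)" by (metis One_nat_def not0_implies_Suc)
  then show ?case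
  proof cases
    case 1
    then show ?thesis by (intro exI[of _ 1]) auto
  next
    case 2
    then show ?thesis by (intro exI[of _ "[:0, 1:]"]) auto
  next
    case 3
    obtain p where p: "degree p \<le> e" "\<And>x. cos (real e * x) = poly p (cos x)" using less[of e] 3 by auto
    obtain r where r: "degree r \<le> Suc e" "\<And>x. cos (real (Suc e) * x) = poly r (cos x)" using less[of "Suc e"] 3 by auto
    have "cos (real d * x) = 2 * cos x * cos (real (Suc e) * x) - cos (real e * x)" for x
    proof -
      have "real d * x = real (Suc e) * x + x" "real e * x = real (Suc e) * x - x" using 3 by (auto simp: algebra_simps)
      then show ?thesis by (simp only: cos_add cos_diff) (simp add: algebra_simps)
    qed
    then have "\<forall>x. cos (real d * x) = poly ([:0, 2:] * r - p) (cos x)" using p r by (simp add: algebra_simps)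
    moreover have "degree ([:0, 2:] * r - p) \<le> d"
      using p(1) r(1) 3 by (intro degree_diff_le order_trans[OF degree_mult_le]) auto
    ultimately show ?thesis by blast
  qed
qed

text \<open>The ratio of the Fourier coefficients of order \<open>d\<close> and 0 of
  \<open>(1 + cos x) powr q\<close>, that is
  \<open>Gamma(q+1)^2 / (Gamma(q+1-d) Gamma(q+1+d))\<close>. The normalisation is undone later by
  the value of the series at 0.\<close>

definition cos_pow_coeff :: "real \<Rightarrow> nat \<Rightarrow> real" where
  "cos_pow_coeff q d = (\<Prod>i<d. (q - real i) / (q + 1 + real i))"

definition cos_pow_sum :: "real \<Rightarrow> nat \<Rightarrow> real \<Rightarrow> real" where
  "cos_pow_sum q M x = 1 + 2 * (\<Sum>d<M. cos_pow_coeff q (Suc d) * cos (real (Suc d) * x))"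

lemma cos_pow_coeff_Suc: "cos_pow_coeff q (Suc d) = cos_pow_coeff q d * ((q - real d) / (q + 1 + real d))"
  by (simp add: cos_pow_coeff_def)

lemma cos_pow_coeff_rec:
  "q > 0 \<Longrightarrow> (q + 1 + real d) * cos_pow_coeff q (Suc d) = (q - real d) * cos_pow_coeff q d"
  by (simp add: cos_pow_coeff_Suc add_pos_nonneg add_nonneg_eq_0_iff)

text \<open>The full cosine series solves \<open>(1 + cos x) S' + q sin x S = 0\<close>, as \<open>(1 + cos x) powr q\<close> does;
  for a partial sum only the last frequencies survive.\<close>

lemma cos_pow_sum_ode:
  assumes "q > 0"
  shows "\<exists>S'. (cos_pow_sum q M has_real_derivative S') (at x) \<and>
    S' * (1 + cos x) + q * sin x * cos_pow_sum q M x
      = (q - real M) * cos_pow_coeff q M * (sin (real (Suc M) * x) + sin (real M * x))"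
proof (induction M)
  case 0
  have "cos_pow_sum q 0 = (\<lambda>x. 1)" by (simp add: cos_pow_sum_def fun_eq_iff)
  then show ?case by (intro exI[of _ 0]) (auto simp: cos_pow_coeff_def)
next
  case (Suc M)
  then obtain S' where S': "(cos_pow_sum q M has_real_derivative S') (at x)"
    "S' * (1 + cos x) + q * sin x * cos_pow_sum q M x
      = (q - real M) * cos_pow_coeff q M * (sin (real (Suc M) * x) + sin (real M * x))" by blast
  define c where "c = cos_pow_coeff q (Suc M)"
  define y where "y = real (Suc M) * x"
  have step: "cos_pow_sum q (Suc M) = (\<lambda>x. cos_pow_sum q M x + 2 * c * cos (real (Suc M) * x))"
    by (simp add: cos_pow_sum_def c_def fun_eq_iff)
  have D: "(cos_pow_sum q (Suc M) has_real_derivative (S' + 2 * c * (- sin y * real (Suc M)))) (at x)"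
    unfolding step y_def by (auto intro!: derivative_eq_intros S'(1))
  have rec: "(q - real M) * cos_pow_coeff q M = (q + 1 + real M) * c"
    using cos_pow_coeff_rec[OF assms, of M] by (simp add: c_def)
  have y: "real M * x = y - x" "real (Suc (Suc M)) * x = y + x" by (simp_all add: y_def algebra_simps)
  have "(S' + 2 * c * (- sin y * real (Suc M))) * (1 + cos x) + q * sin x * cos_pow_sum q (Suc M) x
     = (S' * (1 + cos x) + q * sin x * cos_pow_sum q M x)
       + 2 * c * (- sin y * real (Suc M)) * (1 + cos x) + q * sin x * (2 * c * cos y)"
    unfolding step y_def by (simp add: algebra_simps)
  also have "\<dots> = (q + 1 + real M) * c * (sin y + sin (y - x))
       + 2 * c * (- sin y * real (Suc M)) * (1 + cos x) + q * sin x * (2 * c * cos y)"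
    using S'(2) unfolding rec by (simp only: y_def[symmetric] y(1))
  also have "\<dots> = (q - real (Suc M)) * c * (sin (y + x) + sin y)"
    by (simp add: sin_add sin_diff algebra_simps)
  finally show ?case using D unfolding y(2) c_def y_def by blast
qed

text \<open>From \<open>d \<ge> q\<close> on,
  \<open>\<bar>cos_pow_coeff q d\<bar> * (real d + 1)^2\<close> is nonincreasing. This quadratic
  decay is weaker than the true one and serves convergence only; the numerical estimate uses the
  telescoped tail below.\<close>

lemma cos_pow_coeff_decay:
  assumes "q \<ge> 1"
  obtains C where "\<And>d. real d \<ge> q \<Longrightarrow> \<bar>cos_pow_coeff q d\<bar> * (real d + 1)^2 \<le> C"
proof -
  define n0 where "n0 = nat \<lceil>q\<rceil>"
  have n0: "real n0 \<ge> q" and min: "\<And>d. real d \<ge> q \<Longrightarrow> d \<ge> n0"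
    unfolding n0_def by linarith+
  let ?X = "\<lambda>d. \<bar>cos_pow_coeff q d\<bar> * (real d + 1)^2"
  have "?X d \<le> ?X n0" if "n0 \<le> d" for d
    using that
  proof (induction d rule: dec_induct)
    case (step d)
    then have d: "real d \<ge> q" using n0 by (meson of_nat_mono order_trans)
    have "(real d - q) * (real d + 2)^2 \<le> (real d - 1) * (real d + 2)^2" 
      using assms by (intro mult_right_mono) auto
    also have "\<dots> \<le> (real d + 2) * (real d + 1)^2"
      by (simp add: power2_eq_square algebra_simps)
    also have "\<dots> \<le> (q + 1 + real d) * (real d + 1)^2" using assms by (intro mult_right_mono) auto
    finally have "(real d - q) / (q + 1 + real d) * (real d + 2)^2 \<le> (real d + 1)^2"
      using d assms by (simp add: field_simps)
    then have "\<bar>cos_pow_coeff q d\<bar> * ((real d - q) / (q + 1 + real d) * (real d + 2)^2) \<le> ?X d"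
      by (intro mult_left_mono) auto
    moreover have "?X (Suc d) = \<bar>cos_pow_coeff q d\<bar> * ((real d - q) / (q + 1 + real d) * (real d + 2)^2)"
      using d assms by (simp add: cos_pow_coeff_Suc abs_mult add.commute)
    ultimately show ?case using step by linarith
  qed simp
  then show ?thesis using that min by blast
qed

text \<open>The absolute values have a closed antidifference: for \<open>d \<ge> q\<close>,
  \<open>?t d - ?t (Suc d) = \<bar>cos_pow_coeff q d\<bar>\<close>. The whole tail is thus
  controlled by its first term.\<close>

lemma cos_pow_coeff_tail:
  assumes "q > 0" "real J \<ge> q" "J \<le> M"
  shows "(\<Sum>d=J..<M. \<bar>cos_pow_coeff q d\<bar>) \<le> \<bar>cos_pow_coeff q J\<bar> * (real J + q) / (2 * q)"
proof -
  let ?t = "\<lambda>d. \<bar>cos_pow_coeff q d\<bar> * (real d + q) / (2 * q)"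
  have "(\<Sum>d=J..<M. \<bar>cos_pow_coeff q d\<bar>) = ?t J - ?t M"
    using assms(3)
  proof (induction M rule: dec_induct)
    case (step M)
    then have M: "real M \<ge> q" using assms(2) by (meson of_nat_mono order_trans)
    have "?t (Suc M) = \<bar>cos_pow_coeff q M\<bar> * ((real M - q) / (q + 1 + real M)) * (real M + 1 + q) / (2 * q)"
      using M assms(1) by (simp add: cos_pow_coeff_Suc abs_mult add.commute)
    also have "\<dots> = \<bar>cos_pow_coeff q M\<bar> * ((real M - q) / (2 * q))"
    proof -
      have c: "real M + 1 + q = q + 1 + real M" and "q + 1 + real M \<noteq> 0" using assms(1) by auto
      then show ?thesis unfolding c by simp
    qed
    also have "\<dots> = ?t M - \<bar>cos_pow_coeff q M\<bar>"
      using assms(1) by (simp add: field_simps)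
    finally show ?case using step by simp
  qed simp
  moreover have "?t M \<ge> 0" using assms by simp
  ultimately show ?thesis by linarith
qed

text \<open>The sum \<open>cos_pow_sum q M\<close> contains the frequencies up to \<open>M\<close>;
  with \<open>J - 1\<close> the first omitted frequency is \<open>J\<close>, and the polynomial
  obtained from it has degree below \<open>J\<close>.\<close>

lemma cos_pow_sum_diff:
  assumes "q > 0" "real J > q" "J \<le> Suc M"
  shows "\<bar>cos_pow_sum q M x - cos_pow_sum q (J - 1) x\<bar> \<le> \<bar>cos_pow_coeff q J\<bar> * (real J + q) / q"
proof -
  have J: "J \<ge> 1" using assms by (cases J) auto
  have "cos_pow_sum q M x - cos_pow_sum q (J - 1) x = 2 * (\<Sum>d=J-1..<M. cos_pow_coeff q (Suc d) * cos (real (Suc d) * x))"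
    using sum.atLeastLessThan_concat[of 0 "J-1" M "\<lambda>d. cos_pow_coeff q (Suc d) * cos (real (Suc d) * x)"] assms(3)
    unfolding cos_pow_sum_def lessThan_atLeast0 by linarith
  moreover have "\<bar>\<Sum>d=J-1..<M. cos_pow_coeff q (Suc d) * cos (real (Suc d) * x)\<bar> \<le> (\<Sum>d=J-1..<M. \<bar>cos_pow_coeff q (Suc d)\<bar>)"
    by (intro order_trans[OF sum_abs] sum_mono) (auto simp: abs_mult mult_left_le)
  moreover have "(\<Sum>d=J-1..<M. \<bar>cos_pow_coeff q (Suc d)\<bar>) = (\<Sum>d=J..<Suc M. \<bar>cos_pow_coeff q d\<bar>)"
    using J by (subst sum.shift_bounds_Suc_ivl[symmetric]) simp
  moreover have "\<dots> \<le> \<bar>cos_pow_coeff q J\<bar> * (real J + q) / (2 * q)"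
    using assms by (intro cos_pow_coeff_tail) auto
  moreover have "2 * (\<bar>cos_pow_coeff q J\<bar> * (real J + q) / (2 * q)) = \<bar>cos_pow_coeff q J\<bar> * (real J + q) / q"
    by simp
  ultimately show ?thesis by linarith
qed

text \<open>By the differential equation, the derivative of
  \<open>cos_pow_sum q M x * (1 + cos x) powr (- q)\<close> is only the remainder term, whose
  coefficient \<open>(q - M) * cos_pow_coeff q M\<close> is of order \<open>1/M\<close>. The mean
  value theorem on \<open>[0, x]\<close> then makes this quotient constant in the limit. The end
  \<open>x = pi\<close> is excluded because \<open>1 + cos x\<close> vanishes there.\<close>

lemma cos_pow_sum_limit:
  assumes q: "q \<ge> 1" and x: "0 \<le> x" "x < pi"
  shows "(\<lambda>M. cos_pow_sum q M x - ((1 + cos x) / 2) powr q * cos_pow_sum q M 0) \<longlonglongrightarrow> 0"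
proof (cases "x = 0")
  case False
  then have x0: "0 < x" using x by simp
  obtain C where C: "\<And>d. real d \<ge> q \<Longrightarrow> \<bar>cos_pow_coeff q d\<bar> * (real d + 1)^2 \<le> C"
    using cos_pow_coeff_decay[OF q] by blast
  have cpos: "0 < 1 + cos x" using cos_monotone_0_pi[of x pi] x by simp
  define K where "K = (1 + cos x) powr (- q - 1)"
  have bound: "\<bar>cos_pow_sum q M x * (1 + cos x) powr (- q) - cos_pow_sum q M 0 * 2 powr (- q)\<bar> \<le> x * (2 * C * K / (real M + 1))"
    if M: "real M \<ge> q" for M
  proof -
    define S' where "S' y = (SOME S'. (cos_pow_sum q M has_real_derivative S') (at y) \<and>
      S' * (1 + cos y) + q * sin y * cos_pow_sum q M y
      = (q - real M) * cos_pow_coeff q M * (sin (real (Suc M) * y) + sin (real M * y)))" for y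
    have S': "(cos_pow_sum q M has_real_derivative S' y) (at y)"
      "S' y * (1 + cos y) + q * sin y * cos_pow_sum q M y
      = (q - real M) * cos_pow_coeff q M * (sin (real (Suc M) * y) + sin (real M * y))" for y
      using someI_ex[OF cos_pow_sum_ode[of q M y]] q unfolding S'_def by auto
    let ?u = "\<lambda>y. cos_pow_sum q M y * (1 + cos y) powr (- q)"
    let ?u' = "\<lambda>y. (q - real M) * cos_pow_coeff q M * (sin (real (Suc M) * y) + sin (real M * y)) * (1 + cos y) powr (- q - 1)"
    have cy: "1 + cos y \<ge> 1 + cos x" if "0 \<le> y" "y \<le> x" for y
      using that x cos_monotone_0_pi_le[of y x] by simp
    have der: "(?u has_real_derivative ?u' y) (at y)" if "0 \<le> y" "y \<le> x" for y
    proof -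
      have p: "0 < 1 + cos y" using cy[OF that] cpos by linarith
      have e: "(1 + cos y) powr (- q) = (1 + cos y) * (1 + cos y) powr (- q - 1)"
        using p powr_add[of "1 + cos y" 1 "- q - 1"] by simp
      have "(?u has_real_derivative (S' y * (1 + cos y) powr (- q) + cos_pow_sum q M y * (- q * (1 + cos y) powr (- q - 1) * (- sin y)))) (at y)"
        using p by (auto intro!: derivative_eq_intros S'(1) simp: powr_diff field_simps)
      moreover have "S' y * (1 + cos y) powr (- q) + cos_pow_sum q M y * (- q * (1 + cos y) powr (- q - 1) * (- sin y)) = ?u' y"
        unfolding e S'(2)[of y, symmetric] by (simp add: algebra_simps)
      ultimately show ?thesis by simp
    qed
    obtain z where z: "0 < z" "z < x" "?u x - ?u 0 = (x - 0) * ?u' z"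
      using MVT2[OF x0, of ?u ?u'] der by auto
    have zz: "(1 + cos z) powr (- q - 1) \<le> K"
      unfolding K_def using cy[of z] z cpos q by (intro powr_mono2') auto
    have s2: "\<bar>sin (real (Suc M) * z) + sin (real M * z)\<bar> \<le> 2"
      using abs_sin_le_one[of "real (Suc M) * z"] abs_sin_le_one[of "real M * z"] by linarith
    have "\<bar>(q - real M) * cos_pow_coeff q M\<bar> \<le> (real M + 1) * \<bar>cos_pow_coeff q M\<bar>"
      unfolding abs_mult using M q by (intro mult_right_mono) auto
    also have "\<dots> \<le> C / (real M + 1)"
      using C[OF M] by (simp add: field_simps power2_eq_square)
    finally have a: "\<bar>(q - real M) * cos_pow_coeff q M\<bar> \<le> C / (real M + 1)" .
    have C0: "0 \<le> C" by (rule order_trans[OF _ C[OF M]]) simp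
    have "\<bar>?u' z\<bar> \<le> C / (real M + 1) * 2 * K"
      unfolding abs_mult[of "_ * _" "_ powr _"] abs_mult[of "_ * _" "_ + _"]
      by (intro mult_mono a s2) (use zz a C[OF M] in \<open>auto intro: order_trans[OF abs_ge_zero] simp: C0\<close>)
    then have "x * \<bar>?u' z\<bar> \<le> x * (2 * C * K / (real M + 1))"
      using x0 by (intro mult_left_mono) (auto simp: mult_ac)
    then show ?thesis using z(3) x0 by (simp add: abs_mult)
  qed
  have "(\<lambda>M. x * (2 * C * K / (real M + 1))) \<longlonglongrightarrow> 0" by real_asymp
  then have "(\<lambda>M. cos_pow_sum q M x * (1 + cos x) powr (- q) - cos_pow_sum q M 0 * 2 powr (- q)) \<longlonglongrightarrow> 0"
  proof (rule Lim_null_comparison[rotated])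
    show "\<forall>\<^sub>F M in sequentially. norm (cos_pow_sum q M x * (1 + cos x) powr (- q) - cos_pow_sum q M 0 * 2 powr (- q)) \<le> x * (2 * C * K / (real M + 1))"
      using eventually_ge_at_top[of "nat \<lceil>q\<rceil>"]
    proof eventually_elim
      case (elim M)
      then have "real M \<ge> q" by linarith
      then show ?case using bound by simp
    qed
  qed
  then have "(\<lambda>M. (1 + cos x) powr q * (cos_pow_sum q M x * (1 + cos x) powr (- q) - cos_pow_sum q M 0 * 2 powr (- q))) \<longlonglongrightarrow> (1 + cos x) powr q * 0"
    by (intro tendsto_mult tendsto_const)
  moreover have "(1 + cos x) powr q * (cos_pow_sum q M x * (1 + cos x) powr (- q) - cos_pow_sum q M 0 * 2 powr (- q))
      = cos_pow_sum q M x - ((1 + cos x) / 2) powr q * cos_pow_sum q M 0" for M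
    using cpos by (simp add: powr_minus powr_divide field_simps)
  ultimately show ?thesis by simp
qed simp

text \<open>The number \<open>17/5 = 1 + 2 * (4/5 + 2/5)\<close> bounds the value of the normalised cosine series at 0 from
  below; its terms of order 1 and 2 are least at \<open>q = 4\<close>.\<close>

lemma powr_poly_approx:
  fixes k J :: nat
  assumes k: "k \<ge> 4" and q: "real k < q" "q < real k + 1" and J: "J \<ge> k + 2"
  obtains P where "degree P < J"
    "\<And>u. u \<in> {0..9} \<Longrightarrow> \<bar>u powr q - poly P u\<bar> \<le> 9 powr q * (\<bar>cos_pow_coeff q J\<bar> * (real J + q) / q) / (17/5)"
proof -
  have q4: "q > 4" using k q by linarith
  have kq: "q > 0" "q \<ge> 1" using q4 by auto
  have Jq: "real J > q" using J q by linarith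
  define t where "t = \<bar>cos_pow_coeff q J\<bar> * (real J + q) / q"
  have pos: "0 < cos_pow_coeff q d" if "d \<le> k + 1" for d
    unfolding cos_pow_coeff_def using that q kq by (intro prod_pos) auto
  \<comment> \<open>Coefficients up to order \<open>k+1\<close> are positive, and everything from
    order \<open>k+2\<close> on amounts to at most \<open>cos_pow_coeff q (k+1)\<close>. The partial
    sum contains twice that coefficient, so the later terms cannot spoil the bound from orders 0, 1
    and 2.\<close>
  have lower: "17/5 \<le> cos_pow_sum q M 0" if M: "M \<ge> k + 1" for M
  proof -
    have "\<bar>cos_pow_sum q M 0 - cos_pow_sum q (k+1) 0\<bar> \<le> \<bar>cos_pow_coeff q (k+2)\<bar> * (real (k+2) + q) / q"
      using cos_pow_sum_diff[of q "k+2" M 0] M q kq by simp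
    also have "\<bar>cos_pow_coeff q (k+2)\<bar> * (real (k+2) + q) / q = cos_pow_coeff q (k+1) * ((real (k+1) - q) / q)"
    proof -
      have e: "cos_pow_coeff q (k+2) = cos_pow_coeff q (k+1) * ((q - real (k+1)) / (q + 1 + real (k+1)))"
        using cos_pow_coeff_Suc[of q "k+1"] by simp
      have c: "real (k+2) + q = q + 1 + real (k+1)" by simp
      have d: "q + 1 + real (k+1) > 0" using kq by simp
      have n: "\<bar>q - real (k+1)\<bar> = real (k+1) - q" using q by simp
      show ?thesis unfolding e c abs_mult abs_divide n using d pos[of "k+1"] by simp
    qed
    also have "\<dots> \<le> cos_pow_coeff q (k+1) * 1"
      using pos[of "k+1"] q q4 by (intro mult_left_mono) (auto simp: field_simps)
    finally have "\<bar>cos_pow_sum q M 0 - cos_pow_sum q (k+1) 0\<bar> \<le> cos_pow_coeff q (k+1)" by simp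
    moreover have "1 + 2 * (cos_pow_coeff q 1 + cos_pow_coeff q 2 + cos_pow_coeff q (k+1)) \<le> cos_pow_sum q (k+1) 0"
    proof -
      have "(\<Sum>d\<in>{0,1,k}. cos_pow_coeff q (Suc d)) \<le> (\<Sum>d<k+1. cos_pow_coeff q (Suc d))"
        using k by (intro sum_mono2) (auto intro!: less_imp_le[OF pos])
      then show ?thesis using k by (simp add: cos_pow_sum_def numeral_2_eq_2)
    qed
    moreover have "cos_pow_coeff q 1 \<ge> 4/5" using q4 by (simp add: cos_pow_coeff_def field_simps)
    moreover have "cos_pow_coeff q 2 \<ge> 2/5"
    proof -
      have "cos_pow_coeff q 2 = (q / (q+1)) * ((q - 1) / (q + 2))" by (simp add: cos_pow_coeff_def numeral_2_eq_2)
      moreover have "(4/5) * (1/2) \<le> (q / (q+1)) * ((q - 1) / (q + 2))"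
        using q4 by (intro mult_mono) (auto simp: field_simps)
      ultimately show ?thesis by simp
    qed
    ultimately have "17/5 + cos_pow_coeff q (k+1) \<le> cos_pow_sum q M 0"
      unfolding abs_le_iff distrib_left by linarith
    then show ?thesis using pos[OF order_refl] by linarith
  qed
  have "convergent (\<lambda>M. cos_pow_sum q M 0)"
  proof -
    obtain C where C: "\<And>d. real d \<ge> q \<Longrightarrow> \<bar>cos_pow_coeff q d\<bar> * (real d + 1)^2 \<le> C"
      using cos_pow_coeff_decay[OF kq(2)] by blast
    have "summable (\<lambda>d. cos_pow_coeff q (Suc d))"
    proof (rule summable_comparison_test_ev)
      show "summable (\<lambda>d. C * inverse (real (Suc d) ^ 2))"
        by (intro summable_mult iffD2[OF summable_Suc_iff] inverse_power_summable) simp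
      show "\<forall>\<^sub>F d in sequentially. norm (cos_pow_coeff q (Suc d)) \<le> C * inverse (real (Suc d) ^ 2)"
        using eventually_ge_at_top[of "nat \<lceil>q\<rceil>"]
      proof eventually_elim
        case (elim d)
        then have "real (Suc d) \<ge> q" by linarith
        have "\<bar>cos_pow_coeff q (Suc d)\<bar> * real (Suc d)^2 \<le> \<bar>cos_pow_coeff q (Suc d)\<bar> * (real (Suc d) + 1)^2"
          by (intro mult_left_mono power_mono) auto
        then have "\<bar>cos_pow_coeff q (Suc d)\<bar> * real (Suc d)^2 \<le> C" using C[OF \<open>real (Suc d) \<ge> q\<close>] by linarith
        then show ?case by (simp add: field_simps del: of_nat_Suc)
      qed
    qed
    then have "(\<lambda>M. \<Sum>d<M. cos_pow_coeff q (Suc d)) \<longlonglongrightarrow> (\<Sum>d. cos_pow_coeff q (Suc d))" by (rule summable_LIMSEQ)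
    then have "(\<lambda>M. 1 + 2 * (\<Sum>d<M. cos_pow_coeff q (Suc d))) \<longlonglongrightarrow> 1 + 2 * (\<Sum>d. cos_pow_coeff q (Suc d))"
      by (intro tendsto_intros)
    then show ?thesis by (auto simp: cos_pow_sum_def convergent_def)
  qed
  then obtain L where L: "(\<lambda>M. cos_pow_sum q M 0) \<longlonglongrightarrow> L" by (auto simp: convergent_def)
  have L34: "17/5 \<le> L" using lower by (intro LIMSEQ_le_const[OF L]) auto
  have main: "\<bar>((1 + cos x) / 2) powr q * L - cos_pow_sum q (J - 1) x\<bar> \<le> t" if "0 \<le> x" "x < pi" for x
  proof -
    have "(\<lambda>M. (cos_pow_sum q M x - ((1 + cos x) / 2) powr q * cos_pow_sum q M 0) + ((1 + cos x) / 2) powr q * cos_pow_sum q M 0)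
       \<longlonglongrightarrow> 0 + ((1 + cos x) / 2) powr q * L"
      by (intro tendsto_add tendsto_mult tendsto_const L cos_pow_sum_limit kq that)
    then have "(\<lambda>M. \<bar>cos_pow_sum q M x - cos_pow_sum q (J - 1) x\<bar>) \<longlonglongrightarrow> \<bar>((1 + cos x) / 2) powr q * L - cos_pow_sum q (J - 1) x\<bar>"
      by (intro tendsto_intros) simp
    then show ?thesis
    proof (rule LIMSEQ_le_const2)
      show "\<exists>N. \<forall>M\<ge>N. \<bar>cos_pow_sum q M x - cos_pow_sum q (J - 1) x\<bar> \<le> t"
        unfolding t_def using kq Jq by (intro exI[of _ J] allI impI cos_pow_sum_diff) auto
    qed
  qed
  obtain T where T: "\<And>d. degree (T d) \<le> d" "\<And>d x. cos (real d * x) = poly (T d) (cos x)"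
    using cos_multiple_poly by metis
  define Q where "Q = 1 + smult 2 (\<Sum>d<J-1. smult (cos_pow_coeff q (Suc d)) (T (Suc d)))"
  have Q: "poly Q (cos x) = cos_pow_sum q (J - 1) x" for x
    by (simp add: Q_def cos_pow_sum_def poly_sum T(2)[symmetric] del: of_nat_Suc)
  have dQ: "degree Q \<le> J - 1" unfolding Q_def
    by (intro degree_add_le order_trans[OF degree_smult_le] degree_sum_le)
      (auto intro!: order_trans[OF T(1)])
  \<comment> \<open>The affine map \<open>u \<mapsto> 2u/9 - 1\<close> takes \<open>[0, 9]\<close>
    to \<open>[-1, 1]\<close>; with \<open>cos x = 2u/9 - 1\<close> one has
    \<open>u = 9 (1 + cos x) / 2\<close>. Dividing by \<open>L\<close>, the value of the series at
    0, normalises the limit to 1 there.\<close>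
  define P where "P = smult (9 powr q / L) (pcompose Q [:-1, 2/9:])"
  have dP: "degree P < J"
  proof -
    have "degree P \<le> degree (pcompose Q [:-1, 2/9:])" unfolding P_def by (rule degree_smult_le)
    also have "\<dots> \<le> degree Q" by (simp add: degree_pcompose)
    also have "\<dots> < J" using dQ J by linarith
    finally show ?thesis .
  qed
  have Lpos: "L > 0" using L34 by linarith
  have err: "\<bar>u powr q - poly P u\<bar> \<le> 9 powr q * t / (17/5)" if u: "u \<in> {0<..9}" for u
  proof -
    define x where "x = arccos (2/9 * u - 1)"
    have c: "cos x = 2/9 * u - 1" unfolding x_def using u by (intro cos_arccos) auto
    have x: "0 \<le> x" "x < pi"
    proof -
      show "0 \<le> x" unfolding x_def using u by (intro arccos_lbound) auto
      have "x \<le> pi" unfolding x_def using u by (intro arccos_ubound) auto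
      moreover have "x \<noteq> pi" using c u by auto
      ultimately show "x < pi" by simp
    qed
    have "u powr q = 9 powr q * ((1 + cos x) / 2) powr q"
      using u by (simp add: c powr_mult[symmetric])
    moreover have "poly P u = 9 powr q / L * cos_pow_sum q (J - 1) x"
      unfolding P_def using Q[of x] c by (simp add: poly_pcompose algebra_simps)
    ultimately have "u powr q - poly P u = 9 powr q / L * (((1 + cos x) / 2) powr q * L - cos_pow_sum q (J - 1) x)"
      using Lpos by (simp add: field_simps)
    then have "\<bar>u powr q - poly P u\<bar> = 9 powr q / L * \<bar>((1 + cos x) / 2) powr q * L - cos_pow_sum q (J - 1) x\<bar>"
      using Lpos by (simp add: abs_mult)
    also have "\<dots> \<le> 9 powr q / L * t" using main[OF x] Lpos by (intro mult_left_mono) auto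
    also have "\<dots> \<le> 9 powr q / (17/5) * t"
      using L34 kq by (intro mult_right_mono divide_left_mono) (auto simp: t_def)
    finally show ?thesis by simp
  qed
  have "\<bar>u powr q - poly P u\<bar> \<le> 9 powr q * t / (17/5)" if "u \<in> {0..9}" for u
  \<comment> \<open>The point \<open>u = 0\<close> corresponds to the excluded \<open>x = pi\<close>
    and is recovered by continuity.\<close>
  proof (rule continuous_le_on_closure[of "{0<..9}" "\<lambda>u. \<bar>u powr q - poly P u\<bar>"])
    show "continuous_on (closure {0<..9}) (\<lambda>u. \<bar>u powr q - poly P u\<bar>)"
      using kq by (auto intro!: continuous_intros continuous_on_powr')
    show "u \<in> closure {0<..9}" using that by simp
  qed (rule err)
  then show ?thesis using that dP unfolding t_def by blast
qed

section \<open>The first Fourier coefficient as a hypergeometric function\<close>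

lemma gbinomial_Suc_rec: "(real j + 1) * (q gchoose Suc j) = (q - real j) * (q gchoose j)"
  for q :: real
  using gbinomial_mult_1[of q j] by (simp add: algebra_simps)

text \<open>The coefficient of \<open>v^j\<close> in \<open>q F(-q, 1-q; 2; v)\<close>, as
  \<open>bprod_rec\<close> shows. It is a product of neighbouring binomial coefficients because the
  first frequency of \<open>\<bar>(1+Y) powr q\<bar>^2\<close> pairs the powers \<open>j\<close> and
  \<open>j+1\<close> of \<open>Y\<close>.\<close>

definition bprod :: "real \<Rightarrow> nat \<Rightarrow> real" where
  "bprod q j = (q gchoose j) * (q gchoose Suc j)"

lemma bprod_rec: "(real j + 1) * (real j + 2) * bprod q (Suc j) = (q - real j) * (q - 1 - real j) * bprod q j"
proof -
  have a: "(real j + 1) * (q gchoose Suc j) = (q - real j) * (q gchoose j)" by (rule gbinomial_Suc_rec)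
  have b: "(real j + 2) * (q gchoose Suc (Suc j)) = (q - 1 - real j) * (q gchoose Suc j)"
    using gbinomial_Suc_rec[of "Suc j" q] by (simp add: algebra_simps)
  have "(real j + 1) * (real j + 2) * bprod q (Suc j)
      = ((real j + 1) * (q gchoose Suc j)) * ((real j + 2) * (q gchoose Suc (Suc j)))" 
    unfolding bprod_def by (simp only: mult_ac)
  also have "\<dots> = (q - real j) * (q - 1 - real j) * bprod q j"
    unfolding a b bprod_def by (simp only: mult_ac)
  finally show ?thesis .
qed

text \<open>Bernoulli's inequality gives \<open>(j/(j+1))^(k+1) \<ge> (j-k)/(j+1)\<close>, which
  exceeds the ratio \<open>(j-q)/(j+1)\<close> of consecutive absolute values; hence the weighted
  sequence is nonincreasing from \<open>q\<close> on.\<close>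

lemma gbinomial_decay:
  fixes q :: real
  assumes "real k < q"
  obtains C where "\<And>j. real j \<ge> q \<Longrightarrow> \<bar>q gchoose j\<bar> * real j ^ (k+1) \<le> C"
proof -
  define n0 where "n0 = nat \<lceil>q\<rceil>"
  have n0: "real n0 \<ge> q" and min: "\<And>d. real d \<ge> q \<Longrightarrow> d \<ge> n0"
    unfolding n0_def by linarith+
  let ?X = "\<lambda>j. \<bar>q gchoose j\<bar> * real j ^ (k+1)"
  have "?X j \<le> ?X n0" if "n0 \<le> j" for j
    using that
  proof (induction j rule: dec_induct)
    case (step j)
    then have j: "real j \<ge> q" using n0 by (meson of_nat_mono order_trans)
    have "(1 - 1 / (real j + 1)) ^ (k+1) \<ge> 1 + real (k+1) * (- (1 / (real j + 1)))"
      using Bernoulli_inequality[of "- (1 / (real j + 1))" "k+1"] by simp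
    moreover have "1 + real (k+1) * (- (1 / (real j + 1))) = (real j - real k) / (real j + 1)"
      by (simp add: field_simps)
    moreover have "1 - 1 / (real j + 1) = real j / (real j + 1)" by (simp add: field_simps)
    ultimately have "(real j - real k) / (real j + 1) \<le> (real j / (real j + 1)) ^ (k+1)" by simp
    moreover have "(real j - q) / (real j + 1) \<le> (real j - real k) / (real j + 1)"
      using assms by (intro divide_right_mono) auto
    ultimately have "(real j - q) / (real j + 1) \<le> real j ^ (k+1) / (real j + 1) ^ (k+1)"
      by (simp only: power_divide)
    then have *: "(real j - q) / (real j + 1) * (real j + 1) ^ (k+1) \<le> real j ^ (k+1)"
      by (subst (asm) pos_le_divide_eq) auto
    have "q gchoose Suc j = (q gchoose j) * ((q - real j) / (real j + 1))"
      using gbinomial_Suc_rec[of j q] by (simp add: field_simps)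
    then have "\<bar>q gchoose Suc j\<bar> = \<bar>q gchoose j\<bar> * ((real j - q) / (real j + 1))"
      using j by (simp add: abs_mult)
    then have "?X (Suc j) = \<bar>q gchoose j\<bar> * ((real j - q) / (real j + 1) * (real j + 1) ^ (k+1))"
      by (simp add: add.commute)
    also have "\<dots> \<le> ?X j" using * by (intro mult_left_mono) auto
    finally show ?case using step by linarith
  qed simp
  then show ?thesis using that min by blast
qed

lemma bprod_decay:
  assumes "real k < q"
  obtains C where "\<And>j. real j \<ge> q \<Longrightarrow> \<bar>bprod q j\<bar> * real j ^ (2*k+2) \<le> C"
proof -
  obtain C where C: "\<And>j. real j \<ge> q \<Longrightarrow> \<bar>q gchoose j\<bar> * real j ^ (k+1) \<le> C"
    using gbinomial_decay[OF assms] by blast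
  have "\<bar>bprod q j\<bar> * real j ^ (2*k+2) \<le> C * C" if j: "real j \<ge> q" for j
  proof -
    have C0: "0 \<le> C" by (rule order_trans[OF _ C[OF j]]) simp
    have "\<bar>q gchoose Suc j\<bar> * real j ^ (k+1) \<le> \<bar>q gchoose Suc j\<bar> * real (Suc j) ^ (k+1)"
      by (intro mult_left_mono power_mono) auto
    also have "\<dots> \<le> C" using j by (intro C) auto
    finally have c: "\<bar>q gchoose Suc j\<bar> * real j ^ (k+1) \<le> C" .
    have "real j ^ (2*k+2) = real j ^ (k+1) * real j ^ (k+1)" by (simp add: power_add[symmetric] mult_2)
    then have "\<bar>bprod q j\<bar> * real j ^ (2*k+2) = (\<bar>q gchoose j\<bar> * real j ^ (k+1)) * (\<bar>q gchoose Suc j\<bar> * real j ^ (k+1))"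
      by (simp only: bprod_def abs_mult mult_ac)
    also have "\<dots> \<le> C * C" by (intro mult_mono C[OF j] c C0) auto
    finally show ?thesis .
  qed
  then show ?thesis using that by blast
qed

text \<open>A weight of degree \<open>2k\<close> leaves a factor of order \<open>j^(-2)\<close>. The
  weights met below have degree at most \<open>k+2\<close>: derivatives up to order
  \<open>k+1\<close> at \<open>v = 1\<close>, and the telescoping sequences that compare
  them.\<close>

lemma bprod_poly_summable:
  assumes k: "real k < q" "k \<ge> 1" and p: "\<And>j. j \<ge> 1 \<Longrightarrow> \<bar>p j\<bar> \<le> K * real j ^ (2*k)"
  shows "summable (\<lambda>j. \<bar>p j * bprod q j\<bar>)"
proof -
  obtain C where C: "\<And>j. real j \<ge> q \<Longrightarrow> \<bar>bprod q j\<bar> * real j ^ (2*k+2) \<le> C"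
    using bprod_decay[OF k(1)] by blast
  show ?thesis
  proof (rule summable_comparison_test_ev)
    show "summable (\<lambda>j. K * C * inverse (real j ^ 2))"
      by (intro summable_mult) (use inverse_power_summable[of 2, where 'a=real] in auto)
    show "\<forall>\<^sub>F j in sequentially. norm \<bar>p j * bprod q j\<bar> \<le> K * C * inverse (real j ^ 2)"
      using eventually_ge_at_top[of "nat \<lceil>q\<rceil>"] eventually_ge_at_top[of 1]
    proof eventually_elim
      case (elim j)
      then have j: "real j \<ge> q" by linarith
      have "0 \<le> K * real j ^ (2*k)" by (rule order_trans[OF _ p[OF elim(2)]]) simp
      moreover have "0 < real j ^ (2*k)" using elim(2) by simp
      ultimately have K: "0 \<le> K" by (simp only: zero_le_mult_iff) linarith
      have "\<bar>p j\<bar> * \<bar>bprod q j\<bar> * real j ^ 2 \<le> K * real j ^ (2*k) * \<bar>bprod q j\<bar> * real j ^ 2"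
        using p[OF elim(2)] by (intro mult_right_mono) auto
      also have "\<dots> = K * (\<bar>bprod q j\<bar> * real j ^ (2*k+2))" by (simp add: power_add power2_eq_square)
      also have "\<dots> \<le> K * C" using C[OF j] K by (intro mult_left_mono) auto
      finally show ?case using elim(2) by (simp add: abs_mult field_simps power2_eq_square)
    qed
  qed
qed

text \<open>The falling factorial, i.e. the factor produced by differentiating
  \<open>v powr x\<close> \<open>i\<close> times. It is needed at the integers \<open>j\<close> for
  the expansion at 0 and at \<open>q - 1 - j\<close> for the one at infinity.\<close>

definition ffall :: "real \<Rightarrow> nat \<Rightarrow> real" where
  "ffall x i = (\<Prod>l<i. x - real l)"

lemma ffall_0 [simp]: "ffall x 0 = 1" by (simp add: ffall_def)
lemma ffall_Suc: "ffall x (Suc i) = ffall x i * (x - real i)" by (simp add: ffall_def)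
lemma ffall_shift: "x * ffall (x - 1) i = ffall x i * (x - real i)"
proof (induction i)
  case (Suc i)
  have "x * ffall (x - 1) (Suc i) = (x * ffall (x - 1) i) * (x - 1 - real i)" by (simp add: ffall_Suc)
  then show ?case unfolding Suc by (simp add: ffall_Suc algebra_simps)
qed simp
lemma ffall_Suc': "ffall x (Suc i) = x * ffall (x - 1) i"
  by (simp add: ffall_Suc ffall_shift)

lemma ffall_of_nat_pos: "i \<le> j \<Longrightarrow> ffall (real j) i > 0"
  unfolding ffall_def by (intro prod_pos) auto
lemma ffall_of_nat_zero: "j < i \<Longrightarrow> ffall (real j) i = 0"
  unfolding ffall_def by (auto intro!: prod_zero)

lemma ffall_bound: "\<bar>ffall x i\<bar> \<le> (\<bar>x\<bar> + real i) ^ i"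
proof -
  have "\<bar>ffall x i\<bar> = (\<Prod>l<i. \<bar>x - real l\<bar>)" by (simp add: ffall_def abs_prod)
  also have "\<dots> \<le> (\<Prod>l<i. \<bar>x\<bar> + real i)" by (intro prod_mono) auto
  finally show ?thesis by simp
qed

lemma ffall_bounds:
  assumes "j \<ge> 1" "q > 0"
  shows "\<bar>ffall (real j) i\<bar> \<le> (q + real i + 2) ^ i * real j ^ i"
    and "\<bar>ffall (q - 1 - real j) i\<bar> \<le> (q + real i + 2) ^ i * real j ^ i"
proof -
  have j: "real j \<ge> 1" using assms by simp
  have b: "x + real i \<le> (q + real i + 2) * real j" if "x \<le> real j + q + 1" for x
  proof -
    have "(q + 1 + real i) * 1 \<le> (q + 1 + real i) * real j" using j assms(2) by (intro mult_left_mono) auto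
    then show ?thesis using that by (simp add: algebra_simps)
  qed
  show "\<bar>ffall (real j) i\<bar> \<le> (q + real i + 2) ^ i * real j ^ i"
    using order_trans[OF ffall_bound power_mono[OF b]] assms by (simp add: power_mult_distrib)
  show "\<bar>ffall (q - 1 - real j) i\<bar> \<le> (q + real i + 2) ^ i * real j ^ i"
    using order_trans[OF ffall_bound[of "q - 1 - real j"] power_mono[OF b]] assms by (simp add: power_mult_distrib)
qed

lemma bprod_ffall_summable:
  assumes k: "real k < q" "k \<ge> 1" and p: "\<And>j. j \<ge> 1 \<Longrightarrow> \<bar>p j\<bar> \<le> K * real j ^ r" "r \<le> 2*k"
  shows "summable (\<lambda>j. \<bar>p j * bprod q j\<bar>)"
proof (rule bprod_poly_summable[OF k])
  fix j :: nat assume j: "j \<ge> 1"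
  have K: "0 \<le> K" using order_trans[OF _ p(1)[of 1]] by simp
  have "K * real j ^ r \<le> K * real j ^ (2*k)" using K j p(2) by (intro mult_left_mono power_increasing) auto
  then show "\<bar>p j\<bar> \<le> K * real j ^ (2*k)" using p(1)[OF j] by linarith
qed

lemma telescope_suminf_zero:
  fixes X :: "nat \<Rightarrow> real"
  assumes "summable (\<lambda>j. \<bar>X j\<bar>)" "X 0 = 0" "\<And>j. f j = X (Suc j) - X j"
  shows "f sums 0"
proof -
  have "f = (\<lambda>j. X (Suc j) - X j)" using assms(3) by auto
  then show ?thesis
    using telescope_sums[OF summable_LIMSEQ_zero[OF summable_rabs_cancel[OF assms(1)]]] assms(2) by simp
qed

text \<open>At \<open>v = 1\<close> the derivatives of the expansions of the same function at \<open>0\<close> and at \<open>\<infinity>\<close> agree: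
  both satisfy the first-order recursion which the hypergeometric equation gives at its singular
  point \<open>1\<close>.\<close>

lemma ffall_series_match:
  assumes k: "real k < q" "k \<ge> 4" and i: "i \<le> k + 1"
  shows "(\<Sum>j. ffall (real j) i * bprod q j) = (\<Sum>j. ffall (q - 1 - real j) i * bprod q j)"
  using i
proof (induction i)
  case 0
  then show ?case by simp
next
  case (Suc i)
  have q: "q > 0" "k \<ge> 1" using k by auto
  have sA: "summable (\<lambda>j. ffall (real j) i * bprod q j)" if "i \<le> k + 1" for i
    by (rule summable_rabs_cancel, rule bprod_ffall_summable[OF k(1) q(2)], rule ffall_bounds(1)[OF _ q(1)])
      (use that k in auto)
  have sB: "summable (\<lambda>j. ffall (q - 1 - real j) i * bprod q j)" if "i \<le> k + 1" for i
    by (rule summable_rabs_cancel, rule bprod_ffall_summable[OF k(1) q(2)], rule ffall_bounds(2)[OF _ q(1)])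
      (use that k in auto)
  have shift: "(q - real j) * (q - 1 - real j) * bprod q j = (real j + 1) * (real j + 2) * bprod q (Suc j)" for j
    by (rule bprod_rec[symmetric])
  have growA: "summable (\<lambda>j. \<bar>(ffall (real j) (Suc i) * (real j + 1)) * bprod q j\<bar>)"
  proof (rule bprod_ffall_summable[OF k(1) q(2)])
    fix j :: nat assume j: "j \<ge> 1"
    show "\<bar>ffall (real j) (Suc i) * (real j + 1)\<bar> \<le> (2 * (q + real (Suc i) + 2) ^ Suc i) * real j ^ (i + 2)"
      using mult_mono[OF ffall_bounds(1)[OF j q(1), of "Suc i"], of "real j + 1" "2 * real j"] j q
      by (simp add: abs_mult mult_ac)
  qed (use Suc k in auto)
  have growB: "summable (\<lambda>j. \<bar>(real j * (real j + 1) * ffall (q - 1 - real j) i) * bprod q j\<bar>)"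
  proof (rule bprod_ffall_summable[OF k(1) q(2)])
    fix j :: nat assume j: "j \<ge> 1"
    have "real j * (real j + 1) \<le> 2 * real j ^ 2" using j by (simp add: power2_eq_square algebra_simps)
    then show "\<bar>real j * (real j + 1) * ffall (q - 1 - real j) i\<bar> \<le> (2 * (q + real i + 2) ^ i) * real j ^ (i + 2)"
      using mult_mono[OF _ ffall_bounds(2)[OF j q(1), of i], of "real j * (real j + 1)" "2 * real j ^ 2"] j q
      by (simp add: abs_mult mult_ac power_add power2_eq_square)
  qed (use Suc k in auto)
  \<comment> \<open>The coefficients are those of the hypergeometric equation for the
    \<open>i\<close>-th derivative at \<open>v = 1\<close>, where the second-order term drops out.
    The summand is the difference of the sequence in \<open>growA\<close>, which tends to 0 because
    it is summable; for \<open>B\<close> the sequence in \<open>growB\<close> does the same up to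
    sign.\<close>
  have A: "(\<lambda>j. (q - real i) * (q - real i - 1) * (ffall (real j) i * bprod q j) - (2 * q - real i) * (ffall (real j) (Suc i) * bprod q j)) sums 0"
  proof (rule telescope_suminf_zero[OF growA])
    fix j
    have "ffall (real (Suc j)) (Suc i) * (real (Suc j) + 1) * bprod q (Suc j)
        = ffall (real j) i * ((real j + 1) * (real j + 2) * bprod q (Suc j))"
      using ffall_Suc'[of "real j + 1" i] by (simp add: mult_ac add.commute)
    also have "\<dots> = ffall (real j) i * ((q - real j) * (q - 1 - real j) * bprod q j)" by (simp only: shift)
    finally show "(q - real i) * (q - real i - 1) * (ffall (real j) i * bprod q j) - (2 * q - real i) * (ffall (real j) (Suc i) * bprod q j)
      = ffall (real (Suc j)) (Suc i) * (real (Suc j) + 1) * bprod q (Suc j) - ffall (real j) (Suc i) * (real j + 1) * bprod q j"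
      by (simp add: ffall_Suc algebra_simps)
  qed (simp add: ffall_Suc')
  have B: "(\<lambda>j. (q - real i) * (q - real i - 1) * (ffall (q - 1 - real j) i * bprod q j) - (2 * q - real i) * (ffall (q - 1 - real j) (Suc i) * bprod q j)) sums 0"
  proof -
    have "(\<lambda>j. - ((q - real i) * (q - real i - 1) * (ffall (q - 1 - real j) i * bprod q j) - (2 * q - real i) * (ffall (q - 1 - real j) (Suc i) * bprod q j))) sums 0"
    proof (rule telescope_suminf_zero[OF growB])
      fix j
      have "real (Suc j) * (real (Suc j) + 1) * ffall (q - 1 - real (Suc j)) i * bprod q (Suc j)
        = ffall (q - 1 - real j - 1) i * ((real j + 1) * (real j + 2) * bprod q (Suc j))"
        by (simp add: algebra_simps)
      also have "\<dots> = (q - real j) * bprod q j * ((q - 1 - real j) * ffall (q - 1 - real j - 1) i)"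
        unfolding bprod_rec by (simp only: mult_ac)
      also have "\<dots> = (q - real j) * bprod q j * (ffall (q - 1 - real j) i * (q - 1 - real j - real i))"
        by (simp only: ffall_shift)
      finally show "- ((q - real i) * (q - real i - 1) * (ffall (q - 1 - real j) i * bprod q j) - (2 * q - real i) * (ffall (q - 1 - real j) (Suc i) * bprod q j))
        = real (Suc j) * (real (Suc j) + 1) * ffall (q - 1 - real (Suc j)) i * bprod q (Suc j) - real j * (real j + 1) * ffall (q - 1 - real j) i * bprod q j"
        by (simp add: ffall_Suc algebra_simps)
    qed simp
    from sums_minus[OF this] show ?thesis by simp
  qed
  have iq: "2 * q - real i \<noteq> 0" using Suc k by auto
  have i: "i \<le> k + 1" "Suc i \<le> k + 1" using Suc by auto
  have "(q - real i) * (q - real i - 1) * (\<Sum>j. ffall (real j) i * bprod q j) - (2 * q - real i) * (\<Sum>j. ffall (real j) (Suc i) * bprod q j) = 0"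
    by (rule sums_unique2[OF _ A]) (intro sums_diff sums_mult summable_sums sA i)
  moreover have "(q - real i) * (q - real i - 1) * (\<Sum>j. ffall (q - 1 - real j) i * bprod q j) - (2 * q - real i) * (\<Sum>j. ffall (q - 1 - real j) (Suc i) * bprod q j) = 0"
    by (rule sums_unique2[OF _ B]) (intro sums_diff sums_mult summable_sums sB i)
  ultimately have "(2 * q - real i) * (\<Sum>j. ffall (real j) (Suc i) * bprod q j) = (2 * q - real i) * (\<Sum>j. ffall (q - 1 - real j) (Suc i) * bprod q j)"
    using Suc.IH i by simp
  then show ?case using iq by simp
qed

section \<open>The series inside and outside the unit circle\<close>

lemma norm_powr_of_real: "norm (w powr complex_of_real q) = norm w powr q"
  by (cases "w = 0") (auto simp: powr_def norm_exp_eq_Re)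

lemma gbinomial_abs_summable:
  assumes k: "real k < q" "k \<ge> 1"
  shows "summable (\<lambda>j. \<bar>q gchoose j\<bar>)"
proof -
  obtain C where C: "\<And>j. real j \<ge> q \<Longrightarrow> \<bar>q gchoose j\<bar> * real j ^ (k+1) \<le> C"
    using gbinomial_decay[OF k(1)] by blast
  show ?thesis
  proof (rule summable_comparison_test_ev)
    show "summable (\<lambda>j. C * inverse (real j ^ (k+1)))"
      by (intro summable_mult inverse_power_summable) (use k in simp)
    show "\<forall>\<^sub>F j in sequentially. norm \<bar>q gchoose j\<bar> \<le> C * inverse (real j ^ (k+1))"
      using eventually_ge_at_top[of "nat \<lceil>q\<rceil>"] eventually_gt_at_top[of 0]
    proof eventually_elim
      case (elim j)
      then have "real j \<ge> q" by linarith
      then show ?case using C[of j] elim(2) by (simp add: field_simps)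
    qed
  qed
qed

lemma integral_cos_diff_cos:
  "integral {0..pi} (\<lambda>y. cos ((real i - real l) * y) * cos y) = (if i = Suc l \<or> l = Suc i then pi / 2 else 0)"
proof -
  obtain d where d: "\<And>y. cos ((real i - real l) * y) = cos (real d * y)" "d + 2 * min i l = i + l" "max i l = d + min i l"
    using cos_nat_diff by metis
  have "d = 1 \<longleftrightarrow> i = Suc l \<or> l = Suc i" using d(2,3) by linarith
  then show ?thesis unfolding d(1) by (simp add: integral_unique[OF integral_cos_multiple_cos])
qed

text \<open>Only pairs with \<open>i\<close> and \<open>l\<close> neighbouring survive. Each pair
  \<open>{j, j+1}\<close> occurs in both orders with the integral \<open>pi / 2\<close>, which gives
  the factor \<open>pi\<close>; \<open>Suc M\<close> terms of the series have \<open>M\<close>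
  neighbouring pairs.\<close>

lemma inner_partial_sum:
  fixes c :: "nat \<Rightarrow> real"
  shows "(\<Sum>i<Suc M. \<Sum>l<Suc M. c i * c l * \<rho> ^ (i+l) * integral {0..pi} (\<lambda>y. cos ((real i - real l) * y) * cos y))
    = pi * \<rho> * (\<Sum>j<M. (c j * c (Suc j)) * (\<rho>\<^sup>2) ^ j)"
proof (induction M)
  case 0
  then show ?case by (simp add: integral_cos_diff_cos)
next
  case (Suc M)
  let ?t = "\<lambda>i l. c i * c l * \<rho> ^ (i+l) * integral {0..pi} (\<lambda>y. cos ((real i - real l) * y) * cos y)"
  have 1: "(\<Sum>l<Suc M. ?t (Suc M) l) = c M * c (Suc M) * \<rho> ^ (2*M+1) * (pi/2)"
  proof -
    have "(\<Sum>l<Suc M. ?t (Suc M) l) = (\<Sum>l<Suc M. if l = M then c M * c (Suc M) * \<rho> ^ (2*M+1) * (pi/2) else 0)"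
    proof (intro sum.cong refl)
      fix l assume "l \<in> {..<Suc M}"
      moreover have "Suc M + M = 2*M+1" by simp
      ultimately show "?t (Suc M) l = (if l = M then c M * c (Suc M) * \<rho> ^ (2*M+1) * (pi/2) else 0)"
        unfolding integral_cos_diff_cos by (cases "l = M") (simp_all add: mult_2)
    qed
    then show ?thesis by simp
  qed
  have 2: "(\<Sum>i<Suc M. ?t i (Suc M)) = c M * c (Suc M) * \<rho> ^ (2*M+1) * (pi/2)"
  proof -
    have "(\<Sum>i<Suc M. ?t i (Suc M)) = (\<Sum>i<Suc M. if i = M then c M * c (Suc M) * \<rho> ^ (2*M+1) * (pi/2) else 0)"
    proof (intro sum.cong refl)
      fix i assume "i \<in> {..<Suc M}"
      moreover have "M + Suc M = 2*M+1" by simp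
      ultimately show "?t i (Suc M) = (if i = M then c M * c (Suc M) * \<rho> ^ (2*M+1) * (pi/2) else 0)"
        unfolding integral_cos_diff_cos by (cases "i = M") (simp_all add: mult_2)
    qed
    then show ?thesis by simp
  qed
  have "(\<Sum>i<Suc (Suc M). \<Sum>l<Suc (Suc M). ?t i l)
     = (\<Sum>i<Suc M. \<Sum>l<Suc M. ?t i l) + (\<Sum>i<Suc M. ?t i (Suc M)) + ((\<Sum>l<Suc M. ?t (Suc M) l) + ?t (Suc M) (Suc M))"
    by (simp only: sum.lessThan_Suc[of _ "Suc M"] sum.distrib)
  also have "?t (Suc M) (Suc M) = 0" by (simp only: integral_cos_diff_cos) simp
  also have "(\<Sum>i<Suc M. \<Sum>l<Suc M. ?t i l) + (\<Sum>i<Suc M. ?t i (Suc M)) + ((\<Sum>l<Suc M. ?t (Suc M) l) + 0)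
      = pi * \<rho> * (\<Sum>j<M. (c j * c (Suc j)) * (\<rho>\<^sup>2) ^ j) + c M * c (Suc M) * \<rho> ^ (2*M+1) * pi"
    unfolding Suc.IH 1 2 by (simp add: field_simps)
  also have "\<dots> = pi * \<rho> * (\<Sum>j<Suc M. (c j * c (Suc j)) * (\<rho>\<^sup>2) ^ j)"
  proof -
    have e: "\<rho> ^ (2*M+1) = \<rho> * (\<rho>\<^sup>2) ^ M" by (simp add: power_mult)
    show ?thesis unfolding e by (simp add: algebra_simps)
  qed
  finally show ?case .
qed

text \<open>With \<open>Y = \<rho> * cis y\<close>, \<open>tri_sq \<rho> y powr q\<close> is the
  squared modulus of the binomial series for \<open>(1 + Y) powr q\<close>. Squaring partial sums
  keeps every step a finite Fourier expansion; dominated convergence applies because the binomial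
  coefficients are absolutely summable.\<close>

lemma inner_coeff_powr_small:
  assumes k: "real k < q" "k \<ge> 1" and r: "\<bar>\<rho>\<bar> < 1"
  shows "inner_coeff (\<lambda>u. u powr q) \<rho> = pi * \<rho> * (\<Sum>j. bprod q j * (\<rho>\<^sup>2) ^ j)"
proof -
  define c where "c j = q gchoose j" for j
  define s where "s M y = (\<Sum>i<Suc M. complex_of_real (c i) * (complex_of_real \<rho> * cis y) ^ i)" for M y
  define B where "B = (\<Sum>j. \<bar>c j\<bar>)"
  have q: "q > 0" using k by auto
  have B: "norm (s M y) \<le> B" for M y
  proof -
    have "norm (s M y) \<le> (\<Sum>i<Suc M. \<bar>c i\<bar> * \<bar>\<rho>\<bar> ^ i)"
      unfolding s_def by (rule order_trans[OF norm_sum]) (simp add: norm_mult norm_power del: sum.lessThan_Suc)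
    also have "\<dots> \<le> (\<Sum>i<Suc M. \<bar>c i\<bar> * 1)"
      using r by (intro sum_mono mult_left_mono power_le_one) auto
    also have "\<dots> \<le> B" unfolding B_def
      using sum_le_suminf[OF gbinomial_abs_summable[OF k], of "{..<Suc M}"] by (simp add: c_def)
    finally show ?thesis .
  qed
  have B0: "0 \<le> B" using order_trans[OF norm_ge_zero B] .
  have cont: "continuous_on {0..pi} (\<lambda>y. (norm (s M y))\<^sup>2 * cos y)" for M
    unfolding s_def cis_conv_exp by (intro continuous_intros)
  have lim: "(\<lambda>M. (norm (s M y))\<^sup>2 * cos y) \<longlonglongrightarrow> tri_sq \<rho> y powr q * cos y" for y
  proof -
    let ?Y = "complex_of_real \<rho> * cis y"
    have "norm ?Y < 1" using r by (simp add: norm_mult)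
    then have "(\<lambda>n. (complex_of_real q gchoose n) * ?Y ^ n) sums (1 + ?Y) powr complex_of_real q"
      by (rule gen_binomial_complex)
    then have "(\<lambda>n. complex_of_real (c n) * ?Y ^ n) sums (1 + ?Y) powr complex_of_real q"
      by (simp add: c_def gbinomial_prod_rev)
    then have "(\<lambda>M. s M y) \<longlonglongrightarrow> (1 + ?Y) powr complex_of_real q"
      unfolding s_def sums_def by (rule LIMSEQ_Suc)
    then have "(\<lambda>M. (norm (s M y))\<^sup>2 * cos y) \<longlonglongrightarrow> (norm ((1 + ?Y) powr complex_of_real q))\<^sup>2 * cos y"
      by (intro tendsto_intros)
    moreover have "(norm ((1 + ?Y) powr complex_of_real q))\<^sup>2 = tri_sq \<rho> y powr q"
      unfolding norm_powr_of_real tri_sq_eq_norm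
      by (simp add: power2_eq_square powr_mult)
    ultimately show ?thesis by simp
  qed
  have "(\<lambda>M. integral {0..pi} (\<lambda>y. (norm (s M y))\<^sup>2 * cos y)) \<longlonglongrightarrow> integral {0..pi} (\<lambda>y. tri_sq \<rho> y powr q * cos y)"
  proof (rule dominated_convergence(2)[where h = "\<lambda>_. B\<^sup>2"])
    show "(\<lambda>y. (norm (s M y))\<^sup>2 * cos y) integrable_on {0..pi}" for M
      by (intro integrable_continuous_real cont)
    show "(\<lambda>y. B\<^sup>2) integrable_on {0..pi}" by (intro integrable_const_ivl)
    show "norm ((norm (s M y))\<^sup>2 * cos y) \<le> B\<^sup>2" for M y
    proof -
      have "(norm (s M y))\<^sup>2 * \<bar>cos y\<bar> \<le> B\<^sup>2 * 1"
        using B B0 by (intro mult_mono power_mono) auto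
      then show ?thesis by (simp add: abs_mult)
    qed
  qed (rule lim)
  moreover have "integral {0..pi} (\<lambda>y. (norm (s M y))\<^sup>2 * cos y) = pi * \<rho> * (\<Sum>j<M. bprod q j * (\<rho>\<^sup>2) ^ j)" for M
  proof -
    have "integral {0..pi} (\<lambda>y. (norm (s M y))\<^sup>2 * cos y)
       = integral {0..pi} (\<lambda>y. \<Sum>i\<le>M. \<Sum>l\<le>M. (c i * c l * \<rho> ^ (i+l)) * (cos ((real i - real l) * y) * cos y))"
      unfolding s_def norm_sq_partial_sum unfolding lessThan_Suc_atMost by (simp add: sum_distrib_right mult.assoc)
    also have "\<dots> = (\<Sum>i\<le>M. \<Sum>l\<le>M. (c i * c l * \<rho> ^ (i+l)) * integral {0..pi} (\<lambda>y. cos ((real i - real l) * y) * cos y))"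
      by (rule integral_double_sum) (intro integrable_continuous_real continuous_intros)
    also have "\<dots> = pi * \<rho> * (\<Sum>j<M. (c j * c (Suc j)) * (\<rho>\<^sup>2) ^ j)"
      using inner_partial_sum[where c = c and M = M and \<rho> = \<rho>] unfolding lessThan_Suc_atMost .
    finally show ?thesis by (simp add: c_def bprod_def)
  qed
  ultimately have "(\<lambda>M. pi * \<rho> * (\<Sum>j<M. bprod q j * (\<rho>\<^sup>2) ^ j)) \<longlonglongrightarrow> integral {0..pi} (\<lambda>y. tri_sq \<rho> y powr q * cos y)"
    by simp
  moreover have "summable (\<lambda>j. bprod q j * (\<rho>\<^sup>2) ^ j)"
  proof (rule summable_comparison_test)
    show "summable (\<lambda>j. \<bar>1 * bprod q j\<bar>)"
      by (rule bprod_poly_summable[OF k, of _ 1]) (auto simp: one_le_power)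
    have "(\<rho>\<^sup>2) ^ j \<le> 1" for j by (rule power_le_one) (use r in \<open>auto simp: abs_square_le_1\<close>)
    then have "\<bar>bprod q j\<bar> * (\<rho>\<^sup>2) ^ j \<le> \<bar>bprod q j\<bar> * 1" for j by (intro mult_left_mono) auto
    then show "\<exists>N. \<forall>n\<ge>N. norm (bprod q n * (\<rho>\<^sup>2) ^ n) \<le> \<bar>1 * bprod q n\<bar>" by (simp add: abs_mult)
  qed
  then have "(\<lambda>M. pi * \<rho> * (\<Sum>j<M. bprod q j * (\<rho>\<^sup>2) ^ j)) \<longlonglongrightarrow> pi * \<rho> * (\<Sum>j. bprod q j * (\<rho>\<^sup>2) ^ j)"
    by (intro tendsto_mult tendsto_const summable_LIMSEQ)
  ultimately show ?thesis unfolding inner_coeff_def by (rule LIMSEQ_unique)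
qed

text \<open>Inversion \<open>\<rho> \<mapsto> 1/\<rho>\<close>, under which \<open>tri_sq\<close>
  only acquires the factor \<open>\<rho>\<^sup>2\<close>, reduces this to the case inside the unit
  circle.\<close>

lemma inner_coeff_powr_large:
  assumes k: "real k < q" "k \<ge> 1" and r: "\<bar>\<rho>\<bar> > 1"
  shows "inner_coeff (\<lambda>u. u powr q) \<rho> = pi * \<rho> * ((\<rho>\<^sup>2) powr (q - 1) * (\<Sum>j. bprod q j * (1 / \<rho>\<^sup>2) ^ j))"
proof -
  have r0: "\<rho> \<noteq> 0" using r by auto
  have scale: "tri_sq \<rho> y = \<rho>\<^sup>2 * tri_sq (1 / \<rho>) y" for y
    using r0 by (simp add: tri_sq_def field_simps power2_eq_square)
  have "tri_sq (1 / \<rho>) y \<ge> 0" for y unfolding tri_sq_eq_norm by simp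
  then have "inner_coeff (\<lambda>u. u powr q) \<rho> = integral {0..pi} (\<lambda>y. (\<rho>\<^sup>2) powr q * (tri_sq (1 / \<rho>) y powr q * cos y))"
    unfolding inner_coeff_def scale by (simp add: powr_mult mult.assoc)
  also have "\<dots> = (\<rho>\<^sup>2) powr q * inner_coeff (\<lambda>u. u powr q) (1 / \<rho>)"
    unfolding inner_coeff_def by simp
  also have "inner_coeff (\<lambda>u. u powr q) (1 / \<rho>) = pi * (1 / \<rho>) * (\<Sum>j. bprod q j * ((1 / \<rho>)\<^sup>2) ^ j)"
    by (rule inner_coeff_powr_small[OF k]) (use r in simp)
  finally have "inner_coeff (\<lambda>u. u powr q) \<rho> = (\<rho>\<^sup>2) powr q * (pi * (1 / \<rho>) * (\<Sum>j. bprod q j * (1 / \<rho>\<^sup>2) ^ j))"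
    by (simp add: power_divide)
  moreover have "(\<rho>\<^sup>2) powr q = \<rho>\<^sup>2 * (\<rho>\<^sup>2) powr (q - 1)"
    using r0 powr_add[of "\<rho>\<^sup>2" 1 "q - 1"] by simp
  ultimately show ?thesis using r0 by (simp add: power2_eq_square)
qed

text \<open>Coefficients of the \<open>i\<close>-th derivative: \<open>Acoef\<close> of the power
  series at 0, reindexed so that it starts at \<open>v^0\<close>; \<open>Bcoef\<close> of the
  expansion in \<open>v powr (q - 1 - j)\<close>, with \<open>v powr (q - 1 - i)\<close> taken out
  so that a power series in \<open>1/v\<close> remains.\<close>

definition Acoef :: "real \<Rightarrow> nat \<Rightarrow> nat \<Rightarrow> real" where
  "Acoef q i j = ffall (real (j + i)) i * bprod q (j + i)"

definition Bcoef :: "real \<Rightarrow> nat \<Rightarrow> nat \<Rightarrow> real" where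
  "Bcoef q i j = ffall (q - 1 - real j) i * bprod q j"

text \<open>The \<open>i\<close>-th derivative of \<open>v \<mapsto> inner_coeff (\<lambda>u. u powr q) (sqrt v) / (pi * sqrt v)\<close>.\<close>

definition Hfun :: "real \<Rightarrow> nat \<Rightarrow> real \<Rightarrow> real" where
  "Hfun q i v = (if v \<le> 1 then (\<Sum>j. Acoef q i j * v ^ j)
     else v powr (q - 1 - real i) * (\<Sum>j. Bcoef q i j * (1 / v) ^ j))"

lemma inner_coeff_powr:
  assumes k: "real k < q" "k \<ge> 1" and r: "\<rho>\<^sup>2 \<noteq> 1"
  shows "inner_coeff (\<lambda>u. u powr q) \<rho> = pi * \<rho> * Hfun q 0 (\<rho>\<^sup>2)"
proof (cases "\<bar>\<rho>\<bar> < 1")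
  case True
  then have "\<rho>\<^sup>2 \<le> 1" by (simp add: abs_square_le_1)
  then show ?thesis using inner_coeff_powr_small[OF k True] by (simp add: Hfun_def Acoef_def)
next
  case False
  then have "\<bar>\<rho>\<bar> \<noteq> 1" using r by (metis abs_square_eq_1)
  then have r1: "\<bar>\<rho>\<bar> > 1" using False by simp
  then have "\<not> \<rho>\<^sup>2 \<le> 1" by (simp add: abs_square_le_1 not_le)
  then show ?thesis using inner_coeff_powr_large[OF k r1] by (simp add: Hfun_def Bcoef_def)
qed

lemma coef_abs_summable:
  assumes k: "real k < q" "k \<ge> 4" and i: "i \<le> k + 1"
  shows "summable (\<lambda>j. \<bar>Acoef q i j\<bar>)" and "summable (\<lambda>j. \<bar>Bcoef q i j\<bar>)"
proof -
  have q: "q > 0" "k \<ge> 1" using k by auto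
  have "summable (\<lambda>j. \<bar>ffall (real j) i * bprod q j\<bar>)"
    by (rule bprod_ffall_summable[OF k(1) q(2)], rule ffall_bounds(1)[OF _ q(1)]) (use i k in auto)
  then show "summable (\<lambda>j. \<bar>Acoef q i j\<bar>)"
    unfolding Acoef_def using summable_iff_shift[of "\<lambda>j. \<bar>ffall (real j) i * bprod q j\<bar>" i] by simp
  show "summable (\<lambda>j. \<bar>Bcoef q i j\<bar>)" unfolding Bcoef_def
    by (rule bprod_ffall_summable[OF k(1) q(2)], rule ffall_bounds(2)[OF _ q(1)]) (use i k in auto)
qed

lemma Acoef_Bcoef_match:
  assumes k: "real k < q" "k \<ge> 4" and i: "i \<le> k + 1"
  shows "(\<Sum>j. Acoef q i j) = (\<Sum>j. Bcoef q i j)"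
proof -
  have q: "q > 0" "k \<ge> 1" using k by auto
  have s: "summable (\<lambda>j. ffall (real j) i * bprod q j)"
    by (rule summable_rabs_cancel, rule bprod_ffall_summable[OF k(1) q(2)], rule ffall_bounds(1)[OF _ q(1)]) (use i k in auto)
  have "(\<Sum>j. ffall (real j) i * bprod q j) = (\<Sum>j. Acoef q i j) + (\<Sum>j<i. ffall (real j) i * bprod q j)"
    unfolding Acoef_def by (rule suminf_split_initial_segment[OF s])
  also have "(\<Sum>j<i. ffall (real j) i * bprod q j) = 0"
    by (intro sum.neutral) (auto simp: ffall_of_nat_zero)
  finally show ?thesis using ffall_series_match[OF k i] by (simp add: Bcoef_def)
qed

lemma continuous_on_abs_summable_powser:
  fixes c :: "nat \<Rightarrow> real"
  assumes "summable (\<lambda>j. \<bar>c j\<bar>)"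
  shows "continuous_on {-1..1} (\<lambda>x. \<Sum>j. c j * x ^ j)"
proof (rule uniform_limit_theorem)
  show "uniform_limit {-1..1} (\<lambda>n x. \<Sum>j<n. c j * x ^ j) (\<lambda>x. \<Sum>j. c j * x ^ j) sequentially"
  proof (rule Weierstrass_m_test[OF _ assms])
    fix n and x :: real assume "x \<in> {-1..1}"
    then have "\<bar>x\<bar> ^ n \<le> 1" by (intro power_le_one) auto
    then have "\<bar>c n\<bar> * \<bar>x\<bar> ^ n \<le> \<bar>c n\<bar> * 1" by (intro mult_left_mono) auto
    then show "norm (c n * x ^ n) \<le> \<bar>c n\<bar>" by (simp add: abs_mult power_abs)
  qed
  show "\<forall>\<^sub>F n in sequentially. continuous_on {-1..1} (\<lambda>x. \<Sum>j<n. c j * x ^ j)"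
    by (intro always_eventually allI continuous_intros)
qed simp

lemma abs_summable_powser:
  fixes c :: "nat \<Rightarrow> real"
  assumes "summable (\<lambda>j. \<bar>c j\<bar>)" "\<bar>x\<bar> < 1"
  shows "((\<lambda>x. \<Sum>j. c j * x ^ j) has_real_derivative (\<Sum>j. diffs c j * x ^ j)) (at x)"
    and "summable (\<lambda>j. c j * x ^ j)" and "(\<lambda>j. real j * c j * x ^ j) sums (x * (\<Sum>j. diffs c j * x ^ j))"
    and "(\<lambda>j. diffs c j * x ^ j) sums (\<Sum>j. diffs c j * x ^ j)"
proof -
  have s: "summable (\<lambda>j. c j * 1 ^ j)" using summable_rabs_cancel[OF assms(1)] by simp
  show "((\<lambda>x. \<Sum>j. c j * x ^ j) has_real_derivative (\<Sum>j. diffs c j * x ^ j)) (at x)"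
    by (rule termdiffs_strong[OF s]) (use assms in auto)
  have ss: "summable (\<lambda>j. c j * y ^ j)" if "norm y < 1" for y
    by (rule powser_inside[OF s]) (use that in auto)
  then show "summable (\<lambda>j. c j * x ^ j)" using assms(2) by simp
  have sd: "summable (\<lambda>j. diffs c j * x ^ j)"
    by (rule termdiff_converges[of x 1]) (use ss assms(2) in auto)
  then show "(\<lambda>j. diffs c j * x ^ j) sums (\<Sum>j. diffs c j * x ^ j)" by (rule summable_sums)
  have "(\<lambda>j. x * (real j * c j * x ^ (j - Suc 0))) sums (x * (\<Sum>j. diffs c j * x ^ j))"
    using sums_mult[OF diffs_equiv[OF sd], of x] by simp
  moreover have "x * (real j * c j * x ^ (j - Suc 0)) = real j * c j * x ^ j" for j by (cases j) auto
  ultimately show "(\<lambda>j. real j * c j * x ^ j) sums (x * (\<Sum>j. diffs c j * x ^ j))" by simp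
qed

lemma diffs_Acoef: "diffs (Acoef q i) = Acoef q (Suc i)"
  by (simp add: fun_eq_iff diffs_def Acoef_def ffall_Suc add.commute)

text \<open>Absolute summability makes each expansion continuous up to \<open>v = 1\<close>, and
  \<open>Acoef_Bcoef_match\<close> glues the two values there.\<close>

lemma continuous_on_Hfun:
  assumes k: "real k < q" "k \<ge> 4" and i: "i \<le> k + 1"
  shows "continuous_on {0..4} (Hfun q i)"
proof -
  have "continuous_on ({0..1} \<union> {1..4}) (\<lambda>v. if v \<le> 1 then (\<Sum>j. Acoef q i j * v ^ j)
     else v powr (q - 1 - real i) * (\<Sum>j. Bcoef q i j * (1 / v) ^ j))"
  proof (rule continuous_on_cases)
    show "continuous_on {0..1} (\<lambda>v. \<Sum>j. Acoef q i j * v ^ j)"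
      by (rule continuous_on_subset[OF continuous_on_abs_summable_powser[OF coef_abs_summable(1)[OF k i]]]) auto
    have "continuous_on {1..4} (\<lambda>v::real. \<Sum>j. Bcoef q i j * (1 / v) ^ j)"
      by (rule continuous_on_compose2[OF continuous_on_abs_summable_powser[OF coef_abs_summable(2)[OF k i]]])
        (auto intro!: continuous_intros simp: field_simps)
    then show "continuous_on {1..4} (\<lambda>v. v powr (q - 1 - real i) * (\<Sum>j. Bcoef q i j * (1 / v) ^ j))"
      by (intro continuous_intros) auto
    show "\<forall>x. x \<in> {0..1} \<and> \<not> x \<le> 1 \<or> x \<in> {1..4} \<and> x \<le> 1 \<longrightarrow>
        (\<Sum>j. Acoef q i j * x ^ j) = x powr (q - 1 - real i) * (\<Sum>j. Bcoef q i j * (1 / x) ^ j)"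
      using Acoef_Bcoef_match[OF k i] by auto
  qed auto
  moreover have "{0..1} \<union> {1..4} = {0..4::real}" by auto
  ultimately show ?thesis unfolding Hfun_def[abs_def] by simp
qed

text \<open>The point 1 is left out; it forms the exceptional set in
  \<open>Rodrigues_piecewise\<close>.\<close>

lemma Hfun_deriv:
  assumes k: "real k < q" "k \<ge> 4" and i: "i \<le> k" and v: "v \<in> {0<..<4} - {1}"
  shows "(Hfun q i has_real_derivative Hfun q (Suc i) v) (at v)"
proof (cases "v < 1")
  case True
  have "((\<lambda>v. \<Sum>j. Acoef q i j * v ^ j) has_real_derivative Hfun q (Suc i) v) (at v)"
    using abs_summable_powser(1)[OF coef_abs_summable(1)[OF k, of i], of v] True v i
    by (simp add: diffs_Acoef Hfun_def)
  then show ?thesis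
  proof (rule has_field_derivative_transform_within_open)
    show "open {0<..<1::real}" by simp
  qed (use True v in \<open>auto simp: Hfun_def\<close>)
next
  case False
  then have v1: "v > 1" using v by auto
  define G where "G x = (\<Sum>j. Bcoef q i j * x ^ j)" for x
  define G' where "G' = (\<Sum>j. diffs (Bcoef q i) j * (1 / v) ^ j)"
  define a where "a = q - 1 - real i"
  have sB: "summable (\<lambda>j. \<bar>Bcoef q i j\<bar>)" by (rule coef_abs_summable(2)[OF k]) (use i in auto)
  have iv: "\<bar>1 / v\<bar> < 1" using v1 by simp
  have dG: "(G has_real_derivative G') (at (1 / v))"
    unfolding G_def[abs_def] G'_def by (rule abs_summable_powser(1)[OF sB iv])
  have "((\<lambda>v. v powr a * G (1 / v)) has_real_derivative (a * v powr (a - 1) * G (1 / v) + v powr a * (G' * (- 1 / v\<^sup>2)))) (at v)"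
  proof -
    have "((\<lambda>v. 1 / v) has_real_derivative (- 1 / v\<^sup>2)) (at v)"
      using v1 by (auto intro!: derivative_eq_intros simp: power2_eq_square)
    from DERIV_chain2[OF dG this] have 1: "((\<lambda>v. G (1 / v)) has_real_derivative (G' * (- 1 / v\<^sup>2))) (at v)" .
    have 2: "((\<lambda>v. v powr a) has_real_derivative (a * v powr (a - 1))) (at v)"
      using v1 by (intro has_real_derivative_powr) auto
    show ?thesis using DERIV_mult[OF 2 1] by (simp add: mult_ac)
  qed
  also have "a * v powr (a - 1) * G (1 / v) + v powr a * (G' * (- 1 / v\<^sup>2)) = v powr (a - 1) * (a * G (1 / v) - 1 / v * G')"
  proof -
    have "v powr a = v * v powr (a - 1)" using v1 powr_add[of v 1 "a - 1"] by simp
    then show ?thesis using v1 by (simp add: field_simps power2_eq_square)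
  qed
  also have "a * G (1 / v) - 1 / v * G' = (\<Sum>j. Bcoef q (Suc i) j * (1 / v) ^ j)"
  proof -
    have "(\<lambda>j. a * (Bcoef q i j * (1 / v) ^ j) - real j * Bcoef q i j * (1 / v) ^ j) sums (a * G (1 / v) - 1 / v * G')"
      unfolding G_def G'_def
      by (intro sums_diff sums_mult summable_sums abs_summable_powser(2)[OF sB iv] abs_summable_powser(3)[OF sB iv])
    moreover have "a * (Bcoef q i j * (1 / v) ^ j) - real j * Bcoef q i j * (1 / v) ^ j = Bcoef q (Suc i) j * (1 / v) ^ j" for j
      by (simp add: Bcoef_def ffall_Suc a_def algebra_simps)
    ultimately show ?thesis by (simp add: sums_iff)
  qed
  finally have "((\<lambda>v. v powr a * G (1 / v)) has_real_derivative Hfun q (Suc i) v) (at v)"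
    using v1 by (simp add: Hfun_def a_def algebra_simps)
  then show ?thesis
  proof (rule has_field_derivative_transform_within_open)
    show "open {1<..<4::real}" by simp
  qed (use v v1 in \<open>auto simp: Hfun_def G_def a_def\<close>)
qed

text \<open>So \<open>Bcoef q i\<close> is a multiple of the coefficient sequence of
  \<open>F(-q, i+1-q; 2; x)\<close>, where \<open>x\<close> stands for \<open>1/v\<close>.\<close>

lemma Bcoef_rec:
  "(real j + 1) * (real j + 2) * Bcoef q i (Suc j) = (real j - q) * (real j + 1 + real i - q) * Bcoef q i j"
proof -
  have "(real j + 1) * (real j + 2) * Bcoef q i (Suc j)
      = ffall (q - 1 - real j - 1) i * ((real j + 1) * (real j + 2) * bprod q (Suc j))"
    by (simp add: Bcoef_def algebra_simps)
  also have "\<dots> = (q - real j) * bprod q j * ((q - 1 - real j) * ffall (q - 1 - real j - 1) i)"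
    unfolding bprod_rec by (simp only: mult_ac)
  also have "\<dots> = (q - real j) * bprod q j * (ffall (q - 1 - real j) i * (q - 1 - real j - real i))"
    by (simp only: ffall_shift)
  also have "\<dots> = (real j - q) * (real j + 1 + real i - q) * Bcoef q i j"
    by (simp add: Bcoef_def algebra_simps)
  finally show ?thesis .
qed

section \<open>Sign and size of the derivative of order k + 1\<close>

lemma ffall_ge_fact:
  assumes "real k < q"
  shows "fact k * (q - real k) \<le> ffall q (k + 1)"
proof -
  have "(\<Prod>l<k. real k - real l) \<le> (\<Prod>l<k. q - real l)"
    using assms by (intro prod_mono) auto
  moreover have "(\<Prod>l<k. real k - real l) = fact k"
  proof -
    have "(\<Prod>l<k. real k - real l) = (\<Prod>l<k. real (k - l))" by (intro prod.cong refl) (auto simp: of_nat_diff)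
    also have "\<dots> = real (\<Prod>l<k. k - l)" by simp
    also have "(\<Prod>l<k. k - l) = fact k" by (simp add: fact_prod_rev lessThan_atLeast0)
    finally show ?thesis by simp
  qed
  ultimately have "fact k \<le> ffall q k" by (simp add: ffall_def)
  then show ?thesis using assms by (simp add: ffall_Suc mult_right_mono)
qed

text \<open>The source of the sign and of the vanishing factor in the main term:
  \<open>q - k\<close> is the last factor of \<open>ffall q (k+1)\<close>, and the shift from
  \<open>q - 1\<close> to \<open>q\<close> contributes \<open>q - (k+1)\<close>.\<close>

lemma Bcoef_0: "Bcoef q (k + 1) 0 = - ((real k + 1 - q) * ffall q (k + 1))"
proof -
  have "Bcoef q (k + 1) 0 = q * ffall (q - 1) (k + 1)" by (simp add: Bcoef_def bprod_def)
  then show ?thesis unfolding ffall_shift by (simp add: algebra_simps)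
qed

lemma Bcoef_0_neg:
  assumes "real k < q" "q < real k + 1"
  shows "Bcoef q (k + 1) 0 < 0"
proof -
  have "0 < fact k * (q - real k)" using assms by simp
  then have "0 < ffall q (k + 1)" using ffall_ge_fact[OF assms(1)] by linarith
  then show ?thesis unfolding Bcoef_0 using assms by simp
qed

text \<open>From index \<open>k+1\<close> on the binomial coefficients of \<open>q\<close> alternate
  in sign, so products of neighbours are negative.\<close>

lemma bprod_neg:
  assumes q: "real k < q" "q < real k + 1" and j: "k + 1 \<le> j"
  shows "bprod q j < 0"
  using j
proof (induction j rule: dec_induct)
  case base
  have nz: "q gchoose (k+1) \<noteq> 0"
    using q by (simp add: gbinomial_prod_rev)
  have "(real (k+1) + 1) * (q gchoose Suc (k+1)) = (q - real (k+1)) * (q gchoose (k+1))" by (rule gbinomial_Suc_rec)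
  then have "((real (k+1) + 1) * (q gchoose Suc (k+1))) * (q gchoose (k+1)) = ((q - real (k+1)) * (q gchoose (k+1))) * (q gchoose (k+1))"
    by (rule arg_cong[where f="\<lambda>t. t * (q gchoose (k+1))"])
  then have "(real (k+1) + 1) * bprod q (k+1) = (q - real (k+1)) * (q gchoose (k+1))\<^sup>2"
    unfolding bprod_def power2_eq_square by (simp only: mult_ac)
  also have "\<dots> < 0" using q nz by (intro mult_neg_pos) auto
  finally show ?case by (simp add: mult_less_0_iff)
next
  case (step j)
  have "(real j + 1) * (real j + 2) * bprod q (Suc j) = ((q - real j) * (q - 1 - real j)) * bprod q j"
    by (rule bprod_rec)
  also have "\<dots> < 0" using step q by (intro mult_pos_neg mult_neg_neg) auto
  finally show ?case by (simp add: mult_less_0_iff)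
qed

text \<open>Euler's transformation \<open>F(a,b;c;x) = (1-x) powr (c-a-b) F(c-a,c-b;c;x)\<close> makes all coefficients
  positive; instead of the identity we use the differential equation behind it.\<close>

lemma Bcoef_series_upper:
  assumes q: "real k < q" "q < real k + 1" and k: "k \<ge> 4" and x: "0 \<le> x" "x < 1"
  shows "(\<Sum>j. Bcoef q (k+1) j * x ^ j) \<le> Bcoef q (k+1) 0 * (1 - x) powr (2 * q - real k)"
proof -
  define f where "f = Bcoef q (k+1)"
  \<comment> \<open>Thus \<open>y\<^sup>2 * E y\<close> is the primitive of \<open>y * G y\<close>.
    In terms of \<open>e\<close> the coefficient recursion loses its factor \<open>j + 2\<close> and
    becomes the first-order equation \<open>ode\<close> with a positive constant \<open>c\<close>;
    the exponent \<open>s\<close> is \<open>c-a-b\<close> for the parameters \<open>a = -q\<close>,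
    \<open>b = k+2-q\<close>, \<open>c = 2\<close> of the hypergeometric series.\<close>
  define e where "e j = f j / (real j + 2)" for j
  define G where "G x = (\<Sum>j. f j * x ^ j)" for x
  define G' where "G' x = (\<Sum>j. diffs f j * x ^ j)" for x
  define E where "E x = (\<Sum>j. e j * x ^ j)" for x
  define E' where "E' x = (\<Sum>j. diffs e j * x ^ j)" for x
  define s where "s = 2 * q - real k"
  define c where "c = (q - real k) * (q + 2)"
  have cpos: "c > 0" using q k by (simp add: c_def)
  have sf: "summable (\<lambda>j. \<bar>f j\<bar>)" unfolding f_def by (rule coef_abs_summable(2)[OF q(1) k]) simp
  have se: "summable (\<lambda>j. \<bar>e j\<bar>)"
  proof (rule summable_comparison_test'[OF sf])
    fix n :: nat
    have "\<bar>f n\<bar> * 1 \<le> \<bar>f n\<bar> * (real n + 2)" by (intro mult_left_mono) auto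
    then show "norm \<bar>e n\<bar> \<le> \<bar>f n\<bar>" by (simp add: e_def field_simps)
  qed
  have dG: "(G has_real_derivative G' y) (at y)" and dE: "(E has_real_derivative E' y) (at y)" if "\<bar>y\<bar> < 1" for y
    unfolding G_def[abs_def] G'_def E_def[abs_def] E'_def
    by (rule abs_summable_powser(1)[OF sf that], rule abs_summable_powser(1)[OF se that])
  have ode: "(1 - y) * G' y + s * G y = c * E y" if y: "\<bar>y\<bar> < 1" for y
  proof -
    have "(\<lambda>j. diffs f j * y ^ j - real j * f j * y ^ j + s * (f j * y ^ j)) sums (G' y - y * G' y + s * G y)"
      unfolding G_def G'_def
      by (intro sums_add sums_diff sums_mult abs_summable_powser[OF sf y] summable_sums)
    moreover have "diffs f j * y ^ j - real j * f j * y ^ j + s * (f j * y ^ j) = c * (e j * y ^ j)" for j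
    proof -
      have f: "f j = (real j + 2) * e j" by (simp add: e_def)
      have "(real j + 2) * ((real j + 1) * f (Suc j)) = (real j + 2) * ((real j - q) * (real j + 1 + real (k+1) - q) * e j)"
        using Bcoef_rec[of j q "k+1"] unfolding f_def[symmetric] f by (simp add: mult_ac)
      then have "(real j + 1) * f (Suc j) = (real j - q) * (real j + 1 + real (k+1) - q) * e j"
        by (subst (asm) mult_left_cancel) auto
      then have "diffs f j = (real j - q) * (real j + 1 + real (k+1) - q) * e j"
        by (simp add: diffs_def add.commute)
      then have "diffs f j - real j * f j + s * f j = c * e j"
        unfolding f s_def c_def by (simp add: algebra_simps)
      then have "(diffs f j - real j * f j + s * f j) * y ^ j = c * e j * y ^ j" by simp
      then show ?thesis by (simp add: algebra_simps)
    qed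
    ultimately have "(\<lambda>j. c * (e j * y ^ j)) sums (G' y - y * G' y + s * G y)" by simp
    moreover have "(\<lambda>j. c * (e j * y ^ j)) sums (c * E y)"
      unfolding E_def by (intro sums_mult summable_sums abs_summable_powser(2)[OF se y])
    ultimately have "G' y - y * G' y + s * G y = c * E y" by (rule sums_unique2)
    then show ?thesis by (simp add: algebra_simps)
  qed
  have dZ: "((\<lambda>y. y\<^sup>2 * E y) has_real_derivative y * G y) (at y)" if y: "\<bar>y\<bar> < 1" for y
  proof -
    have D: "((\<lambda>y. y\<^sup>2 * E y) has_real_derivative (2 * y * E y + y\<^sup>2 * E' y)) (at y)"
      using DERIV_mult[OF DERIV_power[OF DERIV_ident, of 2] dE[OF y]] by (simp add: algebra_simps)
    have "(\<lambda>j. 2 * (e j * y ^ j) + real j * e j * y ^ j) sums (2 * E y + y * E' y)"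
      unfolding E_def E'_def
      by (intro sums_add sums_mult abs_summable_powser[OF se y] summable_sums)
    moreover have "2 * (e j * y ^ j) + real j * e j * y ^ j = f j * y ^ j" for j
    proof -
      have "2 * (e j * y ^ j) + real j * e j * y ^ j = ((real j + 2) * e j) * y ^ j" by (simp add: algebra_simps)
      also have "(real j + 2) * e j = f j" by (simp add: e_def)
      finally show ?thesis .
    qed
    ultimately have "(\<lambda>j. f j * y ^ j) sums (2 * E y + y * E' y)" by simp
    then have "G y = 2 * E y + y * E' y" unfolding G_def by (simp add: sums_iff)
    then have "2 * y * E y + y\<^sup>2 * E' y = y * G y" by (simp add: algebra_simps power2_eq_square)
    then show ?thesis using D by simp
  qed
  have G0: "G 0 = f 0" unfolding G_def by simp
  have f0: "f 0 < 0" unfolding f_def by (rule Bcoef_0_neg[OF q])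
  \<comment> \<open>While \<open>G\<close> stays nonpositive so does \<open>E\<close>, and then
    \<open>ode\<close> says that \<open>G y * (1 - y) powr (- s)\<close> decreases from its value
    \<open>f 0\<close>.\<close>
  have step: "G z \<le> f 0 * (1 - z) powr s" if z: "0 < z" "z < 1" and neg: "\<And>y. 0 \<le> y \<Longrightarrow> y < z \<Longrightarrow> G y \<le> 0" for z
  proof -
    have E: "E y \<le> 0" if y: "0 < y" "y < z" for y
    proof -
      have "y\<^sup>2 * E y \<le> 0\<^sup>2 * E 0"
      proof (rule DERIV_nonpos_imp_nonincreasing[where f="\<lambda>y. y\<^sup>2 * E y" and a=0 and b=y])
        fix t assume t: "0 \<le> t" "t \<le> y"
        show "\<exists>d. ((\<lambda>y. y\<^sup>2 * E y) has_real_derivative d) (at t) \<and> d \<le> 0"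
          using dZ[of t] neg[of t] t y z by (intro exI[of _ "t * G t"]) (auto intro: mult_nonneg_nonpos)
      qed (use y in simp)
      then show ?thesis using y by (simp add: mult_le_0_iff)
    qed
    define W where "W y = G y * (1 - y) powr (- s)" for y
    have dW: "(W has_real_derivative (1 - y) powr (- s - 1) * (c * E y)) (at y)" if y: "0 \<le> y" "y < 1" for y
    proof -
      have "(W has_real_derivative (G' y * (1 - y) powr (- s) + G y * (s * (1 - y) powr (- s - 1)))) (at y)"
      proof -
        have "((\<lambda>y. (1 - y) powr (- s)) has_real_derivative (s * (1 - y) powr (- s - 1))) (at y)"
          using y by (auto intro!: derivative_eq_intros simp: powr_diff)
        from DERIV_mult[OF dG this] y show ?thesis unfolding W_def[abs_def] by (simp add: mult_ac add.commute)
      qed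
      moreover have pw: "(1 - y) powr (- s) = (1 - y) * (1 - y) powr (- s - 1)"
        using y powr_add[of "1 - y" 1 "- s - 1"] by simp
      have "G' y * (1 - y) powr (- s) + G y * (s * (1 - y) powr (- s - 1)) = (1 - y) powr (- s - 1) * ((1 - y) * G' y + s * G y)"
        unfolding pw by (simp add: algebra_simps)
      ultimately show ?thesis using ode[of y] y by simp
    qed
    have "W z \<le> W 0"
    proof (rule DERIV_nonpos_imp_decreasing_open[where f=W and a=0 and b=z])
      show "0 \<le> z" using z by simp
      show "continuous_on {0..z} W"
        using dW z by (intro DERIV_atLeastAtMost_imp_continuous_on) (meson le_less_trans)
      fix y assume "0 < y" "y < z"
      then show "\<exists>d. (W has_real_derivative d) (at y) \<and> d \<le> 0"
        using dW[of y] E[of y] z cpos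
        by (intro exI[of _ "(1 - y) powr (- s - 1) * (c * E y)"]) (auto intro!: mult_nonneg_nonpos)
    qed
    then have "G z * (1 - z) powr (- s) \<le> f 0" by (simp add: W_def G0)
    then have "G z * (1 - z) powr (- s) * (1 - z) powr s \<le> f 0 * (1 - z) powr s" by (intro mult_right_mono) auto
    moreover have one: "(1 - z) powr (- s) * (1 - z) powr s = 1"
      using z by (simp add: powr_add[symmetric])
    ultimately show ?thesis unfolding mult.assoc one by simp
  qed
  \<comment> \<open>Continuation argument: at the least point with \<open>G \<ge> 0\<close> the
    hypothesis of \<open>step\<close> holds, and its conclusion is strictly negative.\<close>
  have neg: "G y < 0" if y: "0 \<le> y" "y < 1" for y
  proof (rule ccontr)
    assume "\<not> G y < 0"
    define S where "S = {t \<in> {0..y}. 0 \<le> G t}"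
    have "continuous_on {0..y} G"
      using dG y by (intro DERIV_atLeastAtMost_imp_continuous_on) force
    then have "closed ({0..y} \<inter> G -` {0..})" by (rule continuous_closed_preimage) auto
    moreover have "S = {0..y} \<inter> G -` {0..}" by (auto simp: S_def)
    moreover have "bounded S" by (rule bounded_subset[of "{0..y}"]) (auto simp: S_def)
    ultimately have "compact S" by (simp add: compact_eq_bounded_closed)
    moreover have "y \<in> S" using y \<open>\<not> G y < 0\<close> by (simp add: S_def)
    ultimately obtain z where z: "z \<in> S" "\<And>t. t \<in> S \<Longrightarrow> z \<le> t" using compact_attains_inf[of S] by blast
    have z0: "z > 0" using z(1) G0 f0 by (cases "z = 0") (auto simp: S_def)
    have zy: "z \<le> y" "0 \<le> G z" using z(1) by (auto simp: S_def)
    have "G t \<le> 0" if "0 \<le> t" "t < z" for t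
    proof (rule ccontr)
      assume "\<not> G t \<le> 0"
      then have "t \<in> S" using that zy by (simp add: S_def)
      then show False using z(2)[of t] that by simp
    qed
    then have "G z \<le> f 0 * (1 - z) powr s" using z0 zy y by (intro step) auto
    also have "\<dots> < 0" using f0 zy y by (intro mult_neg_pos) auto
    finally show False using zy by simp
  qed
  show ?thesis
  proof (cases "x = 0")
    case True
    then show ?thesis using G0 unfolding G_def f_def by simp
  next
    case False
    then have "G x \<le> f 0 * (1 - x) powr s"
      using x neg by (intro step) (auto intro: less_imp_le)
    then show ?thesis unfolding G_def f_def s_def .
  qed
qed

lemma Hfun_upper:
  assumes q: "real k < q" "q < real k + 1" and k: "k \<ge> 4" and v: "v > 1"
  shows "Hfun q (k+1) v \<le> Bcoef q (k+1) 0 * (v powr (q - 2 - real k) * (1 - 1 / v) powr (2 * q - real k))"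
proof -
  have "Hfun q (k+1) v = v powr (q - 2 - real k) * (\<Sum>j. Bcoef q (k+1) j * (1 / v) ^ j)"
    using v by (simp add: Hfun_def algebra_simps)
  also have "\<dots> \<le> v powr (q - 2 - real k) * (Bcoef q (k+1) 0 * (1 - 1 / v) powr (2 * q - real k))"
    by (intro mult_left_mono Bcoef_series_upper[OF q k]) (use v in auto)
  finally show ?thesis by (simp add: mult_ac)
qed

text \<open>On \<open>[0, 1]\<close> every coefficient has the right sign. Beyond 1 the coefficients
  \<open>Bcoef q (k+1) j\<close> alternate for \<open>j \<le> k+1\<close>, so there the sign has to
  come from \<open>Hfun_upper\<close>.\<close>

lemma Hfun_nonpos:
  assumes q: "real k < q" "q < real k + 1" and k: "k \<ge> 4" and v: "0 \<le> v"
  shows "Hfun q (k+1) v \<le> 0"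
proof (cases "v > 1")
  case True
  have "Bcoef q (k+1) 0 * (v powr (q - 2 - real k) * (1 - 1 / v) powr (2 * q - real k)) \<le> 0"
    using Bcoef_0_neg[OF q] by (intro mult_nonpos_nonneg) auto
  then show ?thesis using Hfun_upper[OF q k True] by linarith
next
  case False
  have coef: "Acoef q (k+1) j \<le> 0" for j
    unfolding Acoef_def using bprod_neg[OF q, of "j + (k+1)"] ffall_of_nat_pos[of "k+1" "j+(k+1)"]
    by (intro mult_nonneg_nonpos) auto
  have "summable (\<lambda>j. Acoef q (k+1) j * v ^ j)"
  proof (rule summable_comparison_test'[OF coef_abs_summable(1)[OF q(1) k order_refl]])
    fix n
    have "\<bar>v\<bar> ^ n \<le> 1" using v False by (intro power_le_one) auto
    then have "\<bar>Acoef q (k+1) n\<bar> * \<bar>v\<bar> ^ n \<le> \<bar>Acoef q (k+1) n\<bar> * 1" by (intro mult_left_mono) auto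
    then show "norm (Acoef q (k+1) n * v ^ n) \<le> \<bar>Acoef q (k+1) n\<bar>" by (simp add: abs_mult power_abs)
  qed
  then have "(\<Sum>j. Acoef q (k+1) j * v ^ j) \<le> (\<Sum>j. 0)"
    by (intro suminf_le) (use coef v in \<open>auto intro!: mult_nonpos_nonneg\<close>)
  then show ?thesis using False by (simp add: Hfun_def)
qed

section \<open>Lower bound for the main term\<close>

lemma integral_le_of_nonpos:
  fixes g :: "real \<Rightarrow> real"
  assumes g: "continuous_on {a..b} g" "\<And>x. x \<in> {a..b} \<Longrightarrow> g x \<le> 0"
    and cd: "a \<le> c" "c \<le> d" "d \<le> b" and K: "\<And>x. x \<in> {c..d} \<Longrightarrow> g x \<le> K"
  shows "integral {a..b} g \<le> K * (d - c)"
proof -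
  have sub: "{c..d} \<subseteq> {a..b}" using cd by auto
  have i: "g integrable_on {a..b}" "g integrable_on {c..d}"
    using g(1) continuous_on_subset[OF g(1) sub] by (auto intro: integrable_continuous_real)
  have "integral {c..d} (\<lambda>x. - g x) \<le> integral {a..b} (\<lambda>x. - g x)"
    using g(2) by (intro integral_subset_le sub integrable_neg i) auto
  then have "integral {a..b} g \<le> integral {c..d} g" using i by (simp add: integral_neg)
  also have "\<dots> \<le> integral {c..d} (\<lambda>x. K)" by (intro integral_le i K integrable_const_ivl)
  also have "\<dots> = K * (d - c)" using cd by simp
  finally show ?thesis .
qed

lemma integral_sin_sq: "integral {0..pi} (\<lambda>x. sin x ^ 2) = pi / 2"
proof -
  have "real (0+2+0) * integral {0..pi} (\<lambda>x. cos x ^ (0+2) * sin x ^ 0) = real (0+1) * integral {0..pi} (\<lambda>x. cos x ^ 0 * sin x ^ 0)"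
    by (rule integral_cos_power_sin_power_rec)
  then have c: "integral {0..pi} (\<lambda>x. cos x ^ 2) = pi / 2" by (simp add: numeral_2_eq_2)
  have "integral {0..pi} (\<lambda>x. sin x ^ 2) = integral {0..pi} (\<lambda>x. 1 - cos x ^ 2)" by (simp add: sin_squared_eq)
  also have "\<dots> = integral {0..pi} (\<lambda>x. 1) - integral {0..pi} (\<lambda>x. cos x ^ 2)"
    by (intro integral_diff integrable_continuous_real continuous_intros)
  finally show ?thesis using c by simp
qed

text \<open>This integral stands in the denominator of the main term, hence the upper bound:
  \<open>cos x ^ 2 * sin x ^ 2 \<le> 1/4\<close> is used \<open>k\<close> times and the remaining
  \<open>cos x ^ 4 * sin x ^ 2\<close> is integrated exactly.\<close>

lemma Rodrigues_weight_upper: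
  "integral {0..pi} (\<lambda>x. cos x ^ (2*(k+1)+2) * sin x ^ (2*(k+1))) \<le> (1/4) ^ k * (pi / 16)"
proof -
  have D2: "integral {0..pi} (\<lambda>x. cos x ^ 2 * sin x ^ 2) = pi / 8"
    using integral_cos_power_sin_power_rec[of 0 2] integral_sin_sq by (simp add: numeral_2_eq_2)
  have D4: "integral {0..pi} (\<lambda>x. cos x ^ 4 * sin x ^ 2) = pi / 16"
    using integral_cos_power_sin_power_rec[of 2 2] D2 by simp
  have "integral {0..pi} (\<lambda>x. cos x ^ (2*(k+1)+2) * sin x ^ (2*(k+1))) \<le> integral {0..pi} (\<lambda>x. (1/4) ^ k * (cos x ^ 4 * sin x ^ 2))"
  proof (intro integral_le integrable_continuous_real continuous_intros)
    fix x :: real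
    have "cos x ^ 2 * sin x ^ 2 \<le> 1/4"
    proof -
      have "(a - b)^2 = (a + b)^2 - 4 * (a * b)" for a b :: real by (simp add: power2_eq_square algebra_simps)
      then have "(cos x ^ 2 + sin x ^ 2)^2 - 4 * (cos x ^ 2 * sin x ^ 2) = (cos x ^ 2 - sin x ^ 2)^2" by simp
      also have "0 \<le> \<dots>" by simp
      finally show ?thesis by simp
    qed
    then have "(cos x ^ 2 * sin x ^ 2) ^ k \<le> (1/4) ^ k" by (intro power_mono) auto
    then have "(cos x ^ 2 * sin x ^ 2) ^ k * (cos x ^ 4 * sin x ^ 2) \<le> (1/4) ^ k * (cos x ^ 4 * sin x ^ 2)"
      by (intro mult_right_mono) auto
    moreover have "cos x ^ (2*(k+1)+2) * sin x ^ (2*(k+1)) = (cos x ^ 2 * sin x ^ 2) ^ k * (cos x ^ 4 * sin x ^ 2)"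
      by (simp add: power_mult_distrib power_mult[symmetric] power_add[symmetric] add.commute)
        (simp add: power_add power2_eq_square power4_eq_xxxx)
    ultimately show "cos x ^ (2*(k+1)+2) * sin x ^ (2*(k+1)) \<le> (1/4) ^ k * (cos x ^ 4 * sin x ^ 2)" by simp
  qed
  also have "\<dots> = (1/4) ^ k * (pi / 16)" using D4 by simp
  finally show ?thesis .
qed

text \<open>The weight times the lower bound for the derivative is largest near \<open>v = 5/2\<close>, where
  \<open>(v - 1) (4 - v)\<close> is; on \<open>[2, 3]\<close> this product is at least 2.\<close>

lemma weight_lower:
  assumes q: "real k < q" "q < real k + 1" and v: "2 \<le> v" "v \<le> 3"
  shows "2 ^ k / 4 ^ (2*k+3) \<le> (v/4) ^ (k+2) * (1 - v/4) ^ (k+1) * (v powr (q - 2 - real k) * (1 - 1 / v) powr (2 * q - real k))"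
proof -
  define a where "a = q - real k"
  have a: "0 < a" "a < 1" using q by (auto simp: a_def)
  have vpos: "v > 0" "v - 1 > 0" using v by auto
  \<comment> \<open>After the powers with exponent \<open>k\<close> are removed, what remains is
    \<open>(4 - v) * r powr a\<close> with \<open>0 < a < 1\<close>. Since \<open>r powr a\<close>
    is at least the smaller of 1 and \<open>r\<close>, it suffices that \<open>4 - v\<close> and
    \<open>(4 - v) * r\<close> are at least 1.\<close>
  define r where "r = (v - 1)\<^sup>2 / v"
  have r0: "r > 0" using vpos by (simp add: r_def)
  have "(v - 2) * (2 - (v - 2)\<^sup>2) \<ge> 0"
  proof (intro mult_nonneg_nonneg)
    have "(v - 2)\<^sup>2 \<le> 1\<^sup>2" using v by (intro power_mono) auto
    then show "0 \<le> 2 - (v - 2)\<^sup>2" by simp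
  qed (use v in simp)
  also have "(v - 2) * (2 - (v - 2)\<^sup>2) = (4 - v) * (v - 1)\<^sup>2 - v" by (simp add: power2_eq_square algebra_simps)
  finally have r1: "1 \<le> (4 - v) * r" using vpos by (simp add: r_def field_simps)
  have A: "1 \<le> (4 - v) * r powr a"
  proof (cases "r \<ge> 1")
    case True
    have "1 * 1 \<le> (4 - v) * r powr a" using v True a by (intro mult_mono ge_one_powr_ge_zero) auto
    then show ?thesis by simp
  next
    case False
    then have "r powr 1 \<le> r powr a" using a r0 by (intro powr_mono') auto
    then have "(4 - v) * r \<le> (4 - v) * r powr a" using r0 v by (intro mult_left_mono) auto
    then show ?thesis using r1 by linarith
  qed
  have "0 \<le> (v - 2) * (3 - v)" using v by simp
  then have "2 \<le> (4 - v) * (v - 1)" by (simp add: algebra_simps)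
  then have B: "2 ^ k \<le> ((4 - v) * (v - 1)) ^ k" by (intro power_mono) auto
  have "2 ^ k * 1 \<le> ((4 - v) * (v - 1)) ^ k * ((4 - v) * r powr a)"
    using A B v by (intro mult_mono) auto
  also have "\<dots> = v ^ (k+2) * (4 - v) ^ (k+1) * (v powr (q - 2 - real k) * (1 - 1 / v) powr (2 * q - real k))"
  proof -
    have e1: "1 - 1 / v = (v - 1) / v" using vpos by (simp add: field_simps)
    have e2: "2 * q - real k = real k + (a + a)" "q - 2 - real k = a - 2" by (auto simp: a_def)
    have x1: "(1 - 1 / v) powr (2 * q - real k) = (v - 1) ^ k * ((v - 1) powr a * (v - 1) powr a) / (v ^ k * (v powr a * v powr a))"
    proof -
      have "x powr (real k + (a + a)) = x ^ k * (x powr a * x powr a)" if "x > 0" for x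
        using that by (simp only: powr_add powr_realpow)
      then show ?thesis unfolding e1 e2 using vpos by (simp only: powr_divide less_imp_le)
    qed
    have x2: "v powr (q - 2 - real k) = v powr a / v ^ 2"
      unfolding e2 using vpos by (simp add: powr_diff powr_realpow)
    have x3: "r powr a = (v - 1) powr a * (v - 1) powr a / v powr a"
      unfolding r_def using vpos by (simp add: powr_divide power2_eq_square powr_mult)
    have nz: "v powr a \<noteq> 0" "v ^ k \<noteq> 0" "v \<noteq> 0" using vpos by auto
    show ?thesis unfolding x1 x2 x3 power_mult_distrib power_add using nz by (simp add: field_simps power2_eq_square)
  qed
  finally have "2 ^ k / 4 ^ (2*k+3) \<le> v ^ (k+2) * (4 - v) ^ (k+1) * (v powr (q - 2 - real k) * (1 - 1 / v) powr (2 * q - real k)) / 4 ^ (2*k+3)"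
    by (intro divide_right_mono) auto
  also have "\<dots> = (v/4) ^ (k+2) * (1 - v/4) ^ (k+1) * (v powr (q - 2 - real k) * (1 - 1 / v) powr (2 * q - real k))"
  proof -
    have e1: "1 - v/4 = (4 - v)/4" by simp
    have "2*k+3 = (k+2) + (k+1)" by simp
    then have e2: "(4::real) ^ (2*k+3) = 4 ^ (k+2) * 4 ^ (k+1)" by (simp only: power_add)
    show ?thesis unfolding e1 e2 power_divide
      by (simp only: times_divide_eq_left times_divide_eq_right divide_divide_eq_left mult_ac)
  qed
  finally show ?thesis .
qed

lemma first_coeff_powr_eq:
  assumes q: "real k < q" and k: "k \<ge> 4"
  shows "first_coeff N (\<lambda>u. u powr q) = pi * integral {0..pi} (\<lambda>x. cos (real N * x) * (2 * cos x) * Hfun q 0 (4 * cos x ^ 2))"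
proof -
  have neg: "negligible {arccos (1/2), arccos (-1/2)}" by simp
  have "integral {0..pi} (\<lambda>x. pi * (cos (real N * x) * (2 * cos x) * Hfun q 0 (4 * cos x ^ 2))) = first_coeff N (\<lambda>u. u powr q)"
    unfolding first_coeff_def
  proof (rule integral_spike[OF neg])
    fix x assume x: "x \<in> {0..pi} - {arccos (1/2), arccos (-1/2)}"
    have "4 * cos x ^ 2 \<noteq> 1"
    proof
      assume "4 * cos x ^ 2 = 1"
      then have "(2 * cos x)\<^sup>2 = 1" by (simp add: power_mult_distrib)
      then have "2 * cos x = 1 \<or> 2 * cos x = -1" by (simp only: power2_eq_1_iff)
      then have "cos x = 1/2 \<or> cos x = -1/2" by linarith
      then show False using x by (metis DiffD1 DiffD2 insertCI arccos_cos atLeastAtMost_iff)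
    qed
    then have "inner_coeff (\<lambda>u. u powr q) (2 * cos x) = pi * (2 * cos x) * Hfun q 0 (4 * cos x ^ 2)"
      using inner_coeff_powr[OF q, of "2 * cos x"] k by (simp add: power_mult_distrib)
    then show "cos (real N * x) * inner_coeff (\<lambda>u. u powr q) (2 * cos x) = pi * (cos (real N * x) * (2 * cos x) * Hfun q 0 (4 * cos x ^ 2))"
      by simp
  qed
  then show ?thesis by simp
qed

text \<open>The integrand is nonpositive, so it may be cut down to \<open>2 \<le> v \<le> 3\<close>.
  The constant is \<open>pi^2 * 16 / (64 * 6)\<close>: 16 from the bound on \<open>w\<close>, 64
  from \<open>4 ^ (2*k+3)\<close>, and 6 from the length \<open>pi / 6\<close> of the remaining
  set.\<close>

lemma first_coeff_powr_upper:
  assumes q: "real k < q" "q < real k + 1" and k: "k \<ge> 4"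
  shows "first_coeff (2*k+3) (\<lambda>u. u powr q) \<le> - (pi\<^sup>2 / 24) * ((q - real k) * (real k + 1 - q) / ((real k + 1) * 2 ^ k))"
proof -
  define m where "m = k + 1"
  define w where "w = integral {0..pi} (\<lambda>x. cos x ^ (2*m+2) * sin x ^ (2*m))"
  define g where "g x = cos x ^ (2*m+2) * sin x ^ (2*m) * Hfun q m (4 * cos x ^ 2)" for x :: real
  define K where "K = Bcoef q m 0 * (2 ^ k / 4 ^ (2*k+3))"
  have "integral {0..pi} (\<lambda>x. cos (real (2*m+1) * x) * (2 * cos x) * Hfun q 0 (4 * cos x ^ 2)) = pi / (fact m * w) * integral {0..pi} g"
    unfolding g_def w_def
    by (rule Rodrigues_piecewise[where S="{1}"])
      (use continuous_on_Hfun[OF q(1) k] Hfun_deriv[OF q(1) k] in \<open>auto simp: m_def\<close>)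
  then have eq: "first_coeff (2*k+3) (\<lambda>u. u powr q) = pi * (pi / (fact m * w) * integral {0..pi} g)"
    using first_coeff_powr_eq[OF q(1) k, of "2*k+3"] by (simp add: m_def numeral_3_eq_3)
  have cg: "continuous_on {0..pi} g" unfolding g_def
    by (intro continuous_intros continuous_on_compose2[OF continuous_on_Hfun[OF q(1) k, of m]])
      (use four_cos_sq_bounds in \<open>auto simp: m_def\<close>)
  have g0: "g x \<le> 0" for x
  proof -
    have "0 \<le> cos x ^ (2*m+2) * sin x ^ (2*m)"
      by (metis (no_types) distrib_left mult.right_neutral mult_nonneg_nonneg power_mult zero_le_power2 zero_le_power nat_mult_1_right one_add_one mult_2 power_add)
    then show ?thesis unfolding g_def using Hfun_nonpos[OF q k, of "4 * cos x ^ 2"] by (intro mult_nonneg_nonpos) (auto simp: m_def)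
  qed
  have gK: "g x \<le> K" if v: "2 \<le> 4 * cos x ^ 2" "4 * cos x ^ 2 \<le> 3" for x
  proof -
    define v where "v = 4 * cos x ^ 2"
    have c: "cos x ^ (2*m+2) = (v/4) ^ (k+2)"
    proof -
      have "2*m+2 = 2*(k+2)" by (simp add: m_def)
      then show ?thesis by (simp only: power_mult) (simp add: v_def)
    qed
    have s2: "sin x ^ 2 = 1 - v/4" by (simp add: v_def sin_squared_eq)
    have s: "sin x ^ (2*m) = (1 - v/4) ^ (k+1)" unfolding m_def power_mult s2 ..
    define X where "X = v powr (q - 2 - real k) * (1 - 1 / v) powr (2 * q - real k)"
    have v23: "2 \<le> v" "v \<le> 3" using v by (auto simp: v_def)
    have "g x \<le> (v/4) ^ (k+2) * (1 - v/4) ^ (k+1) * (Bcoef q m 0 * X)"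
      unfolding g_def c s X_def v_def[symmetric] unfolding m_def
      by (intro mult_left_mono Hfun_upper[OF q k]) (use v23 in auto)
    also have "\<dots> = Bcoef q m 0 * ((v/4) ^ (k+2) * (1 - v/4) ^ (k+1) * X)" by (simp only: mult_ac)
    also have "\<dots> \<le> K" unfolding K_def X_def m_def
      by (intro mult_left_mono_neg weight_lower[OF q v23] less_imp_le[OF Bcoef_0_neg[OF q]])
    finally show ?thesis .
  qed
  \<comment> \<open>The value \<open>v = 4 * cos x ^ 2\<close> is 3 at \<open>pi/6\<close> and 2 at
    \<open>pi/4\<close>; \<open>c2\<close> is the mirror image under
    \<open>x \<mapsto> pi - x\<close>. Each interval has length \<open>pi / 12\<close>.\<close>
  have c1: "2 \<le> 4 * cos x ^ 2 \<and> 4 * cos x ^ 2 \<le> 3" if x: "x \<in> {pi/6..pi/4}" for x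
  proof -
    have "cos (pi/4) \<le> cos x" "cos x \<le> cos (pi/6)" using x by (auto intro!: cos_monotone_0_pi_le)
    then have b: "sqrt 2 / 2 \<le> cos x" "cos x \<le> sqrt 3 / 2" by (simp_all add: cos_45 cos_30)
    moreover have "0 \<le> sqrt 2 / 2" by simp
    ultimately have c0: "0 \<le> cos x" by linarith
    have "(sqrt 2 / 2)\<^sup>2 \<le> cos x ^ 2" "cos x ^ 2 \<le> (sqrt 3 / 2)\<^sup>2" using b c0 by (auto intro!: power_mono)
    then show ?thesis by (simp add: power_divide)
  qed
  have c2: "2 \<le> 4 * cos x ^ 2 \<and> 4 * cos x ^ 2 \<le> 3" if x: "x \<in> {3*pi/4..5*pi/6}" for x
    using c1[of "pi - x"] x by (simp add: cos_diff)
  have "integral {0..pi} g = integral {0..pi/2} g + integral {pi/2..pi} g"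
    by (rule Henstock_Kurzweil_Integration.integral_combine[symmetric]) (auto intro: integrable_continuous_real cg)
  also have "\<dots> \<le> K * (pi/4 - pi/6) + K * (5*pi/6 - 3*pi/4)"
  proof (rule add_mono)
    show "integral {0..pi/2} g \<le> K * (pi/4 - pi/6)"
      by (rule integral_le_of_nonpos) (use g0 gK c1 in \<open>auto intro!: continuous_on_subset[OF cg]\<close>)
    show "integral {pi/2..pi} g \<le> K * (5*pi/6 - 3*pi/4)"
      by (rule integral_le_of_nonpos) (use g0 gK c2 in \<open>auto intro!: continuous_on_subset[OF cg]\<close>)
  qed
  finally have I: "integral {0..pi} g \<le> K * (pi / 6)" by (simp add: field_simps)
  have wpos: "w > 0" unfolding w_def using integral_cos_power_sin_power_pos[of "m+1" m] by simp
  have wle: "w \<le> (1/4) ^ k * (pi / 16)" unfolding w_def m_def by (rule Rodrigues_weight_upper)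
  define b where "b = (q - real k) * (real k + 1 - q)"
  have b: "b > 0" using q by (simp add: b_def)
  have "(real k + 1 - q) * (fact k * (q - real k)) \<le> (real k + 1 - q) * ffall q (k + 1)"
    using q by (intro mult_left_mono ffall_ge_fact) auto
  then have "Bcoef q m 0 \<le> - (fact k * b)" unfolding m_def Bcoef_0 b_def by (simp add: mult_ac)
  then have "K \<le> - (fact k * b) * (2 ^ k / 4 ^ (2*k+3))" unfolding K_def by (intro mult_right_mono) auto
  then have "K * (pi / 6) \<le> - (fact k * b) * (2 ^ k / 4 ^ (2*k+3)) * (pi / 6)" by (intro mult_right_mono) auto
  then have "K * (pi / 6) \<le> - ((fact k * b) * (2 ^ k / 4 ^ (2*k+3)) * (pi / 6))" by (simp only: mult_minus_left)
  with I have I2: "integral {0..pi} g \<le> - ((fact k * b) * (2 ^ k / 4 ^ (2*k+3)) * (pi / 6))" by (rule order_trans)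
  have "pi * (pi / (fact m * w)) * integral {0..pi} g \<le> pi * (pi / (fact m * w)) * (- ((fact k * b) * (2 ^ k / 4 ^ (2*k+3)) * (pi / 6)))"
    using I2 wpos by (intro mult_left_mono) auto
  also have "\<dots> = - ((pi * pi / fact m) * ((fact k * b) * (2 ^ k / 4 ^ (2*k+3)) * (pi / 6)) * (1 / w))"
    using wpos by simp
  also have "\<dots> \<le> - ((pi * pi / fact m) * ((fact k * b) * (2 ^ k / 4 ^ (2*k+3)) * (pi / 6)) * (1 / ((1/4) ^ k * (pi / 16))))"
    using wpos wle b by (intro le_imp_neg_le mult_left_mono divide_left_mono mult_nonneg_nonneg mult_pos_pos) auto
  also have "\<dots> = - (pi\<^sup>2 / 24) * (b / ((real k + 1) * 2 ^ k))"
  proof -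
    have f: "fact m = (real k + 1) * (fact k :: real)" by (simp add: m_def add.commute)
    have p: "(4::real) ^ (2*k+3) = 64 * (4 ^ k * (2 ^ k * 2 ^ k))"
      by (simp add: power_add power_mult power_mult_distrib[symmetric])
    have alg: "- ((pi * pi / (n * F)) * ((F * b) * (P / (64 * (Q * (P * P)))) * (pi / 6)) * (1 / (1 / Q * (pi / 16))))
        = - (pi\<^sup>2 / 24) * (b / (n * P))" if "F \<noteq> 0" "n \<noteq> 0" "P \<noteq> 0" "Q \<noteq> 0" for F n P Q :: real
      using that by (simp add: field_simps power2_eq_square)
    show ?thesis unfolding f p power_one_over by (rule alg) auto
  qed
  finally show ?thesis unfolding eq b_def by (simp only: mult.assoc)
qed

section \<open>Upper bound for the approximation error\<close>

lemma prod_lessThan_add: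
  fixes f :: "nat \<Rightarrow> real"
  shows "(\<Prod>i<a+b. f i) = (\<Prod>i<a. f i) * (\<Prod>j<b. f (a + j))"
  by (induction b) (auto simp: mult_ac)

text \<open>An elementary bound for \<open>Gamma(n+2-a) / Gamma(2-a)\<close>; the induction step is
  \<open>(1 - a/y) * (1 + 1/y) powr a \<le> (1 - a/y) * (1 + a/y) \<le> 1\<close>. The decaying
  power is kept because it offsets the factor \<open>9 powr (q - k)\<close> of the error.\<close>

lemma prod_shifted_upper:
  fixes a :: real
  assumes "0 \<le> a" "a \<le> 1"
  shows "(\<Prod>j<n. real (j+2) - a) \<le> fact (n+1) * (2 / (real n + 2)) powr a"
proof (induction n)
  case 0
  then show ?case by simp
next
  case (Suc n)
  define y where "y = real n + 2"
  have y: "y \<ge> 2" by (simp add: y_def)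
  have "0 < 1 + 1/y" using y by (simp add: add_pos_pos)
  then have "(1 + 1/y) powr a \<le> 1 + a * (1/y)"
    using Youngs_inequality_0[of a "1 - a" "1 + 1/y" 1] assms y by (simp add: algebra_simps)
  then have "(1 - a/y) * (1 + 1/y) powr a \<le> (1 - a/y) * (1 + a/y)"
    using assms y by (intro mult_left_mono) (auto simp: field_simps)
  also have "\<dots> = 1 - (a/y)\<^sup>2" by (simp add: power2_eq_square algebra_simps)
  also have "\<dots> \<le> 1" by simp
  finally have "(1 - a/y) * (1 + 1/y) powr a \<le> 1" .
  moreover have "1 + 1/y = (y + 1)/y" using y by (simp add: field_simps)
  ultimately have "(1 - a/y) * ((y+1) powr a / y powr a) \<le> 1" using y by (simp add: powr_divide)
  then have "(1 - a/y) \<le> y powr a / (y+1) powr a" using y by (simp add: field_simps)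
  then have "y * (1 - a/y) \<le> y * (y powr a / (y+1) powr a)" using y by (intro mult_left_mono) auto
  then have step: "y - a \<le> y * (y powr a / (y+1) powr a)" using y by (simp add: algebra_simps)
  have "(\<Prod>j<Suc n. real (j+2) - a) = (\<Prod>j<n. real (j+2) - a) * (y - a)" by (simp add: y_def)
  also have "\<dots> \<le> (fact (n+1) * (2 / y) powr a) * (y * (y powr a / (y+1) powr a))"
  proof (intro mult_mono step)
    show "(\<Prod>j<n. real (j+2) - a) \<le> fact (n+1) * (2 / y) powr a" using Suc by (simp add: y_def)
  qed (use assms y in auto)
  also have "\<dots> = (y * fact (n+1)) * (2 / (y+1)) powr a"
    using y by (simp add: powr_divide)
  also have "y * fact (n+1) = fact (Suc n + 1)" by (simp add: y_def algebra_simps)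
  finally show ?case by (simp add: y_def add_ac)
qed

text \<open>Among the numerators \<open>q - i\<close>, those with \<open>i = k\<close> and
  \<open>i = k+1\<close> give \<open>a * (1 - a)\<close>, the factor also present in the main term.
  The earlier ones are bounded by a factorial, the later \<open>2*k+4\<close> by
  \<open>prod_shifted_upper\<close>. The number \<open>9/7\<close> bounds
  \<open>(9 / (k + 3)) powr a\<close>, as \<open>k + 3 \<ge> 7\<close>.\<close>

lemma cos_pow_coeff_upper:
  assumes q: "real k < q" "q < real k + 1" and k: "k \<ge> 4"
  shows "9 powr q * \<bar>cos_pow_coeff q (3*k+6)\<bar>
    \<le> (q - real k) * (real k + 1 - q) * (9 ^ k * (9/7) * fact (k+1) * fact k * fact (2*k+5) / fact (4*k+6))"
proof -
  define a where "a = q - real k"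
  have a: "0 < a" "a < 1" using q by (auto simp: a_def)
  have num: "(\<Prod>i<3*k+6. \<bar>q - real i\<bar>) \<le> fact (k+1) * (a * (1 - a)) * (fact (2*k+5) * (1 / (real k + 3)) powr a)"
  proof -
    have e: "3*k+6 = (k+2) + (2*k+4)" by simp
    have "(\<Prod>i<3*k+6. \<bar>q - real i\<bar>) = (\<Prod>i<k+2. \<bar>q - real i\<bar>) * (\<Prod>j<2*k+4. \<bar>q - real (k+2+j)\<bar>)"
      unfolding e by (rule prod_lessThan_add)
    also have "(\<Prod>i<k+2. \<bar>q - real i\<bar>) = (\<Prod>i<k. \<bar>q - real i\<bar>) * (a * (1 - a))"
      using q by (simp add: numeral_2_eq_2 a_def)
    also have "(\<Prod>j<2*k+4. \<bar>q - real (k+2+j)\<bar>) = (\<Prod>j<2*k+4. real (j+2) - a)"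
      using q by (intro prod.cong refl) (auto simp: a_def)
    also have "(\<Prod>i<k. \<bar>q - real i\<bar>) * (a * (1 - a)) * (\<Prod>j<2*k+4. real (j+2) - a)
        \<le> fact (k+1) * (a * (1 - a)) * (fact (2*k+5) * (1 / (real k + 3)) powr a)"
    proof (intro mult_mono mult_right_mono)
      have "(\<Prod>i<k. \<bar>q - real i\<bar>) \<le> (\<Prod>i<k. real (k + 1 - i))"
        using q by (intro prod_mono) (auto simp: of_nat_diff)
      also have "\<dots> \<le> (\<Prod>i<k+1. real (k + 1 - i))" by simp
      also have "\<dots> = real (\<Prod>i<k+1. k + 1 - i)" by simp
      also have "(\<Prod>i<k+1. k + 1 - i) = fact (k+1)" by (simp only: fact_prod_rev lessThan_atLeast0 of_nat_id)
      finally show "(\<Prod>i<k. \<bar>q - real i\<bar>) \<le> fact (k+1)" by (simp add: algebra_simps)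
      have "2 / (real (2*k+4) + 2) = 1 / (real k + 3)" by (simp add: field_simps)
      then show "(\<Prod>j<2*k+4. real (j+2) - a) \<le> fact (2*k+5) * (1 / (real k + 3)) powr a"
        using prod_shifted_upper[of a "2*k+4"] a by (simp add: add_ac)
    qed (use a in \<open>auto intro!: prod_nonneg\<close>)
    finally show ?thesis .
  qed
  have den: "fact (4*k+6) / fact k \<le> (\<Prod>i<3*k+6. q + 1 + real i)"
  proof -
    have f: "fact (k + n) = fact k * (\<Prod>i<n. real k + 1 + real i)" for n
      by (induction n) (auto simp: algebra_simps)
    have "fact (4*k+6) / fact k = (\<Prod>i<3*k+6. real k + 1 + real i)"
      using f[of "3*k+6"] by simp
    also have "\<dots> \<le> (\<Prod>i<3*k+6. q + 1 + real i)" using q by (intro prod_mono) auto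
    finally show ?thesis .
  qed
  have "\<bar>cos_pow_coeff q (3*k+6)\<bar> = (\<Prod>i<3*k+6. \<bar>q - real i\<bar>) / (\<Prod>i<3*k+6. q + 1 + real i)"
    using q k by (simp add: cos_pow_coeff_def abs_prod prod_dividef)
  also have "\<dots> \<le> (fact (k+1) * (a * (1 - a)) * (fact (2*k+5) * (1 / (real k + 3)) powr a)) / (fact (4*k+6) / fact k)"
    using a by (intro frac_le num den) auto
  finally have "9 powr q * \<bar>cos_pow_coeff q (3*k+6)\<bar> \<le> 9 powr q * ((fact (k+1) * (a * (1 - a)) * (fact (2*k+5) * (1 / (real k + 3)) powr a)) / (fact (4*k+6) / fact k))"
    by (intro mult_left_mono) auto
  also have "\<dots> = (9 powr q * (1 / (real k + 3)) powr a) * ((a * (1 - a)) * (fact (k+1) * fact k * fact (2*k+5) / fact (4*k+6)))"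
    by simp
  also have "\<dots> \<le> (9 ^ k * (9/7)) * ((a * (1 - a)) * (fact (k+1) * fact k * fact (2*k+5) / fact (4*k+6)))"
  proof (intro mult_right_mono)
    have "9 powr q = 9 ^ k * 9 powr a" by (simp add: a_def powr_diff powr_realpow)
    then have "9 powr q * (1 / (real k + 3)) powr a = 9 ^ k * (9 / (real k + 3)) powr a"
      by (simp add: powr_divide)
    also have "(9 / (real k + 3)) powr a \<le> (9/7) powr a"
      using k a by (intro powr_mono2) (auto simp: field_simps)
    also have "(9/7) powr a \<le> (9/7::real) powr 1" using a by (intro powr_mono) auto
    finally show "9 powr q * (1 / (real k + 3)) powr a \<le> 9 ^ k * (9/7)" by simp
  qed (use a in auto)
  also have "a * (1 - a) = (q - real k) * (real k + 1 - q)" by (simp add: a_def)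
  finally show ?thesis by (simp only: mult_ac times_divide_eq_left times_divide_eq_right)
qed

text \<open>The comparison needs a constant of at least \<open>36 * (11/2) * (5/17)\<close>.\<close>

lemma tail_numeric:
  fixes k :: nat
  assumes "k \<ge> 4"
  shows "60 * ((real k + 1) * 2 ^ k * (9 ^ k * (9/7) * fact (k+1) * fact k * fact (2*k+5) / fact (4*k+6))) < (1::real)"
  using assms
proof (induction k rule: dec_induct)
  \<comment> \<open>The tightest case: the left side is about 0.65. At \<open>k = 3\<close> the same
    expression would exceed 1.\<close>
  case base
  show ?case by (simp add: fact_numeral)
next
  case (step k)
  define x where "x = real k"
  define t where "t = (9 ^ k * (9/7) * fact (k+1) * fact k * fact (2*k+5) / fact (4*k+6) :: real)"
  have t: "t > 0" by (simp add: t_def)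
  have x: "x \<ge> 4" using step by (simp add: x_def)
  have f1: "fact (Suc k + 1) = (x + 2) * (fact (k+1)::real)" by (simp add: x_def algebra_simps)
  have f2: "fact (Suc k) = (x + 1) * (fact k::real)" by (simp add: x_def algebra_simps)
  have e3: "2 * Suc k + 5 = Suc (Suc (2*k+5))" and e4: "4 * Suc k + 6 = Suc (Suc (Suc (Suc (4*k+6))))" by simp_all
  have f3: "fact (2 * Suc k + 5) = (2*x+7) * ((2*x+6) * (fact (2*k+5)::real))"
    unfolding e3 fact_Suc by (simp add: x_def add_ac)
  have f4: "fact (4 * Suc k + 6) = (4*x+10) * ((4*x+9) * ((4*x+8) * ((4*x+7) * (fact (4*k+6)::real))))"
    unfolding e4 fact_Suc by (simp add: x_def add_ac)
  \<comment> \<open>The ratio of \<open>t\<close> at \<open>k+1\<close> to \<open>t\<close> at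
    \<open>k\<close>. The whole left side changes by the factor
    \<open>2 * (x + 2) * R / (x + 1)\<close>, which tends to \<open>9/32\<close>, so crude bounds
    for it suffice.\<close>
  define R where "R = 9 * (x+2) * (x+1) * (2*x+7) * (2*x+6) / ((4*x+10) * (4*x+9) * (4*x+8) * (4*x+7))"
  have "9 ^ Suc k * (9/7) * fact (Suc k + 1) * fact (Suc k) * fact (2 * Suc k + 5) / fact (4 * Suc k + 6) = t * R"
    unfolding f1 f2 f3 f4 t_def R_def using x by (simp add: field_simps)
  then have "60 * ((real (Suc k) + 1) * 2 ^ Suc k * (9 ^ Suc k * (9/7) * fact (Suc k + 1) * fact (Suc k) * fact (2 * Suc k + 5) / fact (4 * Suc k + 6)))
      = 60 * ((x + 1) * 2 ^ k * t) * (2 * (x + 2) * R / (x + 1))"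
    using x by (simp add: x_def field_simps)
  also have "\<dots> \<le> 60 * ((x + 1) * 2 ^ k * t) * 1"
  proof (rule mult_left_mono)
    have p: "0 < (4*x+10) * (4*x+9) * (4*x+8) * (4*x+7)" using x by (intro mult_pos_pos) auto
    have "2 * (x + 2) * R / (x + 1) = 18 * (x+2)^2 * ((2*x+7) * (2*x+6)) / ((4*x+10) * (4*x+9) * (4*x+8) * (4*x+7))"
    proof -
      have "R = 9 * (x+2) * ((2*x+7) * (2*x+6)) / ((4*x+10) * (4*x+9) * (4*x+8) * (4*x+7)) * (x+1)"
        unfolding R_def by (simp only: mult_ac times_divide_eq_left times_divide_eq_right)
      moreover define Z where "Z = ((2*x+7) * (2*x+6)) / ((4*x+10) * (4*x+9) * (4*x+8) * (4*x+7))"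
      ultimately have "R / (x + 1) = 9 * (x+2) * Z" using x by simp
      then have "2 * (x + 2) * (R / (x + 1)) = 18 * (x+2)^2 * Z"
        by (simp add: power2_eq_square algebra_simps)
      then show ?thesis by (simp add: Z_def)
    qed
    also have "\<dots> \<le> 1"
    proof -
      have "(18 * (x+2)^2) * ((2*x+7) * (2*x+6)) = (16 * (x+2)^2) * ((9/8) * ((2*x+7) * (2*x+6)))" by simp
      also have "\<dots> \<le> ((4*x+9) * (4*x+8)) * ((4*x+10) * (4*x+7))"
      proof (rule mult_mono)
        show "16 * (x+2)^2 \<le> (4*x+9) * (4*x+8)" using x by (simp add: power2_eq_square algebra_simps)
        have "(4*x+10) * (4*x+7) - (9/8) * ((2*x+7) * (2*x+6)) = (23/2) * (x * x) + (155/4) * x + 91/4"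
          by (simp add: algebra_simps)
        moreover have "0 \<le> (23/2) * (x * x) + (155/4) * x + 91/4" using x by simp
        ultimately show "(9/8) * ((2*x+7) * (2*x+6)) \<le> (4*x+10) * (4*x+7)" by linarith
      qed (use x in auto)
      finally show ?thesis using p by (simp add: divide_le_eq mult_ac)
    qed
    finally show "2 * (x + 2) * R / (x + 1) \<le> 1" .
  qed (use x t in auto)
  also have "\<dots> < 1" using step by (simp add: x_def t_def)
  finally show ?case .
qed

section \<open>Comparison\<close>

lemma continuous_on_powr_const:
  fixes q :: real
  assumes "q > 0"
  shows "continuous_on {0..} (\<lambda>u. u powr q)"
  by (rule continuous_on_powr'[OF continuous_on_id continuous_on_const]) (use assms in simp)

text \<open>The main term is at most \<open>- pi * b / (6 * M)\<close> and the error is a multiple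
  of \<open>pi * b * t\<close>. Cancelling \<open>pi * b\<close> removes \<open>q\<close> altogether
  and leaves \<open>tail_numeric\<close>, an inequality in \<open>k\<close> alone.\<close>

lemma alt_mean_powr_neg:
  assumes q: "real k < q" "q < real k + 1" and k: "k \<ge> 4"
  shows "alt_mean (2*k+3) (\<lambda>u. u powr q) < 0"
proof -
  define J where "J = 3*k+6"
  define b where "b = (q - real k) * (real k + 1 - q)"
  define t where "t = (9 ^ k * (9/7) * fact (k+1) * fact k * fact (2*k+5) / fact (4*k+6) :: real)"
  define e where "e = 9 powr q * (\<bar>cos_pow_coeff q J\<bar> * (real J + q) / q) / (17/5)"
  define M where "M = (real k + 1) * 2 ^ k"
  have b: "b > 0" using q by (simp add: b_def)
  have M: "M > 0" by (simp add: M_def)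
  have q0: "q > 0" "q \<ge> 4" using q k by auto
  obtain P where P: "degree P < 3 * (k+2)" "\<And>u. u \<in> {0..9} \<Longrightarrow> \<bar>u powr q - poly P u\<bar> \<le> e"
  proof -
    have J: "J \<ge> k + 2" "J = 3 * (k+2)" by (simp_all add: J_def)
    show ?thesis by (rule powr_poly_approx[OF k q J(1)]) (rule that, simp_all only: J(2) e_def)
  qed
  have "alt_mean (2*k+3) (\<lambda>u. u powr q) \<le> 4 / pi * first_coeff (2*k+3) (\<lambda>u. u powr q) + 6 * pi * e"
    by (rule alias_error[OF continuous_on_subset[OF continuous_on_powr_const] P(1) _ P(2)]) (use q0 in auto)
  moreover have "4 / pi * first_coeff (2*k+3) (\<lambda>u. u powr q) \<le> 4 / pi * (- (pi\<^sup>2 / 24) * (b / M))"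
    using first_coeff_powr_upper[OF q k] unfolding b_def M_def by (intro mult_left_mono) auto
  moreover have "4 / pi * (- (pi\<^sup>2 / 24) * (b / M)) = - (pi * b * (1 / (6 * M)))"
    by (simp add: power2_eq_square)
  moreover have "6 * pi * e < pi * b * (1 / (6 * M))"
  proof -
    have A: "9 powr q * \<bar>cos_pow_coeff q J\<bar> \<le> b * t"
      using cos_pow_coeff_upper[OF q k] unfolding b_def t_def J_def .
    have t: "t > 0" by (simp add: t_def)
    \<comment> \<open>Since \<open>q > k \<ge> 4\<close>, the quotient is below
      \<open>1 + (3*k+6)/k\<close>, which is at most \<open>1 + 3 + 6/4\<close>.\<close>
    have "(real J + q) / q \<le> 11/2" using q k q0 by (simp add: J_def field_simps)
    then have "9 powr q * \<bar>cos_pow_coeff q J\<bar> * ((real J + q) / q) \<le> (b * t) * (11/2)"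
      by (rule mult_mono[OF A]) (use b t q0 in auto)
    then have "9 powr q * \<bar>cos_pow_coeff q J\<bar> * ((real J + q) / q) * (5/17) \<le> (b * t) * (11/2) * (5/17)"
      by (rule mult_right_mono) simp
    moreover have "e = 9 powr q * \<bar>cos_pow_coeff q J\<bar> * ((real J + q) / q) * (5/17)" by (simp add: e_def)
    ultimately have "e \<le> b * t * (55/34)" by simp
    then have "6 * pi * e \<le> 6 * pi * (b * t * (55/34))" by (intro mult_left_mono) auto
    also have "\<dots> = pi * b * (165/17 * t)" by simp
    also have "\<dots> < pi * b * (1 / (6 * M))"
    proof (rule mult_strict_left_mono)
      have "60 * (M * t) < 1" using tail_numeric[OF k] unfolding M_def t_def .
      moreover have "0 < M * t" using M t by simp
      ultimately have "(165/17 * t) * (6 * M) < 1" by (simp add: mult_ac)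
      then show "165/17 * t < 1 / (6 * M)" using M by (simp add: field_simps)
    qed (use b in simp)
    finally show ?thesis .
  qed
  ultimately show ?thesis by linarith
qed

section \<open>Reduction of the norms to integrals over half a period\<close>

lemma set_lebesgue_integral_unit_interval_scaled:
  fixes G :: "real \<Rightarrow> real"
  assumes "continuous_on {0..pi} G"
  shows "(LINT x:{0..<1}|lebesgue. G (pi * x)) = integral {0..pi} G / pi"
proof -
  have "continuous_on {0..1} (\<lambda>x. G (pi * x))"
    by (rule continuous_on_compose2[OF assms]) (auto intro!: continuous_intros simp: mult_left_le)
  then have "set_integrable lebesgue {0..1} (\<lambda>x. G (pi * x))"
    by (rule absolutely_integrable_continuous_real)
  then have "set_integrable lebesgue {0..<1} (\<lambda>x. G (pi * x))"
    by (rule set_integrable_subset) auto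
  then have "(LINT x:{0..<1}|lebesgue. G (pi * x)) = integral {0..<1} (\<lambda>x. G (pi * x))"
    by (rule set_lebesgue_integral_eq_integral(2))
  also have "\<dots> = integral {0..1} (\<lambda>x. G (pi * x))"
    by (rule integral_spike_set; rule negligible_subset[of "{1}"]) auto
  also have "{0..1} = (\<lambda>x. x / pi) ` {0..pi}" by (simp add: image_divide_atLeastAtMost)
  also have "integral \<dots> (\<lambda>x. G (pi * x)) = integral {0..pi} G / pi"
    by (subst integral_stretch_real) auto
  finally show ?thesis .
qed

text \<open>With \<open>y = pi * x\<close>, \<open>1 + e(x) = 2 cos y * cis y\<close>. Taking out
  the unimodular last term \<open>cis ((N + 1) * y)\<close> leaves
  \<open>1 + 2 cos y * cis (- N y)\<close>; for the difference of signs,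
  \<open>- cis ((N + 1) * y)\<close> is taken out and the second summand changes sign, which is the
  shift by \<open>pi\<close>.\<close>

lemma norm_trinomial:
  fixes x :: real and k :: nat
  shows "norm (1 + circle_exp x + circle_exp ((real k + 2) * x)) ^ 2 = tri_sq (2 * cos (pi * x)) (real (2*k+3) * (pi * x))"
    and "norm (1 + circle_exp x - circle_exp ((real k + 2) * x)) ^ 2 = tri_sq (2 * cos (pi * x)) (real (2*k+3) * (pi * x) + pi)"
proof -
  define y where "y = pi * x"
  define N where "N = real (2*k+3)"
  have e: "circle_exp t = cis (2 * pi * t)" for t
    by (simp add: circle_exp_def cis_conv_exp mult_ac)
  have e1: "circle_exp x = cis (2 * y)" and e2: "circle_exp ((real k + 2) * x) = cis ((N + 1) * y)"
    unfolding e by (simp_all add: y_def N_def algebra_simps)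
  have "cis (2 * y) = cis y * cis y" by (simp add: cis_mult)
  moreover have "1 = cis (- y) * cis y" by (simp add: cis_mult)
  moreover have "cis (- y) + cis y = complex_of_real (2 * cos y)" by (simp add: complex_eq_iff)
  ultimately have s: "1 + cis (2 * y) = complex_of_real (2 * cos y) * cis y"
    by (metis distrib_right)
  have f: "cis ((N + 1) * y) * cis (- (N * y)) = cis y" by (simp add: cis_mult algebra_simps)
  have g: "E * (1 + c * D) = c * (E * D) + E" "- E * (1 + c * - D) = c * (E * D) - E" for E c D :: complex
    by (simp_all add: algebra_simps)
  have "1 + cis (2 * y) + cis ((N + 1) * y) = cis ((N + 1) * y) * (1 + complex_of_real (2 * cos y) * cis (- (N * y)))"
    unfolding s g(1) f ..
  then have "norm (1 + cis (2 * y) + cis ((N + 1) * y)) ^ 2 = tri_sq (2 * cos y) (- (N * y))"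
    by (simp add: norm_mult tri_sq_eq_norm)
  then show "norm (1 + circle_exp x + circle_exp ((real k + 2) * x)) ^ 2 = tri_sq (2 * cos (pi * x)) (real (2*k+3) * (pi * x))"
    unfolding e1 e2 by (simp add: tri_sq_def y_def N_def)
  have m: "cis (- (N * y) + pi) = - cis (- (N * y))" by (simp add: complex_eq_iff)
  have "1 + cis (2 * y) - cis ((N + 1) * y) = - cis ((N + 1) * y) * (1 + complex_of_real (2 * cos y) * cis (- (N * y) + pi))"
    unfolding s m g(2) f ..
  then have "norm (1 + cis (2 * y) - cis ((N + 1) * y)) ^ 2 = tri_sq (2 * cos y) (- (N * y) + pi)"
    by (simp add: norm_mult tri_sq_eq_norm)
  then show "norm (1 + circle_exp x - circle_exp ((real k + 2) * x)) ^ 2 = tri_sq (2 * cos (pi * x)) (real (2*k+3) * (pi * x) + pi)"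
    unfolding e1 e2 by (simp add: tri_sq_def y_def N_def)
qed

theorem theorem1p1:
  fixes k :: nat and p :: real
  assumes "k \<ge> 4" and "2 * real k < p" and "p < 2 * real k + 2"
  shows "circle_Lp_norm p (\<lambda>x. 1 + circle_exp x - circle_exp ((real k + 2) * x))
       > circle_Lp_norm p (\<lambda>x. 1 + circle_exp x + circle_exp ((real k + 2) * x))"
proof -
  define q where "q = p / 2"
  have q: "real k < q" "q < real k + 1" and q0: "q > 0" using assms by (auto simp: q_def)
  define G where "G t x = tri_sq (2 * cos x) (real (2*k+3) * x + t) powr q" for t x
  have powr: "norm z powr p = (norm z ^ 2) powr q" for z :: complex
    by (simp add: q_def power2_eq_square powr_mult powr_add[symmetric])
  have f: "continuous_on {0..9} (\<lambda>u::real. u powr q)"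
    by (rule continuous_on_subset[OF continuous_on_powr_const[OF q0]]) auto
  have cG: "continuous_on {0..pi} (G t)" for t
    unfolding G_def[abs_def] by (intro continuous_on_comp_tri_sq[OF f] continuous_intros abs_two_cos_le)
  have plus: "circle_Lp_norm p (\<lambda>x. 1 + circle_exp x + circle_exp ((real k + 2) * x)) = (integral {0..pi} (G 0) / pi) powr (1 / p)"
    unfolding circle_Lp_norm_def powr norm_trinomial set_lebesgue_integral_unit_interval_scaled[OF cG, symmetric]
    by (simp add: G_def)
  have minus: "circle_Lp_norm p (\<lambda>x. 1 + circle_exp x - circle_exp ((real k + 2) * x)) = (integral {0..pi} (G pi) / pi) powr (1 / p)"
    unfolding circle_Lp_norm_def powr norm_trinomial set_lebesgue_integral_unit_interval_scaled[OF cG, symmetric]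
    by (simp add: G_def)
  have "integral {0..pi} (G 0) - integral {0..pi} (G pi) = alt_mean (2*k+3) (\<lambda>u. u powr q)"
    unfolding alt_mean_def
    by (subst integral_diff[symmetric]) (auto intro!: integrable_continuous_real cG simp: G_def)
  then have "integral {0..pi} (G 0) < integral {0..pi} (G pi)"
    using alt_mean_powr_neg[OF q assms(1)] by simp
  moreover have "0 \<le> integral {0..pi} (G 0)"
    by (intro integral_nonneg integrable_continuous_real cG) (simp add: G_def)
  ultimately show ?thesis unfolding plus minus
    using assms by (intro powr_less_mono2) (auto intro: divide_strict_right_mono)
qed

end
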